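(* Let $N\ge 1$ and let $V=V_{per}+V_{loc}$, $\Gamma$, $f$ and exponents $2\le q<p<2^*$ satisfy conditions (V), ($\Gamma$), (F1)–(F4) stated in the context. Suppose that $\inf\sigma(-\Delta+V_{per})>0$. If $V_{loc}(x)>0$ for a.e. $x\in\mathbb{R}^N$, then the equation $$-\Delta u+V(x)u=f(x,u)-\Gamma(x)|u|^{q-2}u\quad\text{on }\mathbb{R}^N$$ has no ground states, i.e. there is no $u\in\mathcal{N}$ which is a critical point of $\mathcal{J}$ with $\mathcal{J}(u)=\inf_{\mathcal{N}}\mathcal{J}$.
   Context: All functions are real-valued. $2^*=2N/(N-2)$ if $N\ge 3$ and $2^*=\infty$ if $N=1,2$. "Periodic in $x$" means $\mathbb{Z}^N$-periodic. $\sigma(-\Delta+V_{per})$ denotes the spectrum of $-\Delta+V_{per}$ on $L^2(\mathbb{R}^N)$. Conditions: - (V) $V=V_{per}+V_{loc}$, where $V_{per}\in L^\infty(\mathbb{R}^N)$ is $\mathbb{Z}^N$-periodic, $V_{loc}\in L^\infty(\mathbb{R}^N)$ and $V_{loc}(x)\to 0$ as $|x|\to\infty$. - ($\Gamma$) $\Gamma\in L^\infty(\mathbb{R}^N)$ is periodic in $x\in\mathbb{R}^N$ and $\Gamma(x)\ge 0$ for a.e. $x\in\mathbb{R}^N$. - (F1) $f:\mathbb{R}^N\times\mathbb{R}\to\mathbb{R}$ is measurable, $\mathbb{Z}^N$-periodic in $x\in\mathbb{R}^N$ and continuous in $u\in\mathbb{R}$ for a.e. $x\in\mathbb{R}^N$,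 and there are $c>0$ and $2\le q<p<2^*$ such that $|f(x,u)|\le c(1+|u|^{p-1})$ for all $u\in\mathbb{R}$, $x\in\mathbb{R}^N$. - (F2) $f(x,u)=o(|u|)$ uniformly in $x$ as $|u|\to 0$. - (F3) $F(x,u)/|u|^q\to\infty$ uniformly in $x$ as $|u|\to\infty$, where $F(x,u)=\int_0^u f(x,s)\,ds$. - (F4) $u\mapsto f(x,u)/|u|^{q-1}$ is strictly increasing on $(-\infty,0)$ and on $(0,\infty)$. The same $q$ is used in (F1), (F3), (F4) and in the equation. The energy functional $\mathcal{J}:H^1(\mathbb{R}^N)\to\mathbb{R}$, of class $C^1$, is $$\mathcal{J}(u)=\frac12\int_{\mathbb{R}^N}|\nabla u|^2+V(x)|u|^2\,dx-\int_{\mathbb{R}^N}\Big(F(x,u)-\frac1q\Gamma(x)|u|^q\Big)\,dx,$$ and the Nehari manifold is $\mathcal{N}=\{u\in H^1(\mathbb{R}^N)\setminus\{0\}:\ \mathcal{J}'(u)(u)=0\}$. A ground state is a critical point of $\mathcal{J}$ that is a minimizer of $\mathcal{J}$ on $\mathcal{N}$. *)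

theory Defs
  imports "HOL-Analysis.Analysis"
begin

section \<open>The Hilbert space \<open>L\<^sup>2(\<real>\<^sup>N)\<close>\<close>

definition square_integrable :: "(real^'n \<Rightarrow> real) \<Rightarrow> bool" where
  "square_integrable u \<longleftrightarrow>
     u \<in> borel_measurable lebesgue \<and> integrable lebesgue (\<lambda>x. (u x)\<^sup>2)"

definition L2_eq :: "(real^'n \<Rightarrow> real) \<Rightarrow> (real^'n \<Rightarrow> real) \<Rightarrow> bool" where
  "L2_eq u v \<longleftrightarrow> square_integrable u \<and> square_integrable v \<and> (AE x in lebesgue. u x = v x)"

lemma square_integrable_0: "square_integrable (\<lambda>x. 0)"
  by (simp add: square_integrable_def)

lemma square_integrable_mult:
  assumes "square_integrable u" "square_integrable v"
  shows "integrable lebesgue (\<lambda>x. u x * v x)"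
proof (rule Bochner_Integration.integrable_bound)
  show "integrable lebesgue (\<lambda>x. (u x)\<^sup>2 + (v x)\<^sup>2)"
    using assms by (auto simp: square_integrable_def)
  show "(\<lambda>x. u x * v x) \<in> borel_measurable lebesgue"
    using assms by (auto simp: square_integrable_def)
  have "\<bar>a * b\<bar> \<le> a\<^sup>2 + b\<^sup>2" for a b :: real
  proof -
    have "2 * \<bar>a\<bar> * \<bar>b\<bar> \<le> a\<^sup>2 + b\<^sup>2"
      using sum_squares_bound[of "\<bar>a\<bar>" "\<bar>b\<bar>"] by simp
    moreover have "0 \<le> \<bar>a\<bar> * \<bar>b\<bar>" by simp
    ultimately show ?thesis unfolding abs_mult by linarith
  qed
  then show "AE x in lebesgue. norm (u x * v x) \<le> norm ((u x)\<^sup>2 + (v x)\<^sup>2)"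
    by simp
qed

lemma square_integrable_add:
  assumes "square_integrable u" "square_integrable v"
  shows "square_integrable (\<lambda>x. u x + v x)"
proof -
  have "integrable lebesgue (\<lambda>x. (u x)\<^sup>2 + (v x)\<^sup>2 + 2 * (u x * v x))"
    using assms square_integrable_mult[OF assms] by (auto simp: square_integrable_def)
  then show ?thesis
    using assms by (auto simp: square_integrable_def power2_sum mult.assoc)
qed

lemma square_integrable_scale:
  assumes "square_integrable u"
  shows "square_integrable (\<lambda>x. c * u x)"
  using assms by (auto simp: square_integrable_def power_mult_distrib)

quotient_type (overloaded) 'n L2 = "real^'n::finite \<Rightarrow> real" / partial: L2_eq
proof (rule part_equivpI)
  show "\<exists>u. L2_eq u u"
    using square_integrable_0 by (auto simp: L2_eq_def)
  show "symp L2_eq"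
    by (auto simp: symp_def L2_eq_def)
  show "transp L2_eq"
    by (auto simp: transp_def L2_eq_def)
qed

instantiation L2 :: (finite) real_inner
begin

lift_definition zero_L2 :: "'a L2" is "\<lambda>x. 0"
  by (simp add: L2_eq_def square_integrable_0)

lift_definition plus_L2 :: "'a L2 \<Rightarrow> 'a L2 \<Rightarrow> 'a L2" is "\<lambda>u v x. u x + v x"
  by (auto simp: L2_eq_def square_integrable_add)

lift_definition scaleR_L2 :: "real \<Rightarrow> 'a L2 \<Rightarrow> 'a L2" is "\<lambda>c u x. c * u x"
  by (auto simp: L2_eq_def square_integrable_scale)

lift_definition inner_L2 :: "'a L2 \<Rightarrow> 'a L2 \<Rightarrow> real"
  is "\<lambda>u v. integral\<^sup>L lebesgue (\<lambda>x. u x * v x)"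
  by (rule integral_cong_AE) (auto simp: L2_eq_def square_integrable_def)

definition uminus_L2 :: "'a L2 \<Rightarrow> 'a L2" where "uminus_L2 u = (- 1) *\<^sub>R u"
definition minus_L2 :: "'a L2 \<Rightarrow> 'a L2 \<Rightarrow> 'a L2" where "minus_L2 u v = u + (- 1) *\<^sub>R v"
definition norm_L2 :: "'a L2 \<Rightarrow> real" where "norm_L2 u = sqrt (inner u u)"
definition sgn_L2 :: "'a L2 \<Rightarrow> 'a L2" where "sgn_L2 u = inverse (norm u) *\<^sub>R u"
definition dist_L2 :: "'a L2 \<Rightarrow> 'a L2 \<Rightarrow> real" where "dist_L2 u v = norm (u - v)"
definition uniformity_L2 :: "('a L2 \<times> 'a L2) filter"
  where "uniformity_L2 = (INF e\<in>{0<..}. principal {(x, y). dist x y < e})"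
definition open_L2 :: "'a L2 set \<Rightarrow> bool"
  where "open_L2 U = (\<forall>x\<in>U. eventually (\<lambda>(x', y). x' = x \<longrightarrow> y \<in> U) uniformity)"

instance
proof
  fix u v w :: "'a L2" and a b :: real
  show "u + v + w = u + (v + w)"
    by transfer (auto simp: L2_eq_def square_integrable_add add.assoc)
  show "u + v = v + u"
    by transfer (auto simp: L2_eq_def square_integrable_add add.commute)
  show "0 + u = u"
    by transfer (auto simp: L2_eq_def)
  show "- u + u = 0"
    unfolding uminus_L2_def
    by transfer (auto simp: L2_eq_def square_integrable_0 square_integrable_def)
  show "u - v = u + - v"
    by (simp add: minus_L2_def uminus_L2_def)
  show "a *\<^sub>R (u + v) = a *\<^sub>R u + a *\<^sub>R v"
    by transfer (auto simp: L2_eq_def distrib_left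
        intro!: square_integrable_add square_integrable_scale)
  show "(a + b) *\<^sub>R u = a *\<^sub>R u + b *\<^sub>R u"
    by transfer (auto simp: L2_eq_def distrib_right
        intro!: square_integrable_add square_integrable_scale)
  show "a *\<^sub>R b *\<^sub>R u = (a * b) *\<^sub>R u"
    by transfer (auto simp: L2_eq_def mult.assoc
        intro!: square_integrable_scale)
  show "1 *\<^sub>R u = u"
    by transfer (auto simp: L2_eq_def)
  show "inner u v = inner v u"
    by transfer (simp add: mult.commute)
  show "inner (u + v) w = inner u w + inner v w"
    by transfer (simp add: L2_eq_def distrib_right square_integrable_mult)
  show "inner (a *\<^sub>R u) v = a * inner u v"
    by transfer (simp add: mult.assoc)
  show "0 \<le> inner u u"
    by transfer simp
  show "inner u u = 0 \<longleftrightarrow> u = 0"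
  proof transfer
    fix u :: "real^'a \<Rightarrow> real"
    assume "L2_eq u u"
    then have u: "square_integrable u" by (simp add: L2_eq_def)
    have "(integral\<^sup>L lebesgue (\<lambda>x. u x * u x) = 0) \<longleftrightarrow> (AE x in lebesgue. u x * u x = 0)"
      by (rule integral_nonneg_eq_0_iff_AE) (use square_integrable_mult[OF u u] in auto)
    then show "(integral\<^sup>L lebesgue (\<lambda>x. u x * u x) = 0) \<longleftrightarrow> L2_eq u (\<lambda>x. 0)"
      using u by (simp add: L2_eq_def square_integrable_0)
  qed
qed (simp_all add: norm_L2_def sgn_L2_def dist_L2_def uniformity_L2_def open_L2_def)

end

lemma rep_L2_square_integrable: "square_integrable (rep_L2 u)"
  using Quotient3_rep_reflp[OF Quotient3_L2, of u] by (simp add: L2_eq_def)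

lemma rep_L2_0: "AE x in lebesgue. rep_L2 (0 :: 'n::finite L2) x = 0"
  using Quotient3_rep_abs[OF Quotient3_L2, of "\<lambda>x :: real^'n. 0"]
  by (simp add: zero_L2_def L2_eq_def square_integrable_0)

lemma rep_L2_add: "AE x in lebesgue. rep_L2 (u + v) x = rep_L2 u x + rep_L2 v x"
  using Quotient3_rep_abs[OF Quotient3_L2, of "\<lambda>x. rep_L2 u x + rep_L2 v x"]
  by (simp add: plus_L2_def L2_eq_def rep_L2_square_integrable square_integrable_add)

lemma rep_L2_scaleR: "AE x in lebesgue. rep_L2 (c *\<^sub>R u) x = c * rep_L2 u x"
  using Quotient3_rep_abs[OF Quotient3_L2, of "\<lambda>x. c * rep_L2 u x"]
  by (simp add: scaleR_L2_def L2_eq_def rep_L2_square_integrable square_integrable_scale)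


section \<open>Weak derivatives and \<open>H\<^sup>1(\<real>\<^sup>N)\<close>\<close>

definition partial_deriv :: "'n::finite \<Rightarrow> (real^'n \<Rightarrow> real) \<Rightarrow> real^'n \<Rightarrow> real" where
  "partial_deriv i \<phi> x = frechet_derivative \<phi> (at x) (axis i 1)"

primrec C_k :: "nat \<Rightarrow> (real^'n::finite \<Rightarrow> real) \<Rightarrow> bool" where
  "C_k 0 \<phi> \<longleftrightarrow> continuous_on UNIV \<phi>"
| "C_k (Suc k) \<phi> \<longleftrightarrow> \<phi> differentiable_on UNIV \<and> (\<forall>i. C_k k (partial_deriv i \<phi>))"

definition test_function :: "(real^'n::finite \<Rightarrow> real) \<Rightarrow> bool" where
  "test_function \<phi> \<longleftrightarrow> (\<forall>k. C_k k \<phi>) \<and> compact (closure {x. \<phi> x \<noteq> 0})"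

definition weak_partial :: "'n::finite \<Rightarrow> 'n L2 \<Rightarrow> 'n L2 \<Rightarrow> bool" where
  "weak_partial i u g \<longleftrightarrow>
     (\<forall>\<phi>. test_function \<phi> \<longrightarrow>
        integral\<^sup>L lebesgue (\<lambda>x. rep_L2 u x * partial_deriv i \<phi> x) =
        - integral\<^sup>L lebesgue (\<lambda>x. rep_L2 g x * \<phi> x))"

lemma partial_deriv_eq_0:
  assumes "x \<notin> closure {x. \<phi> x \<noteq> 0}"
  shows "partial_deriv i \<phi> x = 0"
proof -
  have "(\<phi> has_derivative (\<lambda>h. 0)) (at x)"
    by (rule has_derivative_transform_within_open[of "\<lambda>_. 0" _ _ _ "- closure {x. \<phi> x \<noteq> 0}"])
       (use assms closure_subset[of "{x. \<phi> x \<noteq> 0}"] in auto)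
  then show ?thesis
    unfolding partial_deriv_def by (metis frechet_derivative_at)
qed

lemma continuous_compact_support_square_integrable:
  fixes \<psi> :: "real^'n::finite \<Rightarrow> real"
  assumes "continuous_on UNIV \<psi>" "compact K" "\<And>x. x \<notin> K \<Longrightarrow> \<psi> x = 0"
  shows "square_integrable \<psi>"
proof -
  have m: "\<psi> \<in> borel_measurable borel"
    using assms(1) by (rule borel_measurable_continuous_onI)
  have "continuous_on K (\<lambda>x. (\<psi> x)\<^sup>2)"
    using assms(1) by (intro continuous_intros) (rule continuous_on_subset, auto)
  then have "integrable lborel (\<lambda>x. indicator K x *\<^sub>R (\<psi> x)\<^sup>2)"
    using borel_integrable_compact[OF assms(2), of "\<lambda>x. (\<psi> x)\<^sup>2"] by (simp add: indicator_def of_bool_def)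
  moreover have "(\<lambda>x. indicator K x *\<^sub>R (\<psi> x)\<^sup>2) = (\<lambda>x. (\<psi> x)\<^sup>2)"
    using assms(3) by (auto simp: fun_eq_iff indicator_def)
  ultimately have "integrable lborel (\<lambda>x. (\<psi> x)\<^sup>2)" by simp
  then have "integrable lebesgue (\<lambda>x. (\<psi> x)\<^sup>2)"
    using m by (subst integrable_completion) auto
  moreover have "\<psi> \<in> borel_measurable lebesgue"
    using m by (simp add: measurable_completion)
  ultimately show ?thesis by (simp add: square_integrable_def)
qed

lemma test_function_square_integrable:
  assumes "test_function \<phi>"
  shows "square_integrable \<phi>" "square_integrable (partial_deriv i \<phi>)"
proof -
  have "C_k 0 \<phi>" "C_k 1 \<phi>" and K: "compact (closure {x. \<phi> x \<noteq> 0})"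
    using assms unfolding test_function_def by blast+
  then have "continuous_on UNIV \<phi>" "continuous_on UNIV (partial_deriv i \<phi>)" by auto
  then show "square_integrable \<phi>" "square_integrable (partial_deriv i \<phi>)"
    using continuous_compact_support_square_integrable[OF _ K]
      closure_subset[of "{x. \<phi> x \<noteq> 0}"] partial_deriv_eq_0[of _ \<phi> i]
    by blast+
qed

lemma integral_rep_L2_add:
  assumes "square_integrable \<psi>"
  shows "integral\<^sup>L lebesgue (\<lambda>x. rep_L2 (u + v) x * \<psi> x) =
    integral\<^sup>L lebesgue (\<lambda>x. rep_L2 u x * \<psi> x) + integral\<^sup>L lebesgue (\<lambda>x. rep_L2 v x * \<psi> x)"
proof -
  have "integral\<^sup>L lebesgue (\<lambda>x. rep_L2 (u + v) x * \<psi> x) =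
    integral\<^sup>L lebesgue (\<lambda>x. rep_L2 u x * \<psi> x + rep_L2 v x * \<psi> x)"
  proof (rule integral_cong_AE)
    show "AE x in lebesgue. rep_L2 (u + v) x * \<psi> x = rep_L2 u x * \<psi> x + rep_L2 v x * \<psi> x"
      using rep_L2_add[of u v] by eventually_elim (simp add: distrib_right)
  qed (use assms rep_L2_square_integrable[of u] rep_L2_square_integrable[of v]
         rep_L2_square_integrable[of "u + v"] in \<open>auto simp: square_integrable_def\<close>)
  then show ?thesis
    by (simp add: square_integrable_mult rep_L2_square_integrable assms)
qed

lemma integral_rep_L2_scaleR:
  assumes "square_integrable \<psi>"
  shows "integral\<^sup>L lebesgue (\<lambda>x. rep_L2 (c *\<^sub>R u) x * \<psi> x) =
    c * integral\<^sup>L lebesgue (\<lambda>x. rep_L2 u x * \<psi> x)"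
proof -
  have "integral\<^sup>L lebesgue (\<lambda>x. rep_L2 (c *\<^sub>R u) x * \<psi> x) =
    integral\<^sup>L lebesgue (\<lambda>x. c * (rep_L2 u x * \<psi> x))"
  proof (rule integral_cong_AE)
    show "AE x in lebesgue. rep_L2 (c *\<^sub>R u) x * \<psi> x = c * (rep_L2 u x * \<psi> x)"
      using rep_L2_scaleR[of c u] by eventually_elim simp
  qed (use assms rep_L2_square_integrable[of u] rep_L2_square_integrable[of "c *\<^sub>R u"]
       in \<open>auto simp: square_integrable_def\<close>)
  then show ?thesis by simp
qed

lemma weak_partial_add:
  "weak_partial i u g \<Longrightarrow> weak_partial i v h \<Longrightarrow> weak_partial i (u + v) (g + h)"
  unfolding weak_partial_def
  by (simp add: integral_rep_L2_add test_function_square_integrable)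

lemma weak_partial_scaleR:
  "weak_partial i u g \<Longrightarrow> weak_partial i (c *\<^sub>R u) (c *\<^sub>R g)"
  unfolding weak_partial_def
  by (simp add: integral_rep_L2_scaleR test_function_square_integrable)

lemma weak_partial_0: "weak_partial i 0 0" for i :: "'n::finite"
  using integral_rep_L2_scaleR[of _ 0 "0 :: 'n L2"]
  unfolding weak_partial_def by (simp add: test_function_square_integrable)

text \<open>
  An element of \<open>H\<^sup>1(\<real>\<^sup>N)\<close> is a function \<open>u \<in> L\<^sup>2\<close> whose weak partial derivatives lie
  in \<open>L\<^sup>2\<close>. It is stored together with its weak gradient (which \<open>u\<close> determines), so that
  the inner product \<open>\<integral> u v + \<nabla>u \<bullet> \<nabla>v\<close> is the one inherited from
  \<open>L\<^sup>2 \<times> (L\<^sup>2)\<^sup>N\<close>.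
\<close>

typedef (overloaded) 'n H1 =
  "{(u :: 'n::finite L2, g :: 'n L2 ^ 'n). \<forall>i. weak_partial i u (g $ i)}"
  by (rule exI[of _ "(0, 0)"]) (simp add: weak_partial_0)

setup_lifting type_definition_H1

instantiation H1 :: (finite) real_inner
begin

lift_definition zero_H1 :: "'a H1" is "0"
  by (simp add: zero_prod_def weak_partial_0)

lift_definition plus_H1 :: "'a H1 \<Rightarrow> 'a H1 \<Rightarrow> 'a H1" is "(+)"
  by (auto simp: weak_partial_add)

lift_definition scaleR_H1 :: "real \<Rightarrow> 'a H1 \<Rightarrow> 'a H1" is "scaleR"
  by (auto simp: weak_partial_scaleR)

lift_definition inner_H1 :: "'a H1 \<Rightarrow> 'a H1 \<Rightarrow> real" is "inner" .

definition uminus_H1 :: "'a H1 \<Rightarrow> 'a H1" where "uminus_H1 u = (- 1) *\<^sub>R u"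
definition minus_H1 :: "'a H1 \<Rightarrow> 'a H1 \<Rightarrow> 'a H1" where "minus_H1 u v = u + (- 1) *\<^sub>R v"
definition norm_H1 :: "'a H1 \<Rightarrow> real" where "norm_H1 u = sqrt (inner u u)"
definition sgn_H1 :: "'a H1 \<Rightarrow> 'a H1" where "sgn_H1 u = inverse (norm u) *\<^sub>R u"
definition dist_H1 :: "'a H1 \<Rightarrow> 'a H1 \<Rightarrow> real" where "dist_H1 u v = norm (u - v)"
definition uniformity_H1 :: "('a H1 \<times> 'a H1) filter"
  where "uniformity_H1 = (INF e\<in>{0<..}. principal {(x, y). dist x y < e})"
definition open_H1 :: "'a H1 set \<Rightarrow> bool"
  where "open_H1 U = (\<forall>x\<in>U. eventually (\<lambda>(x', y). x' = x \<longrightarrow> y \<in> U) uniformity)"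

instance
proof
  fix u v w :: "'a H1" and a b :: real
  show "u + v + w = u + (v + w)" by transfer (rule add.assoc)
  show "u + v = v + u" by transfer (rule add.commute)
  show "0 + u = u" by transfer (rule add_0)
  show "- u + u = 0" unfolding uminus_H1_def by transfer simp
  show "u - v = u + - v" by (simp add: minus_H1_def uminus_H1_def)
  show "a *\<^sub>R (u + v) = a *\<^sub>R u + a *\<^sub>R v" by transfer (rule scaleR_add_right)
  show "(a + b) *\<^sub>R u = a *\<^sub>R u + b *\<^sub>R u" by transfer (rule scaleR_add_left)
  show "a *\<^sub>R b *\<^sub>R u = (a * b) *\<^sub>R u" by transfer (rule scaleR_scaleR)
  show "1 *\<^sub>R u = u" by transfer (rule scaleR_one)
  show "inner u v = inner v u" by transfer (rule inner_commute)
  show "inner (u + v) w = inner u w + inner v w" by transfer (rule inner_add_left)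
  show "inner (a *\<^sub>R u) v = a * inner u v" by transfer (rule inner_scaleR_left)
  show "0 \<le> inner u u" by transfer (rule inner_ge_zero)
  show "inner u u = 0 \<longleftrightarrow> u = 0" by transfer (rule inner_eq_zero_iff)
qed (simp_all add: norm_H1_def sgn_H1_def dist_H1_def uniformity_H1_def open_H1_def)

end

definition H1_fun :: "'n::finite H1 \<Rightarrow> real^'n \<Rightarrow> real" where
  "H1_fun u = rep_L2 (fst (Rep_H1 u))"

definition H1_grad :: "'n::finite H1 \<Rightarrow> real^'n \<Rightarrow> real^'n" where
  "H1_grad u x = (\<chi> i. rep_L2 (snd (Rep_H1 u) $ i) x)"


section \<open>The spectrum of \<open>-\<Delta> + V\<close> on \<open>L\<^sup>2(\<real>\<^sup>N)\<close>\<close>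

text \<open>
  An unbounded operator is given by its graph. Its resolvent set consists of the \<open>\<mu>\<close>
  for which \<open>A - \<mu>\<close> is a bijection from the domain onto the whole space with bounded
  inverse \<open>R\<close>. The scalars are real; for self-adjoint operators nothing is lost by this.
\<close>

definition resolvent_set :: "('a::real_normed_vector \<times> 'a) set \<Rightarrow> real set" where
  "resolvent_set A = {\<mu>. \<exists>R. bounded_linear R \<and>
     (\<forall>h. (R h, h + \<mu> *\<^sub>R R h) \<in> A) \<and>
     (\<forall>(u, w) \<in> A. R (w - \<mu> *\<^sub>R u) = u)}"

definition spectrum :: "('a::real_normed_vector \<times> 'a) set \<Rightarrow> real set" where
  "spectrum A = - resolvent_set A"

text \<open>
  The graph of \<open>-\<Delta> + V\<close> with domain \<open>H\<^sup>2(\<real>\<^sup>N)\<close>: \<open>g $ i\<close> and \<open>h $ i $ j\<close> are the weak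
  derivatives \<open>\<partial>\<^sub>i u\<close> and \<open>\<partial>\<^sub>j \<partial>\<^sub>i u\<close>, all in \<open>L\<^sup>2\<close>.
\<close>

definition schrodinger :: "(real^'n::finite \<Rightarrow> real) \<Rightarrow> ('n L2 \<times> 'n L2) set" where
  "schrodinger V = {(u, w). \<exists>(g :: 'n L2 ^ 'n) (h :: 'n L2 ^ 'n ^ 'n).
     (\<forall>i. weak_partial i u (g $ i)) \<and>
     (\<forall>i j. weak_partial j (g $ i) (h $ i $ j)) \<and>
     (AE x in lebesgue. rep_L2 w x = - (\<Sum>i\<in>UNIV. rep_L2 (h $ i $ i) x) + V x * rep_L2 u x)}"


section \<open>Conditions on the potentials and the nonlinearity\<close>

definition crit_exp :: "nat \<Rightarrow> ereal" where
  "crit_exp N = (if N \<ge> 3 then ereal (2 * real N / (real N - 2)) else \<infinity>)"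

definition L_infty :: "(real^'n::finite \<Rightarrow> real) \<Rightarrow> bool" where
  "L_infty g \<longleftrightarrow> g \<in> borel_measurable lebesgue \<and> (\<exists>C. AE x in lebesgue. \<bar>g x\<bar> \<le> C)"

definition int_lattice :: "(real^'n::finite) set" where
  "int_lattice = {z. \<forall>i. z $ i \<in> \<int>}"

definition periodic_AE :: "(real^'n::finite \<Rightarrow> real) \<Rightarrow> bool" where
  "periodic_AE g \<longleftrightarrow> (\<forall>z\<in>int_lattice. AE x in lebesgue. g (x + z) = g x)"

text \<open>Elements of \<open>L\<^sup>\<infinity>\<close> are classes, hence the limit at infinity is an essential one.\<close>

definition vanishes_at_infinity :: "(real^'n::finite \<Rightarrow> real) \<Rightarrow> bool" where
  "vanishes_at_infinity g \<longleftrightarrow>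
     (\<forall>\<epsilon>>0. \<exists>R. AE x in lebesgue. norm x \<ge> R \<longrightarrow> \<bar>g x\<bar> < \<epsilon>)"

definition cond_V ::
  "(real^'n::finite \<Rightarrow> real) \<Rightarrow> (real^'n \<Rightarrow> real) \<Rightarrow> (real^'n \<Rightarrow> real) \<Rightarrow> bool" where
  "cond_V V Vper Vloc \<longleftrightarrow>
     V = (\<lambda>x. Vper x + Vloc x) \<and> L_infty Vper \<and> periodic_AE Vper \<and>
     L_infty Vloc \<and> vanishes_at_infinity Vloc"

definition cond_Gamma :: "(real^'n::finite \<Rightarrow> real) \<Rightarrow> bool" where
  "cond_Gamma \<Gamma> \<longleftrightarrow> L_infty \<Gamma> \<and> periodic_AE \<Gamma> \<and> (AE x in lebesgue. \<Gamma> x \<ge> 0)"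

definition cond_F1 :: "(real^'n::finite \<Rightarrow> real \<Rightarrow> real) \<Rightarrow> real \<Rightarrow> bool" where
  "cond_F1 f p \<longleftrightarrow>
     (\<lambda>(x, u). f x u) \<in> borel_measurable lebesgue \<and>
     (\<forall>z\<in>int_lattice. \<forall>x u. f (x + z) u = f x u) \<and>
     (AE x in lebesgue. continuous_on UNIV (f x)) \<and>
     (\<exists>c>0. \<forall>x u. \<bar>f x u\<bar> \<le> c * (1 + \<bar>u\<bar> powr (p - 1)))"

definition cond_F2 :: "(real^'n::finite \<Rightarrow> real \<Rightarrow> real) \<Rightarrow> bool" where
  "cond_F2 f \<longleftrightarrow> (\<forall>\<epsilon>>0. \<forall>\<^sub>F u in nhds 0. \<forall>x. \<bar>f x u\<bar> \<le> \<epsilon> * \<bar>u\<bar>)"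

definition primitive :: "(real^'n::finite \<Rightarrow> real \<Rightarrow> real) \<Rightarrow> real^'n \<Rightarrow> real \<Rightarrow> real" where
  "primitive f x u = (LBINT s=ereal 0..ereal u. f x s)"

definition cond_F3 :: "(real^'n::finite \<Rightarrow> real \<Rightarrow> real) \<Rightarrow> real \<Rightarrow> bool" where
  "cond_F3 f q \<longleftrightarrow>
     (\<forall>M. \<forall>\<^sub>F u in at_infinity. \<forall>x. primitive f x u / \<bar>u\<bar> powr q \<ge> M)"

definition cond_F4 :: "(real^'n::finite \<Rightarrow> real \<Rightarrow> real) \<Rightarrow> real \<Rightarrow> bool" where
  "cond_F4 f q \<longleftrightarrow>
     (\<forall>x. strict_mono_on {..<0} (\<lambda>u. f x u / \<bar>u\<bar> powr (q - 1)) \<and>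
          strict_mono_on {0<..} (\<lambda>u. f x u / \<bar>u\<bar> powr (q - 1)))"


section \<open>The energy functional and ground states\<close>

definition energy :: "(real^'n::finite \<Rightarrow> real) \<Rightarrow> (real^'n \<Rightarrow> real) \<Rightarrow>
    (real^'n \<Rightarrow> real \<Rightarrow> real) \<Rightarrow> real \<Rightarrow> 'n H1 \<Rightarrow> real" where
  "energy V \<Gamma> f q u =
     1 / 2 * integral\<^sup>L lebesgue (\<lambda>x. (norm (H1_grad u x))\<^sup>2 + V x * \<bar>H1_fun u x\<bar>\<^sup>2) -
     integral\<^sup>L lebesgue
       (\<lambda>x. primitive f x (H1_fun u x) - 1 / q * \<Gamma> x * \<bar>H1_fun u x\<bar> powr q)"

text \<open>
  Under the conditions above the energy is of class \<open>C\<^sup>1\<close> on \<open>H\<^sup>1\<close>, so that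
  \<^const>\<open>frechet_derivative\<close> in the next definition is its derivative at every point. Infima
  are taken in the extended reals, where they need no boundedness assumption.
\<close>

definition nehari :: "(real^'n::finite \<Rightarrow> real) \<Rightarrow> (real^'n \<Rightarrow> real) \<Rightarrow>
    (real^'n \<Rightarrow> real \<Rightarrow> real) \<Rightarrow> real \<Rightarrow> 'n H1 set" where
  "nehari V \<Gamma> f q = {u. u \<noteq> 0 \<and> frechet_derivative (energy V \<Gamma> f q) (at u) u = 0}"

text \<open>
  Critical points of the energy are the weak solutions of
  \<open>-\<Delta>u + V(x) u = f(x, u) - \<Gamma>(x) |u|\<^sup>q\<^sup>-\<^sup>2 u\<close>.
\<close>

definition ground_state :: "(real^'n::finite \<Rightarrow> real) \<Rightarrow> (real^'n \<Rightarrow> real) \<Rightarrow>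
    (real^'n \<Rightarrow> real \<Rightarrow> real) \<Rightarrow> real \<Rightarrow> 'n H1 \<Rightarrow> bool" where
  "ground_state V \<Gamma> f q u \<longleftrightarrow>
     u \<in> nehari V \<Gamma> f q \<and>
     (energy V \<Gamma> f q has_derivative (\<lambda>_. 0)) (at u) \<and>
     ereal (energy V \<Gamma> f q u) = (INF v\<in>nehari V \<Gamma> f q. ereal (energy V \<Gamma> f q v))"

end

theory Submission
  imports Defs
begin

text \<open>
  Let \<open>u\<close> be a ground state. As \<open>J'(u)u = 0\<close>, condition (F4) gives \<open>J(tu) \<le> J(u)\<close> for all \<open>t > 0\<close>. For
  a lattice vector \<open>z\<close> put \<open>v = u(\<cdot> + z)\<close>. The ray through \<open>v\<close> meets the Nehari manifold in some \<open>tv\<close>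
  with \<open>t > 0\<close>, and by periodicity
  \<open>J(tv) = J(tu) + t\<^sup>2/2 (\<integral>V\<^sub>l\<^sub>o\<^sub>c v\<^sup>2 - \<integral>V\<^sub>l\<^sub>o\<^sub>c u\<^sup>2)\<close>.
  The first integral tends to \<open>0\<close> as \<open>\<bar>z\<bar> \<rightarrow> \<infinity>\<close> and the second one is positive, hence \<open>J(tv) < J(u)\<close>
  for large \<open>z\<close>. Neither the periodic problem nor bounds on \<open>t\<close> are needed.

  The intersection point on the ray exists because the form of \<open>-\<Delta> + V\<^sub>p\<^sub>e\<^sub>r\<close> is positive, which follows
  from the spectral assumption, and because \<open>J\<close> is differentiable on \<open>H\<^sup>1\<close>. The latter rests on the
  embedding of \<open>H\<^sup>1\<close> into \<open>L\<^sup>p\<close> for subcritical \<open>p\<close>, obtained here from dyadic averages \<open>A\<^sub>k u\<close> over cubes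
  of side \<open>2\<^sup>-\<^sup>k\<close>: \<open>\<bar>A\<^sub>k u\<bar>\<close> grows at most like \<open>2\<^sup>k\<^sup>(\<^sup>N\<^sup>/\<^sup>2\<^sup>-\<^sup>1\<^sup>)\<close> (like \<open>2\<^sup>k\<^sup>\<theta>\<close> with any \<open>\<theta> > 0\<close> if
  \<open>N \<le> 2\<close>), while \<open>\<parallel>A\<^sub>k u - u\<parallel>\<^sub>2 = O(2\<^sup>-\<^sup>k)\<close>, and on the set where \<open>\<bar>u\<bar>\<close> exceeds twice the first bound
  \<open>\<bar>u\<bar>\<close> is controlled by \<open>\<bar>A\<^sub>k u - u\<bar>\<close>.
\<close>

text \<open>For every \<open>t > 0\<close> the sign of \<open>J(tv) - J(tu)\<close> is that of the
  difference of the two \<open>Vloc\<close> integrals, so one lattice vector serves whatever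
  \<open>t\<close> the ray through \<open>v\<close> produces. The estimate
  \<open>J(tu) \<le> J(u)\<close> hides a comparison of powers: (F4) is adapted to the exponent q,
  the form to the exponent 2, and (t^2 - 1)/2 \<le> (t^q - 1)/q together with positivity of the form
  bridges the gap. The obstacle is that Sobolev functions are known only through integrals against
  test functions. Instead of mollifying them, the proof works with the translation group: u(x + th)
  - u(x) has norm at most \<open>\<bar>t\<bar>\<close> times that of the derivative along h, and the
  difference quotients converge weakly. This yields integration by parts for two Sobolev functions,
  which links the operator on H^2 with its form, and also the rate O(2^-k) of the averages.
  Subcriticality enters through \<theta>(p - 2) < 2: the values of \<open>\<bar>u\<bar>\<close> in
  the k-th layer contribute about 2^(k\<theta>(p-2)) 4^(-k), a convergent geometric series.\<close>

section \<open>Translations and multiplication operators on \<open>L\<^sup>2\<close>\<close>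

lemma lebesgue_distr_translation:
  "distr lebesgue lebesgue (\<lambda>x::'a::euclidean_space. x + z) = lebesgue"
  using lebesgue_affine_euclidean[of "\<lambda>_. 1" z]
  by (simp add: euclidean_representation density_1 add.commute)

lemma measurable_translation_right:
  "(\<lambda>x::'a::euclidean_space. x + z) \<in> lebesgue \<rightarrow>\<^sub>M lebesgue"
  using lebesgue_affine_measurable[of "\<lambda>_. 1" z] by (simp add: euclidean_representation add.commute)

lemma measurable_lebesgue_translate:
  fixes f :: "'a::euclidean_space \<Rightarrow> 'b::topological_space"
  assumes "f \<in> borel_measurable lebesgue"
  shows "(\<lambda>x. f (x + z)) \<in> borel_measurable lebesgue"
  using measurable_compose[OF measurable_translation_right assms] .

lemma AE_lebesgue_translate:
  fixes z :: "'a::euclidean_space"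
  assumes "AE x in lebesgue. P x"
  shows "AE x in lebesgue. P (x + z)"
proof -
  obtain N where N: "{x \<in> space lebesgue. \<not> P x} \<subseteq> N" "N \<in> null_sets lebesgue"
    using assms by (auto elim!: AE_E simp: null_sets_def)
  have "N \<in> null_sets (distr lebesgue lebesgue (\<lambda>x. x + z))"
    using N(2) by (simp add: lebesgue_distr_translation)
  then have "(\<lambda>x. x + z) -` N \<inter> space lebesgue \<in> null_sets lebesgue"
    by (subst (asm) null_sets_distr_iff[OF measurable_translation_right]) auto
  then show ?thesis by (rule AE_I') (use N(1) in auto)
qed

lemma integral_lebesgue_translate:
  fixes f :: "'a::euclidean_space \<Rightarrow> real"
  assumes "f \<in> borel_measurable lebesgue"
  shows "(\<integral>x. f (x + z) \<partial>lebesgue) = (\<integral>x. f x \<partial>lebesgue)"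
  using integral_distr[OF measurable_translation_right assms, of z]
  by (simp add: lebesgue_distr_translation)

lemma integrable_lebesgue_translate:
  fixes f :: "'a::euclidean_space \<Rightarrow> real"
  assumes "integrable lebesgue f"
  shows "integrable lebesgue (\<lambda>x. f (x + z))"
proof (rule integrable_distr[OF measurable_translation_right])
  show "integrable (distr lebesgue lebesgue (\<lambda>x. x + z)) f"
    using assms by (simp add: lebesgue_distr_translation)
qed

lemma square_integrable_translate:
  "square_integrable u \<Longrightarrow> square_integrable (\<lambda>x. u (x + z))"
  using integrable_lebesgue_translate[of "\<lambda>x. (u x)\<^sup>2" z]
  by (simp add: square_integrable_def measurable_lebesgue_translate)

section \<open>Representatives, inner products and translations of square integrable classes\<close>

lemma rep_abs_L2:
  "square_integrable u \<Longrightarrow> AE x in lebesgue. rep_L2 (abs_L2 u) x = u x"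
  using Quotient3_rep_abs[OF Quotient3_L2, of u] by (simp add: L2_eq_def)

lemma L2_eqI:
  assumes "AE x in lebesgue. rep_L2 u x = rep_L2 v x"
  shows "u = v"
  using Quotient3_rel_rep[OF Quotient3_L2, of u v] assms
  by (simp add: L2_eq_def rep_L2_square_integrable)

lemma rep_L2_measurable [measurable]: "rep_L2 u \<in> borel_measurable lebesgue"
  using rep_L2_square_integrable[of u] by (simp add: square_integrable_def)

lemma rep_L2_diff: "AE x in lebesgue. rep_L2 (u - v) x = rep_L2 u x - rep_L2 v x"
  unfolding minus_L2_def
  using rep_L2_add[of u "(-1) *\<^sub>R v"] rep_L2_scaleR[of "-1" v] by eventually_elim linarith

lemma rep_L2_sum:
  "AE x in lebesgue. rep_L2 (\<Sum>i\<in>I. u i) x = (\<Sum>i\<in>I. rep_L2 (u i) x)"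
proof (induction I rule: infinite_finite_induct)
  case (insert i I)
  then have "AE x in lebesgue. rep_L2 (\<Sum>i\<in>I. u i) x = (\<Sum>i\<in>I. rep_L2 (u i) x)" by simp
  with rep_L2_add[of "u i" "\<Sum>i\<in>I. u i"] have
    "AE x in lebesgue. rep_L2 (u i + (\<Sum>i\<in>I. u i)) x = rep_L2 (u i) x + (\<Sum>i\<in>I. rep_L2 (u i) x)"
    by eventually_elim simp
  with insert.hyps show ?case by simp
qed (auto simp: rep_L2_0)

lemma inner_L2_eq: "inner u v = (\<integral>x. rep_L2 u x * rep_L2 v x \<partial>lebesgue)"
  by (simp add: inner_L2_def)

lemma inner_abs_L2:
  assumes "square_integrable a"
  shows "inner u (abs_L2 a) = (\<integral>x. rep_L2 u x * a x \<partial>lebesgue)"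
  unfolding inner_L2_eq
proof (rule integral_cong_AE)
  show "AE x in lebesgue. rep_L2 u x * rep_L2 (abs_L2 a) x = rep_L2 u x * a x"
    using rep_abs_L2[OF assms] by eventually_elim simp
qed (use assms in \<open>auto simp: square_integrable_def\<close>)

lemma norm_L2_eq: "(norm u)\<^sup>2 = (\<integral>x. (rep_L2 u x)\<^sup>2 \<partial>lebesgue)"
  unfolding power2_norm_eq_inner inner_L2_eq by (simp add: power2_eq_square)

lemma norm_abs_L2:
  assumes "square_integrable a"
  shows "(norm (abs_L2 a))\<^sup>2 = (\<integral>x. (a x)\<^sup>2 \<partial>lebesgue)"
  unfolding norm_L2_eq
proof (rule integral_cong_AE)
  show "AE x in lebesgue. (rep_L2 (abs_L2 a) x)\<^sup>2 = (a x)\<^sup>2"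
    using rep_abs_L2[OF assms] by eventually_elim simp
qed (use assms in \<open>auto simp: square_integrable_def\<close>)

definition translate_L2 :: "real^'n \<Rightarrow> 'n::finite L2 \<Rightarrow> 'n L2" where
  "translate_L2 z u = abs_L2 (\<lambda>x. rep_L2 u (x + z))"

lemma rep_translate_L2: "AE x in lebesgue. rep_L2 (translate_L2 z u) x = rep_L2 u (x + z)"
  unfolding translate_L2_def
  by (intro rep_abs_L2 square_integrable_translate rep_L2_square_integrable)

lemma translate_L2_scaleR: "translate_L2 z (c *\<^sub>R u) = c *\<^sub>R translate_L2 z u"
proof (rule L2_eqI)
  show "AE x in lebesgue. rep_L2 (translate_L2 z (c *\<^sub>R u)) x = rep_L2 (c *\<^sub>R translate_L2 z u) x"
    using rep_translate_L2[of z "c *\<^sub>R u"] rep_translate_L2[of z u]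
      AE_lebesgue_translate[OF rep_L2_scaleR[of c u], of z] rep_L2_scaleR[of c "translate_L2 z u"]
    by eventually_elim simp
qed

lemma translate_translate_L2: "translate_L2 y (translate_L2 z u) = translate_L2 (y + z) u"
proof (rule L2_eqI)
  show "AE x in lebesgue. rep_L2 (translate_L2 y (translate_L2 z u)) x = rep_L2 (translate_L2 (y + z) u) x"
    using rep_translate_L2[of y "translate_L2 z u"] rep_translate_L2[of "y + z" u]
      AE_lebesgue_translate[OF rep_translate_L2[of z u], of y]
    by eventually_elim (simp add: add.assoc)
qed

lemma translate_L2_0: "translate_L2 0 u = u"
  by (rule L2_eqI) (use rep_translate_L2[of 0 u] in simp)

lemma inner_translate_L2: "inner (translate_L2 z u) (translate_L2 z v) = inner u v"
proof -
  have "inner (translate_L2 z u) (translate_L2 z v) =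
      (\<integral>x. rep_L2 u (x + z) * rep_L2 v (x + z) \<partial>lebesgue)"
    unfolding inner_L2_eq
  proof (rule integral_cong_AE)
    show "AE x in lebesgue. rep_L2 (translate_L2 z u) x * rep_L2 (translate_L2 z v) x =
        rep_L2 u (x + z) * rep_L2 v (x + z)"
      using rep_translate_L2[of z u] rep_translate_L2[of z v] by eventually_elim simp
  qed (auto intro!: borel_measurable_times measurable_lebesgue_translate)
  also have "\<dots> = inner u v"
    using integral_lebesgue_translate[of "\<lambda>x. rep_L2 u x * rep_L2 v x" z]
    by (simp add: inner_L2_eq)
  finally show ?thesis .
qed

text \<open>Translations are unitary, so the adjoint of a shift is the opposite shift. This moves
  difference quotients from one factor of an inner product to the other.\<close>

lemma inner_translate_L2_left: "inner (translate_L2 z u) v = inner u (translate_L2 (- z) v)"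
  using inner_translate_L2[of "- z" "translate_L2 z u" v]
  by (simp add: translate_translate_L2 translate_L2_0)

lemma norm_translate_L2: "norm (translate_L2 z u) = norm u"
  by (simp add: norm_eq_sqrt_inner inner_translate_L2)

lemma translate_abs_L2:
  assumes "square_integrable a"
  shows "translate_L2 z (abs_L2 a) = abs_L2 (\<lambda>x. a (x + z))"
proof (rule L2_eqI)
  show "AE x in lebesgue. rep_L2 (translate_L2 z (abs_L2 a)) x = rep_L2 (abs_L2 (\<lambda>x. a (x + z))) x"
    using rep_translate_L2[of z "abs_L2 a"] AE_lebesgue_translate[OF rep_abs_L2[OF assms], of z]
      rep_abs_L2[OF square_integrable_translate[OF assms, of z]]
    by eventually_elim simp
qed

lemma abs_L2_add:
  assumes "square_integrable a" "square_integrable b"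
  shows "abs_L2 (\<lambda>x. a x + b x) = abs_L2 a + abs_L2 b"
proof (rule L2_eqI)
  show "AE x in lebesgue. rep_L2 (abs_L2 (\<lambda>x. a x + b x)) x = rep_L2 (abs_L2 a + abs_L2 b) x"
    using rep_abs_L2[OF square_integrable_add[OF assms]] rep_abs_L2[OF assms(1)] rep_abs_L2[OF assms(2)]
      rep_L2_add[of "abs_L2 a" "abs_L2 b"]
    by eventually_elim simp
qed

lemma abs_L2_scaleR:
  assumes "square_integrable a"
  shows "abs_L2 (\<lambda>x. c * a x) = c *\<^sub>R abs_L2 a"
proof (rule L2_eqI)
  show "AE x in lebesgue. rep_L2 (abs_L2 (\<lambda>x. c * a x)) x = rep_L2 (c *\<^sub>R abs_L2 a) x"
    using rep_abs_L2[OF square_integrable_scale[OF assms, of c]] rep_abs_L2[OF assms(1)]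
      rep_L2_scaleR[of c "abs_L2 a"]
    by eventually_elim simp
qed

lemma abs_L2_diff:
  assumes "square_integrable a" "square_integrable b"
  shows "abs_L2 (\<lambda>x. a x - b x) = abs_L2 a - abs_L2 b"
  using abs_L2_add[OF assms(1) square_integrable_scale[OF assms(2), of "-1"]]
    abs_L2_scaleR[OF assms(2), of "-1"] by simp

lemma square_integrable_diff:
  assumes "square_integrable a" "square_integrable b"
  shows "square_integrable (\<lambda>x. a x - b x)"
  using square_integrable_add[OF assms(1) square_integrable_scale[OF assms(2), of "-1"]] by simp

section \<open>Multiplication by bounded functions\<close>

lemma square_integrable_mult_L_infty:
  assumes V: "L_infty V" and u: "square_integrable u"
  shows "square_integrable (\<lambda>x. V x * u x)"
proof -
  obtain C where C: "AE x in lebesgue. \<bar>V x\<bar> \<le> C" using V by (auto simp: L_infty_def)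
  have m[measurable]: "V \<in> borel_measurable lebesgue" "u \<in> borel_measurable lebesgue"
    using V u by (auto simp: L_infty_def square_integrable_def)
  have "integrable lebesgue (\<lambda>x. (V x * u x)\<^sup>2)"
  proof (rule Bochner_Integration.integrable_bound)
    show "integrable lebesgue (\<lambda>x. C\<^sup>2 * (u x)\<^sup>2)"
      using u by (simp add: square_integrable_def)
    show "AE x in lebesgue. norm ((V x * u x)\<^sup>2) \<le> norm (C\<^sup>2 * (u x)\<^sup>2)"
      using C
    proof eventually_elim
      case (elim x)
      have "(V x)\<^sup>2 \<le> C\<^sup>2" using elim by (metis abs_ge_zero power2_abs power_mono)
      then show ?case by (simp add: power_mult_distrib mult_right_mono)
    qed
  qed auto
  then show ?thesis by (auto simp: square_integrable_def)
qed

definition mult_L2 :: "(real^'n \<Rightarrow> real) \<Rightarrow> 'n::finite L2 \<Rightarrow> 'n L2" where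
  "mult_L2 V u = abs_L2 (\<lambda>x. V x * rep_L2 u x)"

lemma rep_mult_L2: "L_infty V \<Longrightarrow> AE x in lebesgue. rep_L2 (mult_L2 V u) x = V x * rep_L2 u x"
  unfolding mult_L2_def
  by (intro rep_abs_L2 square_integrable_mult_L_infty rep_L2_square_integrable)

lemma mult_L2_add:
  assumes "L_infty V"
  shows "mult_L2 V (u + v) = mult_L2 V u + mult_L2 V v"
proof (rule L2_eqI)
  show "AE x in lebesgue. rep_L2 (mult_L2 V (u + v)) x = rep_L2 (mult_L2 V u + mult_L2 V v) x"
    using rep_mult_L2[OF assms, of "u + v"] rep_mult_L2[OF assms, of u] rep_mult_L2[OF assms, of v]
      rep_L2_add[of u v] rep_L2_add[of "mult_L2 V u" "mult_L2 V v"]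
    by eventually_elim (simp add: distrib_left)
qed

lemma mult_L2_scaleR:
  assumes "L_infty V"
  shows "mult_L2 V (c *\<^sub>R u) = c *\<^sub>R mult_L2 V u"
proof (rule L2_eqI)
  show "AE x in lebesgue. rep_L2 (mult_L2 V (c *\<^sub>R u)) x = rep_L2 (c *\<^sub>R mult_L2 V u) x"
    using rep_mult_L2[OF assms, of "c *\<^sub>R u"] rep_mult_L2[OF assms, of u]
      rep_L2_scaleR[of c u] rep_L2_scaleR[of c "mult_L2 V u"]
    by eventually_elim simp
qed

lemma inner_mult_L2:
  assumes "L_infty V"
  shows "inner (mult_L2 V u) v = (\<integral>x. V x * rep_L2 u x * rep_L2 v x \<partial>lebesgue)"
  unfolding mult_L2_def
  using inner_abs_L2[OF square_integrable_mult_L_infty[OF assms rep_L2_square_integrable[of u]], of v]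
  by (simp add: inner_commute mult_ac)

lemma inner_mult_L2_commute:
  assumes "L_infty V"
  shows "inner (mult_L2 V u) v = inner u (mult_L2 V v)"
  using inner_mult_L2[OF assms, of u v] inner_mult_L2[OF assms, of v u]
  by (simp add: inner_commute mult_ac)

lemma norm_mult_L2_le:
  fixes V :: "real^'n::finite \<Rightarrow> real"
  assumes V: "L_infty V"
  shows "\<exists>C\<ge>0. \<forall>u. norm (mult_L2 V u) \<le> C * norm u"
proof -
  obtain C where C: "AE x in lebesgue. \<bar>V x\<bar> \<le> C" using V by (auto simp: L_infty_def)
  have "norm (mult_L2 V u) \<le> \<bar>C\<bar> * norm u" for u
  proof (rule power2_le_imp_le)
    have "(norm (mult_L2 V u))\<^sup>2 \<le> (\<integral>x. C\<^sup>2 * (rep_L2 u x)\<^sup>2 \<partial>lebesgue)"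
      unfolding norm_L2_eq
    proof (rule integral_mono_AE)
      show "AE x in lebesgue. (rep_L2 (mult_L2 V u) x)\<^sup>2 \<le> C\<^sup>2 * (rep_L2 u x)\<^sup>2"
        using rep_mult_L2[OF V, of u] C
      proof eventually_elim
        case (elim x)
        have "(V x)\<^sup>2 \<le> C\<^sup>2" using elim(2) by (metis abs_ge_zero power2_abs power_mono)
        then show ?case unfolding elim(1) by (simp add: power_mult_distrib mult_right_mono)
      qed
    qed (use rep_L2_square_integrable in \<open>auto simp: square_integrable_def\<close>)
    then show "(norm (mult_L2 V u))\<^sup>2 \<le> (\<bar>C\<bar> * norm u)\<^sup>2"
      by (simp add: power_mult_distrib norm_L2_eq)
  qed auto
  then show ?thesis by (intro exI[of _ "\<bar>C\<bar>"]) auto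
qed

section \<open>Test functions\<close>

lemma partial_deriv_eqI:
  assumes "(\<phi> has_derivative D) (at x)"
  shows "partial_deriv i \<phi> x = D (axis i 1)"
  unfolding partial_deriv_def using frechet_derivative_at[OF assms] by simp

text \<open>The recursive clause of \<open>C_k\<close> speaks only of derivatives, while the product
  rule leaves one factor undifferentiated; that factor has to be seen as a function of the lower
  order.\<close>

lemma C_k_Suc_D: "C_k (Suc k) \<phi> \<Longrightarrow> C_k k \<phi>"
proof (induction k arbitrary: \<phi>)
  case 0
  then show ?case by (simp add: differentiable_imp_continuous_on)
next
  case (Suc k)
  then show ?case using C_k.simps(2) by blast
qed

lemma C_k_const: "C_k k (\<lambda>x. c)"
proof (induction k arbitrary: c)
  case (Suc k)
  have "partial_deriv i (\<lambda>x::real^'a. c) = (\<lambda>x. 0)" for i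
    by (rule ext, subst partial_deriv_eqI[OF has_derivative_const]) simp
  then show ?case using Suc[of 0] by simp
qed simp

lemma C_k_add:
  assumes "C_k k f" "C_k k g"
  shows "C_k k (\<lambda>x. f x + g x)"
  using assms
proof (induction k arbitrary: f g)
  case 0
  then show ?case by (simp add: continuous_on_add)
next
  case (Suc k)
  then have d: "f differentiable (at x)" "g differentiable (at x)" for x
    by (auto simp: differentiable_on_def)
  have "partial_deriv i (\<lambda>x. f x + g x) = (\<lambda>x. partial_deriv i f x + partial_deriv i g x)" for i
    using partial_deriv_eqI[OF has_derivative_add[OF d(1)[unfolded frechet_derivative_works] d(2)[unfolded frechet_derivative_works]]]
    by (simp add: fun_eq_iff partial_deriv_def)
  then show ?case using Suc by (simp add: differentiable_on_def)
qed

lemma C_k_mult: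
  assumes "C_k k f" "C_k k g"
  shows "C_k k (\<lambda>x. f x * g x)"
  using assms
proof (induction k arbitrary: f g)
  case 0
  then show ?case by (simp add: continuous_on_mult)
next
  case (Suc k)
  then have d: "f differentiable (at x)" "g differentiable (at x)" for x
    by (auto simp: differentiable_on_def)
  have "partial_deriv i (\<lambda>x. f x * g x) = (\<lambda>x. f x * partial_deriv i g x + partial_deriv i f x * g x)" for i
    using partial_deriv_eqI[OF has_derivative_mult[OF d(1)[unfolded frechet_derivative_works] d(2)[unfolded frechet_derivative_works]]]
    by (simp add: fun_eq_iff partial_deriv_def)
  moreover have "C_k k (\<lambda>x. f x * partial_deriv i g x + partial_deriv i f x * g x)" for i
    using Suc.prems C_k_Suc_D[of k f] C_k_Suc_D[of k g] by (intro C_k_add Suc.IH) auto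
  ultimately show ?case using d by (auto simp: differentiable_on_def)
qed

lemma C_k_prod:
  assumes "\<And>i. i \<in> I \<Longrightarrow> C_k k (f i)"
  shows "C_k k (\<lambda>x. \<Prod>i\<in>I. f i x)"
  using assms by (induction I rule: infinite_finite_induct) (auto intro: C_k_const C_k_mult)

lemma C_k_translate: "C_k k \<phi> \<Longrightarrow> C_k k (\<lambda>x. \<phi> (x + z))"
  and partial_deriv_translate:
    "\<phi> differentiable_on UNIV \<Longrightarrow> partial_deriv i (\<lambda>x. \<phi> (x + z)) = (\<lambda>x. partial_deriv i \<phi> (x + z))"
proof -
  have d: "((\<lambda>x. \<phi> (x + z)) has_derivative frechet_derivative \<phi> (at (x + z))) (at x)"
    if "\<phi> differentiable_on UNIV" for \<phi> :: "real^'a \<Rightarrow> real" and x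
  proof -
    have "(\<phi> has_derivative frechet_derivative \<phi> (at (x + z))) (at (x + z))"
      using that by (simp add: differentiable_on_def frechet_derivative_works)
    moreover have "((\<lambda>x. x + z) has_derivative (\<lambda>h. h)) (at x)"
      by (auto intro!: derivative_eq_intros)
    ultimately show ?thesis by (rule has_derivative_compose[rotated])
  qed
  show p: "partial_deriv i (\<lambda>x. \<phi> (x + z)) = (\<lambda>x. partial_deriv i \<phi> (x + z))"
    if "\<phi> differentiable_on UNIV" for \<phi> :: "real^'a \<Rightarrow> real" and i
    using partial_deriv_eqI[OF d[OF that]] by (simp add: fun_eq_iff partial_deriv_def)
  show "C_k k \<phi> \<Longrightarrow> C_k k (\<lambda>x. \<phi> (x + z))"
  proof (induction k arbitrary: \<phi>)
    case 0
    then show ?case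
      by (auto intro!: continuous_intros continuous_on_compose2[of UNIV \<phi>])
  next
    case (Suc k)
    then show ?case using d[of \<phi>] p[of \<phi>]
      by (auto simp: differentiable_on_def differentiable_def)
  qed
qed

lemma test_function_C_k: "test_function \<phi> \<Longrightarrow> C_k k \<phi>"
  by (simp add: test_function_def)

lemma test_functionI:
  fixes \<phi> :: "real^'n::finite \<Rightarrow> real"
  assumes "\<And>k. C_k k \<phi>" "bounded K" "\<And>x. x \<notin> K \<Longrightarrow> \<phi> x = 0"
  shows "test_function \<phi>"
  unfolding test_function_def
proof (intro conjI allI assms(1))
  have "bounded {x. \<phi> x \<noteq> 0}" by (rule bounded_subset[OF assms(2)]) (use assms(3) in auto)
  then show "compact (closure {x. \<phi> x \<noteq> 0})" by simp
qed

lemma test_function_bounded: "test_function \<phi> \<Longrightarrow> bounded {x. \<phi> x \<noteq> 0}"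
  unfolding test_function_def by (metis bounded_subset closure_subset compact_imp_bounded)

lemma test_function_add:
  assumes "test_function \<phi>" "test_function \<psi>"
  shows "test_function (\<lambda>x. \<phi> x + \<psi> x)"
  by (rule test_functionI[of _ "{x. \<phi> x \<noteq> 0} \<union> {x. \<psi> x \<noteq> 0}"])
     (use assms in \<open>auto intro: C_k_add test_function_C_k test_function_bounded\<close>)

lemma test_function_scale:
  assumes "test_function \<phi>"
  shows "test_function (\<lambda>x. c * \<phi> x)"
  by (rule test_functionI[of _ "{x. \<phi> x \<noteq> 0}"])
     (use assms in \<open>auto intro: C_k_const C_k_mult test_function_C_k test_function_bounded\<close>)

lemma test_function_translate:
  fixes \<phi> :: "real^'n::finite \<Rightarrow> real"
  assumes "test_function \<phi>"
  shows "test_function (\<lambda>x. \<phi> (x + z))"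
proof (rule test_functionI)
  show "bounded ((\<lambda>x. x - z) ` {x. \<phi> x \<noteq> 0})"
    using bounded_translation_minus[OF test_function_bounded[OF assms]] .
  show "\<phi> (x + z) = 0" if "x \<notin> (\<lambda>x. x - z) ` {x. \<phi> x \<noteq> 0}" for x
    using that by (force simp: image_iff)
qed (use assms in \<open>auto intro: C_k_translate test_function_C_k\<close>)

lemma test_function_differentiable:
  assumes "test_function \<phi>"
  shows "\<phi> differentiable_on UNIV"
  using test_function_C_k[OF assms, of 1] by simp

lemma test_function_has_derivative:
  assumes "test_function \<phi>"
  shows "(\<phi> has_derivative (\<lambda>h. \<Sum>i\<in>UNIV. h $ i * partial_deriv i \<phi> x)) (at x)"
proof -
  have d: "(\<phi> has_derivative frechet_derivative \<phi> (at x)) (at x)"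
    using test_function_differentiable[OF assms] by (simp add: differentiable_on_def frechet_derivative_works)
  then interpret bounded_linear "frechet_derivative \<phi> (at x)"
    by (rule has_derivative_bounded_linear)
  have "frechet_derivative \<phi> (at x) h = (\<Sum>i\<in>UNIV. h $ i * partial_deriv i \<phi> x)" for h
  proof -
    have "h = (\<Sum>i\<in>UNIV. h $ i *\<^sub>R axis i 1)"
      using basis_expansion[of h] by (simp add: scalar_mult_eq_scaleR)
    then have "frechet_derivative \<phi> (at x) h = frechet_derivative \<phi> (at x) (\<Sum>i\<in>UNIV. h $ i *\<^sub>R axis i 1)"
      by simp
    then show ?thesis by (simp add: sum scaleR partial_deriv_def)
  qed
  then have "frechet_derivative \<phi> (at x) = (\<lambda>h. \<Sum>i\<in>UNIV. h $ i * partial_deriv i \<phi> x)" by auto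
  with d show ?thesis by simp
qed

section \<open>Smooth cutoff functions built from exp(-1/x)\<close>

definition exp_cutoff :: "real poly \<Rightarrow> real \<Rightarrow> real" where
  "exp_cutoff p x = (if 0 < x then poly p (1 / x) * exp (- (1 / x)) else 0)"

lemma tendsto_poly_times_exp_minus: "((\<lambda>y::real. poly p y * exp (- y)) \<longlongrightarrow> 0) at_top"
proof -
  have "((\<lambda>y::real. \<Sum>i\<le>degree p. coeff p i * (y ^ i / exp y)) \<longlongrightarrow> (\<Sum>i\<le>degree p. coeff p i * 0)) at_top"
    by (intro tendsto_intros tendsto_power_div_exp_0)
  then show ?thesis by (simp add: poly_altdef exp_minus divide_inverse sum_distrib_right mult.assoc)
qed

text \<open>With y = 1/x the chain rule turns p(y) exp(-y) into y^2 (p - p')(y) exp(-y), so the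
  family indexed by polynomials is closed under differentiation. Smoothness of the single function
  with p = 1 then becomes an induction with \<open>p\<close> arbitrary.\<close>

lemma exp_cutoff_has_derivative:
  "(exp_cutoff p has_real_derivative exp_cutoff ([:0, 0, 1:] * (p - pderiv p)) x) (at x)"
proof -
  consider "x > 0" | "x < 0" | "x = 0" by linarith
  then show ?thesis
  proof cases
    case 1
    have "((\<lambda>x. poly p (1 / x) * exp (- (1 / x))) has_real_derivative
        poly p (1 / x) * (exp (- (1 / x)) * (1 / x^2)) + poly (pderiv p) (1 / x) * (- (1 / x^2)) * exp (- (1 / x))) (at x)"
      using 1 by (auto intro!: derivative_eq_intros DERIV_chain2[OF poly_DERIV] simp: field_simps power2_eq_square)
    then have "((\<lambda>x. poly p (1 / x) * exp (- (1 / x))) has_real_derivative exp_cutoff ([:0, 0, 1:] * (p - pderiv p)) x) (at x)"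
      using 1 by (simp add: exp_cutoff_def algebra_simps power2_eq_square)
    then show ?thesis
      by (rule has_field_derivative_transform_within_open[of _ _ _ "{0<..}"]) (use 1 in \<open>auto simp: exp_cutoff_def\<close>)
  next
    case 2
    have "((\<lambda>x. 0) has_real_derivative exp_cutoff ([:0, 0, 1:] * (p - pderiv p)) x) (at x)"
      using 2 by (simp add: exp_cutoff_def)
    then show ?thesis
      by (rule has_field_derivative_transform_within_open[of _ _ _ "{..<0}"]) (use 2 in \<open>auto simp: exp_cutoff_def\<close>)
  next
    case 3
    have "((\<lambda>h. exp_cutoff p h / h) \<longlongrightarrow> 0) (at_left 0)"
      by (rule tendsto_eventually) (auto simp: eventually_at_left_field exp_cutoff_def intro: exI[of _ "-1"])
    moreover have "((\<lambda>h. exp_cutoff p h / h) \<longlongrightarrow> 0) (at_right 0)"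
    proof (rule Lim_transform_eventually)
      \<comment> \<open>With y = 1/h the quotient at 0 is y p(y) exp(-y); \<open>pCons 0 p\<close>
        is the polynomial y p(y).\<close>
      show "((\<lambda>h. poly (pCons 0 p) (inverse h) * exp (- inverse h)) \<longlongrightarrow> 0) (at_right 0)"
        by (rule filterlim_compose[OF tendsto_poly_times_exp_minus filterlim_inverse_at_top_right])
      show "\<forall>\<^sub>F h in at_right 0. poly (pCons 0 p) (inverse h) * exp (- inverse h) = exp_cutoff p h / h"
        using eventually_at_right_less by eventually_elim (auto simp: exp_cutoff_def field_simps)
    qed
    ultimately have "((\<lambda>h. exp_cutoff p h / h) \<longlongrightarrow> 0) (at 0)"
      by (simp add: filterlim_at_split)
    then show ?thesis using 3 by (simp add: DERIV_def exp_cutoff_def)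
  qed
qed

lemma C_k_exp_cutoff: "C_k k (\<lambda>x. exp_cutoff p (a + b * x $ i))"
proof -
  have d: "((\<lambda>x. exp_cutoff p (a + b * x $ i)) has_derivative
      (\<lambda>h. exp_cutoff ([:0, 0, 1:] * (p - pderiv p)) (a + b * x $ i) * (b * h $ i))) (at x)"
    for p and x :: "real^'a"
    by (rule has_derivative_compose[OF _ exp_cutoff_has_derivative[unfolded has_field_derivative_def]])
       (auto intro!: derivative_eq_intros bounded_linear_imp_has_derivative bounded_linear_vec_nth)
  show ?thesis
  proof (induction k arbitrary: p)
    case 0
    show ?case using d has_derivative_continuous
      by (auto simp: continuous_on_eq_continuous_at intro!: has_derivative_continuous)
  next
    case (Suc k)
    have "partial_deriv j (\<lambda>x::real^'a. exp_cutoff p (a + b * x $ i)) =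
        (\<lambda>x. exp_cutoff ([:0, 0, 1:] * (p - pderiv p)) (a + b * x $ i) * (if j = i then b else 0))" for j
      by (rule ext, subst partial_deriv_eqI[OF d]) (auto simp: axis_def)
    then have "C_k k (partial_deriv j (\<lambda>x::real^'a. exp_cutoff p (a + b * x $ i)))" for j
      using C_k_mult[OF Suc C_k_const] by simp
    moreover have "(\<lambda>x::real^'a. exp_cutoff p (a + b * x $ i)) differentiable (at x)" for x
      using d[of p x] by (rule differentiableI)
    ultimately show ?case by (simp add: differentiable_on_def)
  qed
qed

lemma exp_cutoff_1_bounds: "0 \<le> exp_cutoff 1 x" "exp_cutoff 1 x \<le> 1"
  by (auto simp: exp_cutoff_def)

lemma exp_cutoff_1_tendsto: "t > 0 \<Longrightarrow> (\<lambda>n. exp_cutoff 1 (real n * t)) \<longlonglongrightarrow> 1"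
proof -
  assume t: "t > 0"
  have "(\<lambda>n. exp (- (1 / t * (1 / real n)))) \<longlonglongrightarrow> exp (- (1 / t * 0))"
    by (intro tendsto_intros lim_1_over_n)
  then have "(\<lambda>n. exp (- (1 / t * (1 / real n)))) \<longlonglongrightarrow> 1" by simp
  moreover have "\<forall>\<^sub>F n in sequentially. exp (- (1 / t * (1 / real n))) = exp_cutoff 1 (real n * t)"
    using eventually_gt_at_top[of 0] by eventually_elim (use t in \<open>simp add: exp_cutoff_def\<close>)
  ultimately show ?thesis by (rule Lim_transform_eventually)
qed

text \<open>Each factor vanishes unless x lies strictly on the inner side of a face, and the
  dilation by \<open>n\<close> drives it to 1 there. All members vanish outside the open box, and
  the box indicator is both their limit and their dominating function.\<close>

definition box_cutoff :: "real^'n \<Rightarrow> real^'n \<Rightarrow> nat \<Rightarrow> real^'n::finite \<Rightarrow> real" where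
  "box_cutoff a b n x = (\<Prod>i\<in>UNIV. exp_cutoff 1 (real n * (x $ i - a $ i)) * exp_cutoff 1 (real n * (b $ i - x $ i)))"

lemma box_cutoff_outside:
  assumes "x \<notin> box a b"
  shows "box_cutoff a b n x = 0"
proof -
  obtain i where "x $ i \<le> a $ i \<or> b $ i \<le> x $ i" using assms by (auto simp: mem_box_cart not_less)
  then have "real n * (x $ i - a $ i) \<le> 0 \<or> real n * (b $ i - x $ i) \<le> 0"
    by (auto simp: mult_nonneg_nonpos)
  then have "exp_cutoff 1 (real n * (x $ i - a $ i)) * exp_cutoff 1 (real n * (b $ i - x $ i)) = 0"
    unfolding exp_cutoff_def by auto
  then show ?thesis unfolding box_cutoff_def by (subst prod_zero_iff) auto
qed

lemma box_cutoff_bounds: "0 \<le> box_cutoff a b n x" "box_cutoff a b n x \<le> 1"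
  unfolding box_cutoff_def
  by (auto intro!: prod_nonneg prod_le_1 mult_le_one simp: exp_cutoff_1_bounds)

lemma box_cutoff_tendsto:
  "(\<lambda>n. box_cutoff a b n x) \<longlonglongrightarrow> indicator (box a b) x"
proof (cases "x \<in> box a b")
  case True
  have "(\<lambda>n. box_cutoff a b n x) \<longlonglongrightarrow> (\<Prod>i\<in>(UNIV::'a set). 1 * 1)"
    unfolding box_cutoff_def using True
    by (intro tendsto_prod tendsto_mult exp_cutoff_1_tendsto) (auto simp: mem_box_cart)
  then show ?thesis using True by simp
qed (simp add: box_cutoff_outside)

lemma test_function_box_cutoff: "test_function (box_cutoff a b n)"
proof (rule test_functionI[of _ "box a b"])
  have "C_k k (\<lambda>x. exp_cutoff 1 (- real n * a $ i + real n * x $ i) * exp_cutoff 1 (real n * b $ i + (- real n) * x $ i))" for k i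
    by (intro C_k_mult C_k_exp_cutoff)
  then show "C_k k (box_cutoff a b n)" for k
    unfolding box_cutoff_def[abs_def] by (intro C_k_prod) (simp add: right_diff_distrib add.commute)
qed (auto simp: box_cutoff_outside)

section \<open>Density of test functions\<close>

text \<open>Dominated convergence for the squared differences: the limit inherits the bound
  \<open>b\<close>, so they are at most \<open>4 * (b x)\<^sup>2\<close>.\<close>

lemma abs_L2_tendsto:
  fixes a :: "real^'n::finite \<Rightarrow> real"
  assumes "\<And>n. square_integrable (s n)" "square_integrable a" "square_integrable b"
    and "AE x in lebesgue. (\<lambda>n. s n x) \<longlonglongrightarrow> a x" "\<And>n. AE x in lebesgue. \<bar>s n x\<bar> \<le> b x"
  shows "(\<lambda>n. abs_L2 (s n)) \<longlonglongrightarrow> abs_L2 a"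
proof -
  have m[measurable]: "\<And>n. s n \<in> borel_measurable lebesgue" "a \<in> borel_measurable lebesgue" "b \<in> borel_measurable lebesgue"
    using assms(1-3) by (auto simp: square_integrable_def)
  have bd: "AE x in lebesgue. \<forall>n. \<bar>s n x\<bar> \<le> b x" using assms(5) by (simp add: AE_all_countable)
  have "(\<lambda>n. \<integral>x. (s n x - a x)\<^sup>2 \<partial>lebesgue) \<longlonglongrightarrow> integral\<^sup>L lebesgue (\<lambda>x::real^'n. 0)"
  proof (rule integral_dominated_convergence)
    show "integrable lebesgue (\<lambda>x. 4 * (b x)\<^sup>2)"
      using assms(3) by (simp add: square_integrable_def)
    show "AE x in lebesgue. (\<lambda>n. (s n x - a x)\<^sup>2) \<longlonglongrightarrow> 0"
      using assms(4)
    proof eventually_elim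
      case (elim x)
      have "(\<lambda>n. (s n x - a x)\<^sup>2) \<longlonglongrightarrow> (a x - a x)\<^sup>2" using elim by (intro tendsto_intros)
      then show ?case by simp
    qed
    show "AE x in lebesgue. norm ((s n x - a x)\<^sup>2) \<le> 4 * (b x)\<^sup>2" for n
      using assms(4) bd
    proof eventually_elim
      case (elim x)
      have "\<bar>a x\<bar> \<le> b x"
        by (rule LIMSEQ_le_const2[OF tendsto_rabs[OF elim(1)]]) (use elim in auto)
      then have "\<bar>s n x - a x\<bar> \<le> 2 * b x" using elim(2)[rule_format, of n] by linarith
      then have "\<bar>s n x - a x\<bar>\<^sup>2 \<le> (2 * b x)\<^sup>2" by (intro power_mono) auto
      then show ?case by simp
    qed
  qed auto
  then have "(\<lambda>n. (norm (abs_L2 (s n) - abs_L2 a))\<^sup>2) \<longlonglongrightarrow> 0"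
    using assms(1,2) by (simp add: norm_abs_L2 square_integrable_diff flip: abs_L2_diff)
  then have "(\<lambda>n. sqrt ((norm (abs_L2 (s n) - abs_L2 a))\<^sup>2)) \<longlonglongrightarrow> sqrt 0"
    by (rule tendsto_real_sqrt)
  then show ?thesis by (simp add: tendsto_norm_zero_iff LIM_zero_iff)
qed

definition test_L2 :: "'n::finite L2 set" where
  "test_L2 = abs_L2 ` {\<phi>. test_function \<phi>}"

lemma closure_test_L2_add:
  assumes "u \<in> closure test_L2" "v \<in> closure test_L2"
  shows "u + v \<in> closure test_L2"
proof -
  obtain s t where "\<And>n::nat. s n \<in> test_L2" "s \<longlonglongrightarrow> u" "\<And>n::nat. t n \<in> test_L2" "t \<longlonglongrightarrow> v"
    using assms by (auto simp: closure_sequential)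
  moreover have "a + b \<in> test_L2" if "a \<in> test_L2" "b \<in> test_L2" for a b
    using that by (auto simp: test_L2_def test_function_square_integrable simp flip: abs_L2_add
      intro!: imageI test_function_add)
  ultimately show ?thesis unfolding closure_sequential
    by (intro exI[of _ "\<lambda>n. s n + t n"]) (auto intro: tendsto_add)
qed

lemma closure_test_L2_scaleR:
  assumes "u \<in> closure test_L2"
  shows "c *\<^sub>R u \<in> closure test_L2"
proof -
  obtain s where "\<And>n::nat. s n \<in> test_L2" "s \<longlonglongrightarrow> u"
    using assms by (auto simp: closure_sequential)
  moreover have "c *\<^sub>R a \<in> test_L2" if "a \<in> test_L2" for a
    using that by (auto simp: test_L2_def test_function_square_integrable simp flip: abs_L2_scaleR
      intro!: imageI test_function_scale)
  ultimately show ?thesis unfolding closure_sequential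
    by (intro exI[of _ "\<lambda>n. c *\<^sub>R s n"]) (auto intro: tendsto_intros)
qed

lemma closure_test_L2_limit:
  assumes "\<And>n::nat. s n \<in> closure test_L2" "s \<longlonglongrightarrow> u"
  shows "u \<in> closure test_L2"
  using closed_sequentially[OF closed_closure] assms by blast

lemma square_integrable_indicator:
  fixes A :: "(real^'n::finite) set"
  assumes "A \<in> sets lebesgue" "emeasure lebesgue A < \<infinity>"
  shows "square_integrable (indicator A)"
proof -
  have "(\<lambda>x. (indicator A x :: real)\<^sup>2) = indicator A" by (auto simp: indicator_def)
  then show ?thesis using assms by (auto simp: square_integrable_def)
qed

lemma square_integrable_indicator_Int_box:
  fixes A :: "(real^'n::finite) set"
  assumes "A \<in> sets borel"
  shows "square_integrable (indicator (A \<inter> box c d))"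
proof (rule square_integrable_indicator)
  show "A \<inter> box c d \<in> sets lebesgue" using assms by auto
  have "emeasure lebesgue (A \<inter> box c d) \<le> emeasure lebesgue (box c d)"
    by (rule emeasure_mono) auto
  then show "emeasure lebesgue (A \<inter> box c d) < \<infinity>"
    using emeasure_lborel_box_finite[of c d] by (auto simp: less_top)
qed

lemma indicator_box_in_closure: "abs_L2 (indicator (box a b)) \<in> closure test_L2"
proof (rule closure_test_L2_limit)
  show "abs_L2 (box_cutoff a b n) \<in> closure test_L2" for n
    by (rule subsetD[OF closure_subset]) (auto simp: test_L2_def test_function_box_cutoff)
  show "(\<lambda>n. abs_L2 (box_cutoff a b n)) \<longlonglongrightarrow> abs_L2 (indicator (box a b))"
  proof (rule abs_L2_tendsto[where b = "indicator (box a b)"])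
    show "AE x in lebesgue. \<bar>box_cutoff a b n x\<bar> \<le> indicator (box a b) x" for n
      using box_cutoff_bounds[of a b n] box_cutoff_outside[of _ a b n]
      by (intro always_eventually) (simp add: indicator_def)
    show "AE x in lebesgue. (\<lambda>n. box_cutoff a b n x) \<longlonglongrightarrow> indicator (box a b) x"
      by (intro always_eventually allI box_cutoff_tendsto)
  qed (use square_integrable_indicator_Int_box[of UNIV a b] in
         \<open>auto simp: test_function_square_integrable test_function_box_cutoff\<close>)
qed

lemma zero_in_closure_test_L2: "abs_L2 (\<lambda>x. 0) \<in> closure test_L2"
  using closure_test_L2_scaleR[OF indicator_box_in_closure, of 0] by (simp add: zero_L2_def)

text \<open>Dynkin's argument with the intersection-stable generator of open boxes. Intersecting
  with a fixed box keeps all measures finite, so that complements become differences and disjoint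
  unions become dominated limits inside L^2.\<close>

lemma indicator_Int_box_in_closure:
  fixes A :: "(real^'n::finite) set"
  assumes "A \<in> sets borel"
  shows "abs_L2 (indicator (A \<inter> box c d)) \<in> closure test_L2"
proof -
  let ?G = "range (\<lambda>(a, b). box a b :: (real^'n) set)"
  have sig: "sets borel = sigma_sets UNIV ?G"
    unfolding borel_eq_box by (rule sets_measure_of) auto
  from assms have "A \<in> sigma_sets UNIV ?G" by (simp only: sig)
  have "Int_stable ?G" "?G \<subseteq> Pow UNIV" by (auto simp: Int_stable_def box_Int_box)
  from this \<open>A \<in> sigma_sets UNIV ?G\<close> show ?thesis
  proof (induction rule: sigma_sets_induct_disjoint)
    fix A assume "A \<in> ?G"
    then show "abs_L2 (indicator (A \<inter> box c d)) \<in> closure test_L2"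
      using indicator_box_in_closure by (auto simp: box_Int_box)
  next
    have "indicator ({} \<inter> box c d) = (\<lambda>x::real^'n. 0::real)" by auto
    then show "abs_L2 (indicator ({} \<inter> box c d)) \<in> closure test_L2"
      using zero_in_closure_test_L2 by simp
  next
    fix A assume A: "A \<in> sigma_sets UNIV ?G" "abs_L2 (indicator (A \<inter> box c d)) \<in> closure test_L2"
    have "indicator ((UNIV - A) \<inter> box c d) = (\<lambda>x. indicator (box c d) x - indicator (A \<inter> box c d) x :: real)"
      by (auto simp: indicator_def)
    then have "abs_L2 (indicator ((UNIV - A) \<inter> box c d)) = abs_L2 (indicator (box c d)) + (-1) *\<^sub>R abs_L2 (indicator (A \<inter> box c d))"
      using square_integrable_indicator_Int_box[of UNIV c d] square_integrable_indicator_Int_box[of A c d] A(1)[folded sig]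
      by (simp add: abs_L2_diff)
    then show "abs_L2 (indicator ((UNIV - A) \<inter> box c d)) \<in> closure test_L2"
      using closure_test_L2_add[OF indicator_box_in_closure closure_test_L2_scaleR[OF A(2)], of c d "-1"] by simp
  next
    fix A :: "nat \<Rightarrow> (real^'n) set"
    assume A: "disjoint_family A" "range A \<subseteq> sigma_sets UNIV ?G"
      "\<And>i. abs_L2 (indicator (A i \<inter> box c d)) \<in> closure test_L2"
    from A(2)[folded sig] have b: "A i \<in> sets borel" for i by auto
    have u: "(\<Union>i<n. A i) \<in> sets borel" for n using b by auto
    show "abs_L2 (indicator (\<Union> (range A) \<inter> box c d)) \<in> closure test_L2"
    proof (rule closure_test_L2_limit)
      show "abs_L2 (indicator ((\<Union>i<n. A i) \<inter> box c d)) \<in> closure test_L2" for n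
      proof (induction n)
        case 0
        have "indicator ((\<Union>i<0. A i) \<inter> box c d) = (\<lambda>x::real^'n. 0::real)" by auto
        then show ?case using zero_in_closure_test_L2 by simp
      next
        case (Suc n)
        have dj: "A n \<inter> A i = {}" if "i < n" for i
          using that A(1) by (metis UNIV_I disjoint_family_on_def less_irrefl)
        have "indicator ((\<Union>i<Suc n. A i) \<inter> box c d) =
            (\<lambda>x. indicator ((\<Union>i<n. A i) \<inter> box c d) x + indicator (A n \<inter> box c d) x :: real)"
          using dj by (fastforce simp: indicator_def less_Suc_eq)
        then show ?case
          using closure_test_L2_add[OF Suc A(3)[of n]] square_integrable_indicator_Int_box[OF b[of n]]
            square_integrable_indicator_Int_box[OF u[of n]]
          by (simp add: abs_L2_add)
      qed
      show "(\<lambda>n. abs_L2 (indicator ((\<Union>i<n. A i) \<inter> box c d))) \<longlonglongrightarrow> abs_L2 (indicator (\<Union> (range A) \<inter> box c d))"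
      proof (rule abs_L2_tendsto[where b = "indicator (box c d)"])
        show "AE x in lebesgue. (\<lambda>n. indicator ((\<Union>i<n. A i) \<inter> box c d) x) \<longlonglongrightarrow> (indicator (\<Union> (range A) \<inter> box c d) x :: real)"
        proof (intro always_eventually allI)
          fix x
          show "(\<lambda>n. indicator ((\<Union>i<n. A i) \<inter> box c d) x) \<longlonglongrightarrow> (indicator (\<Union> (range A) \<inter> box c d) x :: real)"
          proof (cases "x \<in> \<Union> (range A) \<inter> box c d")
            case True
            then obtain i where "x \<in> A i" by auto
            with True have "\<forall>\<^sub>F n in sequentially. indicator ((\<Union>i<n. A i) \<inter> box c d) x = (1::real)"
              by (intro eventually_mono[OF eventually_gt_at_top[of i]]) (auto simp: indicator_def)
            with True show ?thesis by (simp add: tendsto_eventually)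
          next
            case False
            then have "\<And>n. indicator ((\<Union>i<n. A i) \<inter> box c d) x = (0::real)" by auto
            with False show ?thesis by simp
          qed
        qed
      qed (use b u square_integrable_indicator_Int_box[of UNIV c d] in
            \<open>auto intro!: square_integrable_indicator_Int_box simp: indicator_def\<close>)
    qed
  qed
qed

text \<open>A Borel version \<open>w\<close> of the class is the limit of simple functions
  \<open>s n\<close> bounded by \<open>2 * \<bar>w x\<bar>\<close>. Cut off to the growing boxes
  \<open>?B n\<close> they are finite combinations of the indicators treated before, and the bound
  gives convergence in L^2.\<close>

theorem closure_test_L2: "closure test_L2 = (UNIV :: 'n::finite L2 set)"
proof -
  have "v \<in> closure test_L2" for v :: "'n L2"
  proof -
    let ?B = "\<lambda>n::nat. box (- (\<chi> i. real n)) (\<chi> i. real n) :: (real^'n) set"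
    obtain w where w[measurable]: "w \<in> borel_measurable lborel" and weq: "AE x in lborel. rep_L2 v x = w x"
      using completion_ex_borel_measurable_real[OF rep_L2_measurable] by blast
    have wm[measurable]: "w \<in> borel_measurable lebesgue" using w by (rule measurable_completion)
    have weq': "AE x in lebesgue. rep_L2 v x = w x" using weq by (rule AE_completion)
    have "integrable lebesgue (\<lambda>x. (w x)\<^sup>2) = integrable lebesgue (\<lambda>x. (rep_L2 v x)\<^sup>2)"
    proof (rule integrable_cong_AE)
      show "AE x in lebesgue. (w x)\<^sup>2 = (rep_L2 v x)\<^sup>2" using weq' by eventually_elim simp
    qed auto
    then have wsq: "square_integrable w"
      using rep_L2_square_integrable[of v] by (simp add: square_integrable_def wm)
    obtain s where s: "\<And>i::nat. simple_function lborel (s i)"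
        "\<And>x. (\<lambda>i. s i x) \<longlonglongrightarrow> w x" "\<And>i x. dist (s i x) 0 \<le> 2 * dist (w x) 0"
      using borel_measurable_implies_sequence_metric[OF w, of 0] by auto
    have m: "s n -` {y} \<in> sets borel" for n y
      using simple_functionD(2)[OF s(1), of n "{y}"] by simp
    have sm: "s n \<in> borel_measurable lborel" for n
      using s(1) borel_measurable_simple_function by blast
    have ts: "square_integrable (\<lambda>x. indicator (?B n) x * s n x)" for n
      unfolding square_integrable_def
    proof
      show me: "(\<lambda>x. indicator (?B n) x * s n x) \<in> borel_measurable lebesgue"
        by (rule measurable_completion) (use sm in measurable)
      show "integrable lebesgue (\<lambda>x. (indicator (?B n) x * s n x)\<^sup>2)"
      proof (rule Bochner_Integration.integrable_bound)
        show "integrable lebesgue (\<lambda>x. 4 * (w x)\<^sup>2)" using wsq by (simp add: square_integrable_def)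
        show "AE x in lebesgue. norm ((indicator (?B n) x * s n x)\<^sup>2) \<le> norm (4 * (w x)\<^sup>2)"
        proof (intro always_eventually allI)
          fix x
          have "\<bar>s n x\<bar>\<^sup>2 \<le> (2 * \<bar>w x\<bar>)\<^sup>2" using s(3)[of n x] by (intro power_mono) auto
          then show "norm ((indicator (?B n) x * s n x)\<^sup>2) \<le> norm (4 * (w x)\<^sup>2)"
            by (auto simp: indicator_def)
        qed
      qed (use me in auto)
    qed
    have "abs_L2 (\<lambda>x. indicator (?B n) x * s n x) \<in> closure test_L2" for n
    proof -
      have fin: "finite (range (s n))" using simple_functionD(1)[OF s(1)] by simp
      have si: "square_integrable (\<lambda>x. y * indicator (s n -` {y} \<inter> ?B n) x)" for y
        by (intro square_integrable_scale square_integrable_indicator_Int_box m)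
      have "square_integrable (\<lambda>x. \<Sum>y\<in>Y. y * indicator (s n -` {y} \<inter> ?B n) x) \<and>
          abs_L2 (\<lambda>x. \<Sum>y\<in>Y. y * indicator (s n -` {y} \<inter> ?B n) x) \<in> closure test_L2"
        if "finite Y" for Y
        using that
      proof (induction Y)
        case empty
        show ?case using zero_in_closure_test_L2 by (simp add: square_integrable_0)
      next
        case (insert y Y)
        have "abs_L2 (\<lambda>x. y * indicator (s n -` {y} \<inter> ?B n) x) \<in> closure test_L2"
          unfolding abs_L2_scaleR[OF square_integrable_indicator_Int_box[OF m]]
          by (intro closure_test_L2_scaleR indicator_Int_box_in_closure m)
        note c = this
        show ?case
          unfolding sum.insert[OF insert.hyps] abs_L2_add[OF si conjunct1[OF insert.IH]]
          by (intro conjI square_integrable_add[OF si conjunct1[OF insert.IH]]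
              closure_test_L2_add[OF c conjunct2[OF insert.IH]])
      qed
      from conjunct2[OF this[OF fin]]
      have "abs_L2 (\<lambda>x. \<Sum>y\<in>range (s n). y * indicator (s n -` {y} \<inter> ?B n) x) \<in> closure test_L2" .
      moreover have "(\<Sum>y\<in>range (s n). y * indicator (s n -` {y} \<inter> ?B n) x) = indicator (?B n) x * s n x" for x
      proof -
        have "(\<Sum>y\<in>range (s n). y * indicator (s n -` {y} \<inter> ?B n) x) =
            (\<Sum>y\<in>range (s n). if y = s n x then indicator (?B n) x * s n x else 0)"
          by (rule sum.cong) (auto simp: indicator_def)
        then show ?thesis using fin by simp
      qed
      ultimately show ?thesis by simp
    qed
    moreover have "(\<lambda>n. abs_L2 (\<lambda>x. indicator (?B n) x * s n x)) \<longlonglongrightarrow> abs_L2 w"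
    proof (rule abs_L2_tendsto[OF ts wsq])
      show "square_integrable (\<lambda>x. 2 * \<bar>w x\<bar>)"
        using wsq by (intro square_integrable_scale) (auto simp: square_integrable_def)
      show "AE x in lebesgue. \<bar>indicator (?B n) x * s n x\<bar> \<le> 2 * \<bar>w x\<bar>" for n
        using s(3)[of n] by (auto simp: indicator_def)
      show "AE x in lebesgue. (\<lambda>n. indicator (?B n) x * s n x) \<longlonglongrightarrow> w x"
      proof (intro always_eventually allI)
        fix x :: "real^'n"
        obtain k :: nat where k: "norm x < real k" using reals_Archimedean2 by blast
        have "\<forall>\<^sub>F n in sequentially. s n x = indicator (?B n) x * s n x"
          using eventually_ge_at_top[of k]
        proof eventually_elim
          case (elim n)
          have "\<bar>x $ i\<bar> < real n" for i using component_le_norm_cart[of x i] k elim by linarith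
          then have "x \<in> ?B n" unfolding mem_box_cart by (auto simp: abs_less_iff) (metis minus_less_iff)
          then show ?case by simp
        qed
        then show "(\<lambda>n. indicator (?B n) x * s n x) \<longlonglongrightarrow> w x"
          by (rule Lim_transform_eventually[OF s(2)])
      qed
    qed
    ultimately have "abs_L2 w \<in> closure test_L2" by (rule closure_test_L2_limit)
    moreover have "abs_L2 w = v"
      by (rule L2_eqI) (use rep_abs_L2[OF wsq] weq' in eventually_elim, simp)
    ultimately show ?thesis by simp
  qed
  then show ?thesis by auto
qed

lemma test_L2_approx:
  fixes v :: "'n::finite L2"
  assumes "\<epsilon> > 0"
  obtains \<phi> where "test_function \<phi>" "norm (v - abs_L2 \<phi>) < \<epsilon>"
proof -
  have "v \<in> closure test_L2" by (simp add: closure_test_L2)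
  then obtain a where "a \<in> test_L2" "dist a v < \<epsilon>" using assms unfolding closure_approachable by blast
  then show ?thesis using that by (auto simp: test_L2_def dist_norm norm_minus_commute)
qed

section \<open>Weak directional derivatives and difference quotients\<close>

definition dir_deriv :: "real^'n \<Rightarrow> (real^'n::finite \<Rightarrow> real) \<Rightarrow> real^'n \<Rightarrow> real" where
  "dir_deriv h \<phi> x = (\<Sum>i\<in>UNIV. h $ i * partial_deriv i \<phi> x)"

text \<open>Arbitrary directions are needed because the averages below shift along all vectors of a
  cube. The identity is phrased by \<open>inner\<close>, so that adjoints of translations and
  density can act on it.\<close>

definition weak_dir :: "real^'n \<Rightarrow> 'n::finite L2 \<Rightarrow> 'n L2 \<Rightarrow> bool" where
  "weak_dir h u d \<longleftrightarrow> (\<forall>\<phi>. test_function \<phi> \<longrightarrow>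
     inner u (abs_L2 (dir_deriv h \<phi>)) = - inner d (abs_L2 \<phi>))"

lemma square_integrable_dir_deriv: "test_function \<phi> \<Longrightarrow> square_integrable (dir_deriv h \<phi>)"
proof -
  assume \<phi>: "test_function \<phi>"
  have "square_integrable (\<lambda>x. \<Sum>i\<in>I. h $ i * partial_deriv i \<phi> x)" if "finite I" for I
    using that by induction
      (auto intro!: square_integrable_0 square_integrable_add square_integrable_scale test_function_square_integrable(2)[OF \<phi>])
  then show ?thesis by (simp add: dir_deriv_def[abs_def])
qed

lemma abs_L2_dir_deriv:
  assumes \<phi>: "test_function \<phi>"
  shows "abs_L2 (dir_deriv h \<phi>) = (\<Sum>i\<in>UNIV. h $ i *\<^sub>R abs_L2 (partial_deriv i \<phi>))"
proof -
  have "square_integrable (\<lambda>x. \<Sum>i\<in>I. h $ i * partial_deriv i \<phi> x) \<and>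
    abs_L2 (\<lambda>x. \<Sum>i\<in>I. h $ i * partial_deriv i \<phi> x) = (\<Sum>i\<in>I. h $ i *\<^sub>R abs_L2 (partial_deriv i \<phi>))"
    if "finite I" for I
    using that
  proof induction
    case empty
    then show ?case by (simp add: square_integrable_0 zero_L2_def)
  next
    case (insert i I)
    have s: "square_integrable (\<lambda>x. h $ i * partial_deriv i \<phi> x)"
      by (intro square_integrable_scale test_function_square_integrable \<phi>)
    show ?case
      using insert square_integrable_add[OF s conjunct1[OF insert.IH]]
        abs_L2_add[OF s conjunct1[OF insert.IH]]
        abs_L2_scaleR[OF test_function_square_integrable(2)[OF \<phi>], of "h $ i" i]
      by simp
  qed
  then show ?thesis by (simp add: dir_deriv_def[abs_def])
qed

lemma weak_partial_inner:
  assumes "weak_partial i u g" "test_function \<phi>"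
  shows "inner u (abs_L2 (partial_deriv i \<phi>)) = - inner g (abs_L2 \<phi>)"
  using assms by (simp add: weak_partial_def inner_abs_L2 test_function_square_integrable)

lemma weak_dir_gradient:
  assumes "\<And>i. weak_partial i u (g i)"
  shows "weak_dir h u (\<Sum>i\<in>UNIV. h $ i *\<^sub>R g i)"
  unfolding weak_dir_def
  by (simp add: abs_L2_dir_deriv inner_sum_right inner_sum_left weak_partial_inner[OF assms] sum_negf)

lemma dir_deriv_axis: "dir_deriv (axis i 1) \<phi> = partial_deriv i \<phi>"
proof
  fix x
  have "(\<Sum>j\<in>UNIV. axis i 1 $ j * partial_deriv j \<phi> x) =
      (\<Sum>j\<in>UNIV. if j = i then partial_deriv j \<phi> x else 0)"
    by (rule sum.cong) (auto simp: axis_def)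
  then show "dir_deriv (axis i 1) \<phi> x = partial_deriv i \<phi> x" by (simp add: dir_deriv_def)
qed

lemma weak_partial_iff_weak_dir: "weak_partial i u g \<longleftrightarrow> weak_dir (axis i 1) u g"
  by (simp add: weak_partial_def weak_dir_def dir_deriv_axis inner_abs_L2 test_function_square_integrable)

lemma dir_deriv_translate:
  assumes "test_function \<phi>"
  shows "dir_deriv h (\<lambda>x. \<phi> (x + z)) = (\<lambda>x. dir_deriv h \<phi> (x + z))"
  by (simp add: dir_deriv_def fun_eq_iff partial_deriv_translate[OF test_function_differentiable[OF assms]])

lemma weak_dir_translate:
  assumes "weak_dir h u d"
  shows "weak_dir h (translate_L2 z u) (translate_L2 z d)"
  unfolding weak_dir_def
proof (intro allI impI)
  fix \<phi> :: "real^'a \<Rightarrow> real" assume \<phi>: "test_function \<phi>"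
  have "inner u (abs_L2 (dir_deriv h (\<lambda>x. \<phi> (x + - z)))) = - inner d (abs_L2 (\<lambda>x. \<phi> (x + - z)))"
    using assms test_function_translate[OF \<phi>, of "- z"] unfolding weak_dir_def by blast
  then show "inner (translate_L2 z u) (abs_L2 (dir_deriv h \<phi>)) = - inner (translate_L2 z d) (abs_L2 \<phi>)"
    using translate_abs_L2[OF square_integrable_dir_deriv[OF \<phi>], of "- z" h]
      translate_abs_L2[OF test_function_square_integrable(1)[OF \<phi>], of "- z"]
    by (simp only: dir_deriv_translate[OF \<phi>] inner_translate_L2_left)
qed

section \<open>Convergence of difference quotients\<close>

lemma test_function_line_derivative:
  assumes \<phi>: "test_function \<phi>"
  shows "((\<lambda>t. \<phi> (x + t *\<^sub>R h)) has_real_derivative dir_deriv h \<phi> (x + s *\<^sub>R h)) (at s)"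
proof -
  have "((\<lambda>t. x + t *\<^sub>R h) has_derivative (\<lambda>t. t *\<^sub>R h)) (at s)"
    by (auto intro!: derivative_eq_intros)
  from has_derivative_compose[OF this test_function_has_derivative[OF \<phi>]]
  moreover have "(\<lambda>t. \<Sum>i\<in>UNIV. (t *\<^sub>R h) $ i * partial_deriv i \<phi> (x + s *\<^sub>R h)) = (*) (dir_deriv h \<phi> (x + s *\<^sub>R h))"
    by (simp add: fun_eq_iff dir_deriv_def sum_distrib_left sum_distrib_right mult_ac)
  ultimately show ?thesis by (simp add: has_field_derivative_def)
qed

lemma dir_deriv_bounded:
  fixes \<phi> :: "real^'n::finite \<Rightarrow> real"
  assumes \<phi>: "test_function \<phi>"
  obtains L where "L \<ge> 0" "\<And>x. \<bar>dir_deriv h \<phi> x\<bar> \<le> L"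
proof -
  let ?K = "closure {x. \<phi> x \<noteq> 0}"
  have "C_k 1 \<phi>" using \<phi> by (rule test_function_C_k)
  then have "continuous_on UNIV (dir_deriv h \<phi>)"
    unfolding dir_deriv_def[abs_def] by (intro continuous_intros) auto
  then have "compact (dir_deriv h \<phi> ` ?K)"
    using \<phi> unfolding test_function_def
    by (meson compact_continuous_image continuous_on_subset top_greatest)
  then obtain L where L: "\<And>x. x \<in> ?K \<Longrightarrow> \<bar>dir_deriv h \<phi> x\<bar> \<le> L"
    using compact_imp_bounded bounded_iff by (metis imageI real_norm_def)
  have "\<bar>dir_deriv h \<phi> x\<bar> \<le> \<bar>L\<bar>" for x
  proof (cases "x \<in> ?K")
    case True
    then show ?thesis using L by fastforce
  qed (simp add: dir_deriv_def partial_deriv_eq_0)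
  then show ?thesis using that[of "\<bar>L\<bar>"] by simp
qed

text \<open>Pointwise convergence is differentiability along the line; the mean value theorem and
  the bounded support provide a dominating function.\<close>

lemma difference_quotient_test:
  fixes \<phi> :: "real^'n::finite \<Rightarrow> real"
  assumes \<phi>: "test_function \<phi>"
  shows "((\<lambda>t. (1 / t) *\<^sub>R (translate_L2 (t *\<^sub>R h) (abs_L2 \<phi>) - abs_L2 \<phi>)) \<longlongrightarrow> abs_L2 (dir_deriv h \<phi>)) (at 0)"
  unfolding tendsto_at_iff_sequentially
proof (intro allI impI)
  fix X :: "nat \<Rightarrow> real"
  assume X0: "\<forall>i. X i \<in> UNIV - {0}" and X: "X \<longlonglongrightarrow> 0"
  obtain N where N: "\<And>n. n \<ge> N \<Longrightarrow> \<bar>X n\<bar> < 1"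
    using LIMSEQ_D[OF X, of 1] by auto
  obtain L where L: "L \<ge> 0" "\<And>x. \<bar>dir_deriv h \<phi> x\<bar> \<le> L" using dir_deriv_bounded[OF \<phi>] by blast
  obtain R where R: "\<And>x. \<phi> x \<noteq> 0 \<Longrightarrow> norm x \<le> R"
    using test_function_bounded[OF \<phi>] by (auto simp: bounded_iff)
  \<comment> \<open>From index \<open>N\<close> on the shift has length at most
    \<open>norm h\<close>, so neither the test function nor its shift lives outside this
    ball.\<close>
  let ?B = "cball 0 (R + norm h) :: (real^'n) set"
  let ?s = "\<lambda>n x. 1 / X (n + N) * (\<phi> (x + X (n + N) *\<^sub>R h) - \<phi> x)"
  have sq: "square_integrable (\<lambda>x. \<phi> (x + z) - \<phi> x)" for z
    by (intro square_integrable_diff square_integrable_translate test_function_square_integrable \<phi>)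
  have "(\<lambda>n. abs_L2 (?s n)) \<longlonglongrightarrow> abs_L2 (dir_deriv h \<phi>)"
  proof (rule abs_L2_tendsto[where b = "\<lambda>x. L * indicator ?B x"])
    show "square_integrable (?s n)" for n
      by (intro square_integrable_scale sq)
    show "square_integrable (dir_deriv h \<phi>)" by (rule square_integrable_dir_deriv[OF \<phi>])
    show "square_integrable (\<lambda>x. L * indicator ?B x)"
      by (intro square_integrable_scale square_integrable_indicator)
         (use emeasure_bounded_finite[OF bounded_cball, of 0 "R + norm h"] in auto)
    show "AE x in lebesgue. (\<lambda>n. ?s n x) \<longlonglongrightarrow> dir_deriv h \<phi> x"
    proof (intro always_eventually allI)
      fix x
      have "((\<lambda>t. (\<phi> (x + t *\<^sub>R h) - \<phi> x) / t) \<longlongrightarrow> dir_deriv h \<phi> x) (at 0)"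
        using test_function_line_derivative[OF \<phi>, of x h 0] by (simp add: DERIV_def)
      then have "(\<lambda>n. (\<phi> (x + X n *\<^sub>R h) - \<phi> x) / X n) \<longlonglongrightarrow> dir_deriv h \<phi> x"
        using X X0 unfolding tendsto_at_iff_sequentially comp_def by blast
      from LIMSEQ_ignore_initial_segment[OF this, of N]
      show "(\<lambda>n. ?s n x) \<longlonglongrightarrow> dir_deriv h \<phi> x" by simp
    qed
    show "AE x in lebesgue. \<bar>?s n x\<bar> \<le> L * indicator ?B x" for n
    proof (intro always_eventually allI)
      fix x
      let ?t = "X (n + N)"
      have t: "?t \<noteq> 0" "\<bar>?t\<bar> < 1" using X0 N[of "n + N"] by auto
      show "\<bar>?s n x\<bar> \<le> L * indicator ?B x"
      proof (cases "x \<in> ?B")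
        case True
        have "norm ((\<lambda>t. \<phi> (x + t *\<^sub>R h)) ?t - (\<lambda>t. \<phi> (x + t *\<^sub>R h)) 0) \<le> L * norm (?t - 0)"
          by (rule field_differentiable_bound[of UNIV _ "\<lambda>s. dir_deriv h \<phi> (x + s *\<^sub>R h)"])
             (use L test_function_line_derivative[OF \<phi>] in auto)
        then show ?thesis using t True by (simp add: abs_mult field_simps)
      next
        case False
        then have n: "norm x > R + norm h" by simp
        have "norm (?t *\<^sub>R h) \<le> 1 * norm h" using t unfolding norm_scaleR by (intro mult_right_mono) auto
        moreover have "norm x \<le> norm (x + ?t *\<^sub>R h) + norm (?t *\<^sub>R h)"
          using norm_triangle_ineq4[of "x + ?t *\<^sub>R h" "?t *\<^sub>R h"] by simp
        ultimately have "\<phi> (x + ?t *\<^sub>R h) = 0" "\<phi> x = 0"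
          using n R[of "x + ?t *\<^sub>R h"] R[of x] norm_ge_zero[of h] by linarith+
        then show ?thesis using False by simp
      qed
    qed
  qed
  moreover have "abs_L2 (?s n) = (1 / X (n + N)) *\<^sub>R (translate_L2 (X (n + N) *\<^sub>R h) (abs_L2 \<phi>) - abs_L2 \<phi>)" for n
    using test_function_square_integrable(1)[OF \<phi>]
    by (simp only: abs_L2_scaleR[OF sq] translate_abs_L2 abs_L2_diff square_integrable_translate)
  ultimately have "(\<lambda>n. (1 / X (n + N)) *\<^sub>R (translate_L2 (X (n + N) *\<^sub>R h) (abs_L2 \<phi>) - abs_L2 \<phi>)) \<longlonglongrightarrow> abs_L2 (dir_deriv h \<phi>)"
    by simp
  from LIMSEQ_offset[OF this]
  show "((\<lambda>t. (1 / t) *\<^sub>R (translate_L2 (t *\<^sub>R h) (abs_L2 \<phi>) - abs_L2 \<phi>)) \<circ> X) \<longlonglongrightarrow> abs_L2 (dir_deriv h \<phi>)"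
    by (simp add: comp_def)
qed

text \<open>The shift is moved onto the test function, whose difference quotients converge in norm;
  only then is the definition of the weak derivative applied.\<close>

lemma inner_translate_has_derivative:
  assumes u: "weak_dir h u d" and \<phi>: "test_function \<phi>"
  shows "((\<lambda>t. inner (translate_L2 (t *\<^sub>R h) u) (abs_L2 \<phi>)) has_real_derivative
      inner (translate_L2 (s *\<^sub>R h) d) (abs_L2 \<phi>)) (at s)"
proof -
  let ?v = "translate_L2 (s *\<^sub>R h) u" and ?T = "\<lambda>t. translate_L2 (t *\<^sub>R h) (abs_L2 \<phi>)"
  \<comment> \<open>The adjoint shift goes backwards, hence the quotients at -t. The resulting sign
    is the minus sign in \<open>weak_dir\<close>.\<close>
  have "((\<lambda>t. inner ?v (- ((1 / (- t)) *\<^sub>R (?T (- t) - abs_L2 \<phi>)))) \<longlongrightarrow> inner ?v (- abs_L2 (dir_deriv h \<phi>))) (at 0)"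
  proof (intro tendsto_intros)
    have "filterlim uminus (at 0) (at (0::real))"
      by (auto simp: filterlim_at eventually_at_filter intro!: tendsto_eq_intros)
    from filterlim_compose[OF difference_quotient_test[OF \<phi>, of h] this]
    show "((\<lambda>t. (1 / (- t)) *\<^sub>R (?T (- t) - abs_L2 \<phi>)) \<longlongrightarrow> abs_L2 (dir_deriv h \<phi>)) (at 0)" .
  qed
  moreover have "inner ?v (- ((1 / (- t)) *\<^sub>R (?T (- t) - abs_L2 \<phi>))) =
      (inner (translate_L2 ((s + t) *\<^sub>R h) u) (abs_L2 \<phi>) - inner ?v (abs_L2 \<phi>)) / t" for t
  proof -
    have "inner (translate_L2 ((s + t) *\<^sub>R h) u) (abs_L2 \<phi>) = inner ?v (?T (- t))"
      using inner_translate_L2_left[of "t *\<^sub>R h" ?v "abs_L2 \<phi>"]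
      by (simp add: translate_translate_L2 scaleR_add_left add.commute)
    then show ?thesis by (simp add: inner_diff_right)
  qed
  moreover have "inner ?v (- abs_L2 (dir_deriv h \<phi>)) = inner (translate_L2 (s *\<^sub>R h) d) (abs_L2 \<phi>)"
    using weak_dir_translate[OF u, of "s *\<^sub>R h"] \<phi> by (simp add: weak_dir_def)
  ultimately show ?thesis unfolding DERIV_def by (simp only:)
qed

text \<open>Density extends the estimate from test functions to all of L^2; taking \<open>w\<close>
  itself as the second factor gives the bound.\<close>

lemma norm_L2_le_test:
  fixes w :: "'n::finite L2"
  assumes C: "0 \<le> C" and "\<And>\<phi>. test_function \<phi> \<Longrightarrow> inner w (abs_L2 \<phi>) \<le> C * norm (abs_L2 \<phi>)"
  shows "norm w \<le> C"
proof -
  have "closed {v. inner w v \<le> C * norm v}"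
    by (intro closed_Collect_le continuous_intros)
  moreover have "test_L2 \<subseteq> {v. inner w v \<le> C * norm v}"
    using assms by (auto simp: test_L2_def)
  ultimately have "closure test_L2 \<subseteq> {v. inner w v \<le> C * norm v}"
    by (rule closure_minimal[rotated])
  then have "inner w w \<le> C * norm w" by (auto simp: closure_test_L2)
  then have "norm w * norm w \<le> C * norm w" by (simp flip: power2_norm_eq_inner power2_eq_square)
  with C show ?thesis by (cases "norm w = 0") (auto simp: mult_le_cancel_right)
qed

text \<open>Tested against a fixed function, this is the mean value theorem for a scalar function of
  t. The derivative bound is uniform because translations preserve the norm of
  \<open>d\<close>.\<close>

lemma norm_difference_le:
  assumes u: "weak_dir h u d"
  shows "norm (translate_L2 (t *\<^sub>R h) u - u) \<le> \<bar>t\<bar> * norm d"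
proof (rule norm_L2_le_test)
  show "0 \<le> \<bar>t\<bar> * norm d" by simp
next
  fix \<phi> :: "real^'a \<Rightarrow> real" assume \<phi>: "test_function \<phi>"
  let ?f = "\<lambda>t. inner (translate_L2 (t *\<^sub>R h) u) (abs_L2 \<phi>)"
  have "norm (?f t - ?f 0) \<le> (norm d * norm (abs_L2 \<phi>)) * norm (t - 0)"
  proof (rule field_differentiable_bound[of UNIV])
    show "(?f has_real_derivative inner (translate_L2 (s *\<^sub>R h) d) (abs_L2 \<phi>)) (at s within UNIV)" for s
      using inner_translate_has_derivative[OF u \<phi>] by simp
    show "norm (inner (translate_L2 (s *\<^sub>R h) d) (abs_L2 \<phi>)) \<le> norm d * norm (abs_L2 \<phi>)" for s
      using Cauchy_Schwarz_ineq2[of "translate_L2 (s *\<^sub>R h) d" "abs_L2 \<phi>"] by (simp add: norm_translate_L2)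
  qed auto
  then show "inner (translate_L2 (t *\<^sub>R h) u - u) (abs_L2 \<phi>) \<le> \<bar>t\<bar> * norm d * norm (abs_L2 \<phi>)"
    by (simp add: inner_diff_left translate_L2_0 mult_ac)
qed

text \<open>For test functions this is the derivative at 0. The quotients are bounded by
  \<open>norm d\<close>, so a general \<open>v\<close> may be replaced by a nearby test function at
  a cost uniform in t.\<close>

lemma difference_quotient_weak_limit:
  assumes u: "weak_dir h u d"
  shows "((\<lambda>t. inner (translate_L2 (t *\<^sub>R h) u - u) v / t) \<longlongrightarrow> inner d v) (at 0)"
proof (rule tendstoI)
  fix \<epsilon> :: real assume e: "\<epsilon> > 0"
  \<comment> \<open>Replacing \<open>v\<close> costs at most \<open>norm d * \<delta>\<close> in the
    quotient and again in the limit, each below a third of \<open>\<epsilon>\<close>; the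
    \<open>+ 1\<close> covers \<open>d = 0\<close>.\<close>
  define \<delta> where "\<delta> = \<epsilon> / (4 * (norm d + 1))"
  have \<delta>: "\<delta> > 0" "norm d * \<delta> < \<epsilon> / 3"
    using e by (auto simp: \<delta>_def field_simps add_pos_nonneg intro: add_nonneg_pos)
  obtain \<phi> where \<phi>: "test_function \<phi>" "norm (v - abs_L2 \<phi>) < \<delta>" using test_L2_approx[OF \<delta>(1)] by blast
  have "((\<lambda>t. inner (translate_L2 (t *\<^sub>R h) u - u) (abs_L2 \<phi>) / t) \<longlongrightarrow> inner d (abs_L2 \<phi>)) (at 0)"
    using inner_translate_has_derivative[OF u \<phi>(1), of 0]
    by (simp add: DERIV_def translate_L2_0 inner_diff_left)
  then have "\<forall>\<^sub>F t in at 0. dist (inner (translate_L2 (t *\<^sub>R h) u - u) (abs_L2 \<phi>) / t) (inner d (abs_L2 \<phi>)) < \<epsilon> / 3"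
    by (rule tendstoD) (use e in simp)
  moreover have "\<forall>\<^sub>F t in at (0::real). t \<noteq> 0" by (rule eventually_neq_at_within)
  ultimately show "\<forall>\<^sub>F t in at 0. dist (inner (translate_L2 (t *\<^sub>R h) u - u) v / t) (inner d v) < \<epsilon>"
  proof eventually_elim
    case (elim t)
    let ?w = "translate_L2 (t *\<^sub>R h) u - u" and ?e = "v - abs_L2 \<phi>"
    have ne: "norm d * norm ?e \<le> norm d * \<delta>" using \<phi>(2) by (intro mult_left_mono) auto
    have "\<bar>inner ?w ?e\<bar> \<le> \<bar>t\<bar> * norm d * norm ?e"
      using Cauchy_Schwarz_ineq2[of ?w ?e] norm_difference_le[OF u, of t]
      by (meson mult_right_mono norm_ge_zero order_trans)
    then have "\<bar>inner ?w ?e / t\<bar> \<le> norm d * norm ?e"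
      using elim(2) by (simp add: field_simps abs_divide)
    moreover have "\<bar>inner d ?e\<bar> \<le> norm d * norm ?e" by (rule Cauchy_Schwarz_ineq2)
    moreover have "inner ?w v / t - inner d v = inner ?w ?e / t - inner d ?e + (inner ?w (abs_L2 \<phi>) / t - inner d (abs_L2 \<phi>))"
      by (simp add: inner_diff_right diff_divide_distrib)
    ultimately show ?case using elim(1) ne \<delta>(2) unfolding dist_real_def by linarith
  qed
qed

text \<open>The difference quotient of \<open>u\<close> paired with \<open>v\<close> equals that of
  \<open>v\<close> in the opposite direction paired with \<open>u\<close>; both sides have weak
  limits. In this way both factors may be merely weakly differentiable.\<close>

theorem weak_dir_integration_by_parts:
  assumes u: "weak_dir h u d" and v: "weak_dir h v e"
  shows "inner d v = - inner u e"
proof -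
  have "filterlim uminus (at 0) (at (0::real))"
    by (auto simp: filterlim_at eventually_at_filter intro!: tendsto_eq_intros)
  from filterlim_compose[OF difference_quotient_weak_limit[OF v] this]
  have "((\<lambda>t. inner (translate_L2 (- t *\<^sub>R h) v - v) u / (- t)) \<longlongrightarrow> inner e u) (at 0)" .
  from tendsto_minus[OF this]
  have "((\<lambda>t. inner (translate_L2 (- t *\<^sub>R h) v - v) u / t) \<longlongrightarrow> - inner u e) (at 0)"
    by (simp add: inner_commute)
  moreover have "inner (translate_L2 (- t *\<^sub>R h) v - v) u = inner (translate_L2 (t *\<^sub>R h) u - u) v" for t
    using inner_translate_L2_left[of "t *\<^sub>R h" u v] by (simp add: inner_diff_left inner_diff_right inner_commute)
  ultimately have "((\<lambda>t. inner (translate_L2 (t *\<^sub>R h) u - u) v / t) \<longlongrightarrow> - inner u e) (at 0)" by simp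
  from tendsto_unique[OF at_neq_bot difference_quotient_weak_limit[OF u, of v] this] show ?thesis .
qed

lemma translate_L2_zero: "translate_L2 z 0 = 0"
  using translate_L2_scaleR[of z 0 0] by simp

text \<open>Uniqueness of weak derivatives: the difference quotients of the zero function vanish and
  converge weakly to \<open>d\<close>.\<close>

lemma weak_dir_zero:
  assumes "weak_dir h 0 d"
  shows "d = 0"
proof -
  have "((\<lambda>t::real. 0) \<longlongrightarrow> inner d d) (at 0)"
    using difference_quotient_weak_limit[OF assms, of d] by (simp add: translate_L2_zero)
  from tendsto_unique[OF at_neq_bot this tendsto_const] show ?thesis by simp
qed

section \<open>The quadratic form of a Schroedinger operator on the Sobolev space\<close>

definition H1_L2 :: "'n::finite H1 \<Rightarrow> 'n L2" where
  "H1_L2 u = fst (Rep_H1 u)"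

definition H1_partial :: "'n::finite H1 \<Rightarrow> 'n L2 ^ 'n" where
  "H1_partial u = snd (Rep_H1 u)"

lemma weak_partial_H1: "weak_partial i (H1_L2 u) (H1_partial u $ i)"
  using Rep_H1[of u] by (auto simp: H1_L2_def H1_partial_def)

lemma H1_exists:
  assumes "\<And>i. weak_partial i u (g $ i)"
  obtains U where "H1_L2 U = u" "H1_partial U = g"
  using that[of "Abs_H1 (u, g)"] assms by (simp add: H1_L2_def H1_partial_def Abs_H1_inverse)

lemma H1_eqI: "H1_L2 u = H1_L2 v \<Longrightarrow> H1_partial u = H1_partial v \<Longrightarrow> u = v"
  by (simp add: H1_L2_def H1_partial_def Rep_H1_inject[symmetric] prod_eq_iff)

lemma H1_L2_add: "H1_L2 (u + v) = H1_L2 u + H1_L2 v"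
  and H1_L2_scaleR: "H1_L2 (c *\<^sub>R u) = c *\<^sub>R H1_L2 u"
  and H1_L2_zero: "H1_L2 0 = 0"
  and H1_partial_add: "H1_partial (u + v) = H1_partial u + H1_partial v"
  and H1_partial_scaleR: "H1_partial (c *\<^sub>R u) = c *\<^sub>R H1_partial u"
  by (simp_all add: H1_L2_def H1_partial_def plus_H1.rep_eq scaleR_H1.rep_eq zero_H1.rep_eq)

lemma norm_H1_eq: "(norm u)\<^sup>2 = (norm (H1_L2 u))\<^sup>2 + (norm (H1_partial u))\<^sup>2"
  by (simp add: power2_norm_eq_inner inner_H1.rep_eq inner_prod_def H1_L2_def H1_partial_def)

lemma norm_H1_L2_le: "norm (H1_L2 u) \<le> norm u"
  by (rule power2_le_imp_le) (simp_all add: norm_H1_eq)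

lemma norm_H1_partial_le: "norm (H1_partial u) \<le> norm u"
  by (rule power2_le_imp_le) (simp_all add: norm_H1_eq)

text \<open>An element of \<open>H1\<close> stores its gradient as a separate component, so
  uniqueness of weak derivatives is what lets nontriviality be tested on the function alone.\<close>

lemma H1_L2_eq_0_iff: "H1_L2 u = 0 \<longleftrightarrow> u = 0"
proof
  assume 0: "H1_L2 u = 0"
  have "H1_partial u $ i = 0" for i
    using weak_partial_H1[of i u] weak_dir_zero by (simp add: 0 weak_partial_iff_weak_dir)
  then have "H1_partial u = 0" by (simp add: vec_eq_iff)
  then have "norm u = 0"
    using norm_H1_eq[of u] 0 by simp
  then show "u = 0" by simp
qed (simp add: H1_L2_zero)

definition translate_H1 :: "real^'n \<Rightarrow> 'n::finite H1 \<Rightarrow> 'n H1" where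
  "translate_H1 z u = Abs_H1 (translate_L2 z (H1_L2 u), \<chi> i. translate_L2 z (H1_partial u $ i))"

lemma H1_L2_translate: "H1_L2 (translate_H1 z u) = translate_L2 z (H1_L2 u)"
  and H1_partial_translate: "H1_partial (translate_H1 z u) $ i = translate_L2 z (H1_partial u $ i)"
proof -
  have "weak_partial i (translate_L2 z (H1_L2 u)) (translate_L2 z (H1_partial u $ i))" for i
    using weak_partial_H1[of i u] weak_dir_translate by (simp add: weak_partial_iff_weak_dir)
  then show "H1_L2 (translate_H1 z u) = translate_L2 z (H1_L2 u)"
    and "H1_partial (translate_H1 z u) $ i = translate_L2 z (H1_partial u $ i)"
    by (simp_all add: translate_H1_def H1_L2_def H1_partial_def Abs_H1_inverse)
qed

lemma H1_fun_eq: "H1_fun u = rep_L2 (H1_L2 u)"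
  by (simp add: H1_fun_def H1_L2_def)

definition schrodinger_form :: "(real^'n \<Rightarrow> real) \<Rightarrow> 'n::finite H1 \<Rightarrow> 'n H1 \<Rightarrow> real" where
  "schrodinger_form V u v = inner (H1_partial u) (H1_partial v) + inner (mult_L2 V (H1_L2 u)) (H1_L2 v)"

lemma schrodinger_form_add_left:
  "L_infty V \<Longrightarrow> schrodinger_form V (u + v) w = schrodinger_form V u w + schrodinger_form V v w"
  by (simp add: schrodinger_form_def H1_L2_add H1_partial_add mult_L2_add inner_add_left)

lemma schrodinger_form_scaleR_left:
  "L_infty V \<Longrightarrow> schrodinger_form V (c *\<^sub>R u) w = c * schrodinger_form V u w"
  by (simp add: schrodinger_form_def H1_L2_scaleR H1_partial_scaleR mult_L2_scaleR distrib_left)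

lemma schrodinger_form_commute:
  "L_infty V \<Longrightarrow> schrodinger_form V u v = schrodinger_form V v u"
  unfolding schrodinger_form_def
  by (metis inner_commute inner_mult_L2_commute)

lemma schrodinger_form_add_right:
  "L_infty V \<Longrightarrow> schrodinger_form V w (u + v) = schrodinger_form V w u + schrodinger_form V w v"
  by (simp add: schrodinger_form_def H1_L2_add H1_partial_add inner_add_right)

lemma schrodinger_form_scaleR_right:
  "schrodinger_form V w (c *\<^sub>R u) = c * schrodinger_form V w u"
  by (simp add: schrodinger_form_def H1_L2_scaleR H1_partial_scaleR distrib_left)

lemma schrodinger_form_bounded:
  assumes V: "L_infty V"
  shows "\<exists>K\<ge>0. \<forall>u v. \<bar>schrodinger_form V u v\<bar> \<le> K * (norm u * norm v)"
proof -
  obtain C where C: "C \<ge> 0" "\<And>u. norm (mult_L2 V u) \<le> C * norm u" using norm_mult_L2_le[OF V] by blast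
  have "\<bar>schrodinger_form V u v\<bar> \<le> (1 + C) * (norm u * norm v)" for u v
  proof -
    have "\<bar>inner (H1_partial u) (H1_partial v)\<bar> \<le> norm u * norm v"
      using Cauchy_Schwarz_ineq2[of "H1_partial u" "H1_partial v"] 
        mult_mono[OF norm_H1_partial_le[of u] norm_H1_partial_le[of v]] by simp
    moreover have "\<bar>inner (mult_L2 V (H1_L2 u)) (H1_L2 v)\<bar> \<le> C * (norm u * norm v)"
    proof -
      have "norm (mult_L2 V (H1_L2 u)) \<le> C * norm u"
        using C(2)[of "H1_L2 u"] mult_left_mono[OF norm_H1_L2_le[of u] C(1)] by linarith
      then have "norm (mult_L2 V (H1_L2 u)) * norm (H1_L2 v) \<le> C * norm u * norm v"
        using C(1) by (intro mult_mono norm_H1_L2_le) auto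
      then show ?thesis
        using Cauchy_Schwarz_ineq2[of "mult_L2 V (H1_L2 u)" "H1_L2 v"] by simp
    qed
    ultimately show ?thesis unfolding schrodinger_form_def by (simp add: distrib_right)
  qed
  then show ?thesis using C(1) by (intro exI[of _ "1 + C"]) auto
qed

lemma schrodinger_form_quadratic:
  assumes V: "L_infty V"
  shows "(\<integral>x. (norm (H1_grad u x))\<^sup>2 + V x * \<bar>H1_fun u x\<bar>\<^sup>2 \<partial>lebesgue) = schrodinger_form V u u"
proof -
  have g: "(norm (H1_grad u x))\<^sup>2 = (\<Sum>i\<in>UNIV. (rep_L2 (H1_partial u $ i) x)\<^sup>2)" for x
    unfolding power2_norm_eq_inner by (simp add: H1_grad_def H1_partial_def inner_vec_def power2_eq_square)
  have i1: "integrable lebesgue (\<lambda>x. (rep_L2 w x)\<^sup>2)" for w :: "'a L2"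
    using rep_L2_square_integrable[of w] by (simp add: square_integrable_def)
  have i2: "integrable lebesgue (\<lambda>x. V x * (H1_fun u x)\<^sup>2)"
    using square_integrable_mult[OF square_integrable_mult_L_infty[OF V rep_L2_square_integrable[of "H1_L2 u"]]
        rep_L2_square_integrable[of "H1_L2 u"]]
    by (simp add: H1_fun_eq power2_eq_square mult.assoc)
  have "(\<integral>x. (norm (H1_grad u x))\<^sup>2 + V x * \<bar>H1_fun u x\<bar>\<^sup>2 \<partial>lebesgue) =
      (\<integral>x. (norm (H1_grad u x))\<^sup>2 \<partial>lebesgue) + (\<integral>x. V x * (H1_fun u x)\<^sup>2 \<partial>lebesgue)"
    unfolding g power2_abs
    by (intro Bochner_Integration.integral_add Bochner_Integration.integrable_sum i1 i2)
  also have "(\<integral>x. (norm (H1_grad u x))\<^sup>2 \<partial>lebesgue) = inner (H1_partial u) (H1_partial u)"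
    unfolding g by (subst Bochner_Integration.integral_sum)
      (use i1 in \<open>auto simp: inner_vec_def inner_L2_eq power2_eq_square\<close>)
  also have "(\<integral>x. V x * (H1_fun u x)\<^sup>2 \<partial>lebesgue) = inner (mult_L2 V (H1_L2 u)) (H1_L2 u)"
    by (simp add: inner_mult_L2[OF V] H1_fun_eq power2_eq_square mult.assoc)
  finally show ?thesis by (simp add: schrodinger_form_def)
qed

text \<open>Each second derivative \<open>h $ i $ i\<close> is integrated by parts against an
  arbitrary Sobolev function. This is the passage from the operator, given by its graph, to the
  quadratic form.\<close>

lemma schrodinger_weak_form:
  assumes V: "L_infty V" and uw: "(u, w) \<in> schrodinger V"
  obtains U where "H1_L2 U = u" "\<And>v. inner w (H1_L2 v) = schrodinger_form V U v"
proof -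
  from uw obtain g :: "'a L2 ^ 'a" and h :: "'a L2 ^ 'a ^ 'a" where
    g: "\<And>i. weak_partial i u (g $ i)" and h: "\<And>i j. weak_partial j (g $ i) (h $ i $ j)"
    and w: "AE x in lebesgue. rep_L2 w x = - (\<Sum>i\<in>UNIV. rep_L2 (h $ i $ i) x) + V x * rep_L2 u x"
    unfolding schrodinger_def by blast
  obtain U where U: "H1_L2 U = u" "H1_partial U = g" using H1_exists[OF g] by blast
  have "w = mult_L2 V u - (\<Sum>i\<in>UNIV. h $ i $ i)"
  proof (rule L2_eqI)
    show "AE x in lebesgue. rep_L2 w x = rep_L2 (mult_L2 V u - (\<Sum>i\<in>UNIV. h $ i $ i)) x"
      using w rep_L2_diff[of "mult_L2 V u" "\<Sum>i\<in>UNIV. h $ i $ i"] rep_mult_L2[OF V, of u]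
        rep_L2_sum[of "\<lambda>i. h $ i $ i" UNIV]
      by eventually_elim simp
  qed
  moreover have "inner (h $ i $ i) (H1_L2 v) = - inner (g $ i) (H1_partial v $ i)" for i v
    using weak_dir_integration_by_parts h[of i i] weak_partial_H1[of i v]
    by (simp add: weak_partial_iff_weak_dir)
  ultimately have "inner w (H1_L2 v) = schrodinger_form V U v" for v
    by (simp add: schrodinger_form_def U inner_diff_left inner_sum_left inner_vec_def sum_negf)
  with U(1) show ?thesis by (rule that)
qed

text \<open>The bottom \<open>m\<close> of the numerical range belongs to the spectrum: otherwise \<open>u = (A - m)\<^sup>-\<^sup>1 v\<close> with a
  normalised almost minimiser \<open>v\<close> violates the Cauchy-Schwarz inequality of the nonnegative form of \<open>A - m\<close>.\<close>

theorem schrodinger_form_coercive: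
  fixes V :: "real^'n::finite \<Rightarrow> real"
  assumes V: "L_infty V" and pos: "(INF \<mu>\<in>spectrum (schrodinger V). ereal \<mu>) > 0"
  shows "\<exists>m>0. \<forall>u. m * (norm (H1_L2 u))\<^sup>2 \<le> schrodinger_form V u u"
proof (cases "\<exists>u :: 'n H1. H1_L2 u \<noteq> 0")
  \<comment> \<open>Without a nonzero element the set \<open>S\<close> below would be empty and its
    infimum meaningless, but then every constant works.\<close>
  case False
  then have "H1_L2 u = 0" "u = 0" for u :: "'n H1" by (auto simp: H1_L2_eq_0_iff)
  then have "schrodinger_form V u u = 0" for u
    using schrodinger_form_scaleR_right[of V u 0 u] by (metis mult_zero_left scaleR_zero_left)
  then show ?thesis using \<open>\<And>u. H1_L2 u = 0\<close> by (intro exI[of _ 1]) simp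
next
  case True
  define S where "S = {schrodinger_form V u u |u. norm (H1_L2 u) = 1}"
  have nrm: "norm (H1_L2 ((1 / norm (H1_L2 u)) *\<^sub>R u)) = 1" if "H1_L2 u \<noteq> 0" for u :: "'n H1"
    using that by (simp add: H1_L2_scaleR)
  have "S \<noteq> {}" using True nrm unfolding S_def by blast
  obtain C where C: "C \<ge> 0" "\<And>u. norm (mult_L2 V u) \<le> C * norm u" using norm_mult_L2_le[OF V] by blast
  have lower: "- C * (norm (H1_L2 u))\<^sup>2 \<le> schrodinger_form V u u" for u
  proof -
    have "\<bar>inner (mult_L2 V (H1_L2 u)) (H1_L2 u)\<bar> \<le> C * (norm (H1_L2 u))\<^sup>2"
      using Cauchy_Schwarz_ineq2[of "mult_L2 V (H1_L2 u)" "H1_L2 u"]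
        mult_right_mono[OF C(2)[of "H1_L2 u"] norm_ge_zero[of "H1_L2 u"]]
      by (simp add: power2_eq_square mult.assoc)
    moreover have "0 \<le> inner (H1_partial u) (H1_partial u)" by simp
    ultimately show ?thesis unfolding schrodinger_form_def by linarith
  qed
  have bdd: "bdd_below S"
  proof (rule bdd_belowI[of _ "- C"])
    fix x assume "x \<in> S"
    then obtain u where "x = schrodinger_form V u u" "norm (H1_L2 u) = 1" by (auto simp: S_def)
    then show "- C \<le> x" using lower[of u] by simp
  qed
  define m where "m = Inf S"
  have m: "m * (norm (H1_L2 u))\<^sup>2 \<le> schrodinger_form V u u" for u
  proof (cases "H1_L2 u = 0")
    case True
    then show ?thesis using lower[of u] by simp
  next
    case False
    let ?c = "1 / norm (H1_L2 u)"
    have "m \<le> schrodinger_form V (?c *\<^sub>R u) (?c *\<^sub>R u)"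
      unfolding m_def using nrm[OF False] bdd by (intro cInf_lower) (auto simp: S_def)
    then show ?thesis
      using False by (simp add: schrodinger_form_scaleR_left[OF V] schrodinger_form_scaleR_right field_simps power2_eq_square)
  qed
  have "m \<in> spectrum (schrodinger V)"
  proof (rule ccontr)
    assume "m \<notin> spectrum (schrodinger V)"
    then obtain R where R: "bounded_linear R" "\<And>h. (R h, h + m *\<^sub>R R h) \<in> schrodinger V"
      by (auto simp: spectrum_def resolvent_set_def)
    obtain K where K: "K > 0" "\<And>h. norm (R h) \<le> norm h * K"
      using bounded_linear.pos_bounded[OF R(1)] by blast
    have "Inf S < m + 1 / (2 * K)" using K by (simp add: m_def)
    then obtain v where v: "norm (H1_L2 v) = 1" "schrodinger_form V v v < m + 1 / (2 * K)"
      using cInf_lessD[OF \<open>S \<noteq> {}\<close>] by (auto simp: S_def)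
    let ?h = "H1_L2 v"
    obtain U where U: "H1_L2 U = R ?h" "\<And>w. inner (?h + m *\<^sub>R R ?h) (H1_L2 w) = schrodinger_form V U w"
      using schrodinger_weak_form[OF V R(2)[of ?h]] by blast
    define b where "b = (\<lambda>u w. schrodinger_form V u w - m * inner (H1_L2 u) (H1_L2 w))"
    have bU: "b U w = inner ?h (H1_L2 w)" for w
      using U(2)[of w] by (simp add: b_def U(1) inner_add_left)
    have "b U v = 1" using v(1) by (simp add: bU flip: power2_norm_eq_inner)
    have "b U U \<le> K"
      using K(2)[of ?h] Cauchy_Schwarz_ineq2[of ?h "R ?h"] v(1) by (simp add: bU U(1))
    have "b v v < 1 / (2 * K)" using v by (simp add: b_def flip: power2_norm_eq_inner)
    \<comment> \<open>Here \<open>b U U \<le> K\<close>, \<open>b U v = 1\<close> and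
      \<open>b v v < 1 / (2 * K)\<close>, so on this combination the nonnegative form
      \<open>b\<close> would be at most K - 2K + K/2 = -K/2.\<close>
    let ?w = "U + (- K) *\<^sub>R v"
    have "0 \<le> b ?w ?w" using m[of ?w] by (simp add: b_def power2_norm_eq_inner)
    also have "b ?w ?w = b U U - 2 * K * b U v + K\<^sup>2 * b v v"
      unfolding b_def
      by (simp only: schrodinger_form_add_left[OF V] schrodinger_form_add_right[OF V] schrodinger_form_scaleR_left[OF V]
          schrodinger_form_scaleR_right H1_L2_add H1_L2_scaleR inner_add_left inner_add_right inner_scaleR_left inner_scaleR_right
          schrodinger_form_commute[OF V, of v U] inner_commute[of "H1_L2 v" "H1_L2 U"])
        (simp add: algebra_simps power2_eq_square)
    also have "\<dots> \<le> K - 2 * K + K\<^sup>2 * (1 / (2 * K))"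
      using \<open>b U v = 1\<close> \<open>b U U \<le> K\<close> \<open>b v v < 1 / (2 * K)\<close> mult_left_mono[of "b v v" "1 / (2 * K)" "K\<^sup>2"] by simp
    also have "\<dots> < 0" using K(1) by (simp add: power2_eq_square)
    finally show False by simp
  qed
  then have "(INF \<mu>\<in>spectrum (schrodinger V). ereal \<mu>) \<le> ereal m" by (rule INF_lower)
  from less_le_trans[OF pos this] have "0 < m" by simp
  with m show ?thesis by blast
qed

section \<open>Averages over cubes and the subcritical Sobolev embedding\<close>

definition unit_cube_measure :: "'a::euclidean_space measure" where
  "unit_cube_measure = density lborel (indicator (cbox 0 One))"

lemma sets_unit_cube_measure [simp, measurable_cong]: "sets unit_cube_measure = sets borel"
  and space_unit_cube_measure [simp]: "space unit_cube_measure = UNIV"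
  by (simp_all add: unit_cube_measure_def)

lemma emeasure_unit_cube_measure [simp]: "emeasure (unit_cube_measure :: 'a::euclidean_space measure) UNIV = 1"
proof -
  have "emeasure lborel (cbox 0 One :: 'a set) = 1" by (subst emeasure_lborel_cbox) auto
  then show ?thesis by (simp add: unit_cube_measure_def emeasure_density)
qed

lemma measure_unit_cube_measure [simp]: "measure unit_cube_measure UNIV = 1"
  by (simp add: measure_def)

interpretation unit_cube: finite_measure unit_cube_measure
  by standard (simp add: emeasure_unit_cube_measure)

lemma AE_unit_cube: "AE h in unit_cube_measure. h \<in> cbox 0 One"
  unfolding unit_cube_measure_def by (subst AE_density) (auto simp: indicator_def)

text \<open>The variance under a probability measure is nonnegative; integrability of
  \<open>f\<close> itself comes from \<open>\<bar>a\<bar> \<le> 1 + a\<^sup>2\<close>.\<close>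

lemma unit_cube_square_le:
  fixes f :: "'a::euclidean_space \<Rightarrow> real"
  assumes m[measurable]: "f \<in> borel_measurable borel" and fin: "(\<integral>\<^sup>+h. ennreal ((f h)\<^sup>2) \<partial>unit_cube_measure) < \<infinity>"
  shows "integrable unit_cube_measure f"
    and "ennreal ((\<integral>h. f h \<partial>unit_cube_measure)\<^sup>2) \<le> (\<integral>\<^sup>+h. ennreal ((f h)\<^sup>2) \<partial>unit_cube_measure)"
proof -
  let ?P = "unit_cube_measure :: 'a measure"
  have c: "integrable ?P (\<lambda>h. c)" "(\<integral>h. c \<partial>?P) = c" for c :: real
    by (auto simp: unit_cube.integrable_const)
  have sq: "integrable ?P (\<lambda>h. (f h)\<^sup>2)"
    using fin by (intro integrableI_bounded) auto
  show i: "integrable ?P f"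
  proof (rule Bochner_Integration.integrable_bound[of _ "\<lambda>h. 1 + (f h)\<^sup>2"])
    show "integrable ?P (\<lambda>h. 1 + (f h)\<^sup>2)" using sq c(1)[of 1] by simp
    have "\<bar>a\<bar> \<le> 1 + a\<^sup>2" for a :: real
      using zero_le_power2[of "\<bar>a\<bar> - 1"] by (simp add: power2_diff)
    then show "AE h in ?P. norm (f h) \<le> norm (1 + (f h)\<^sup>2)" by simp
  qed simp
  let ?m = "\<integral>h. f h \<partial>?P"
  have "0 \<le> (\<integral>h. (f h - ?m)\<^sup>2 \<partial>?P)" by simp
  also have "(\<integral>h. (f h - ?m)\<^sup>2 \<partial>?P) = (\<integral>h. (f h)\<^sup>2 + ?m\<^sup>2 - 2 * ?m * f h \<partial>?P)"
    by (simp add: power2_diff mult_ac)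
  also have "\<dots> = (\<integral>h. (f h)\<^sup>2 \<partial>?P) + ?m\<^sup>2 - 2 * ?m * ?m"
    using sq i c by simp
  finally have "?m\<^sup>2 \<le> (\<integral>h. (f h)\<^sup>2 \<partial>?P)" by (simp add: power2_eq_square)
  then show "ennreal (?m\<^sup>2) \<le> (\<integral>\<^sup>+h. ennreal ((f h)\<^sup>2) \<partial>?P)"
    by (simp add: nn_integral_eq_integral[OF sq])
qed

text \<open>For r > 0 this is the mean over the cube of side r with lower corner x. Keeping one
  probability measure for all scales makes Jensen and Fubini available in the variable
  \<open>h\<close>.\<close>

definition cube_avg :: "real \<Rightarrow> ('a::euclidean_space \<Rightarrow> real) \<Rightarrow> 'a \<Rightarrow> real" where
  "cube_avg r u x = (\<integral>h. u (x + r *\<^sub>R h) \<partial>unit_cube_measure)"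

lemma borel_measurable_cube_avg [measurable]:
  fixes u :: "'a::euclidean_space \<Rightarrow> real"
  assumes [measurable]: "u \<in> borel_measurable borel"
  shows "cube_avg r u \<in> borel_measurable borel"
  unfolding cube_avg_def[abs_def] by measurable

text \<open>The cube is enlarged to the whole space; the substitution y = x + r h then contributes
  the Jacobian r^(-N).\<close>

lemma nn_integral_unit_cube_le:
  fixes w :: "'a::euclidean_space \<Rightarrow> ennreal"
  assumes [measurable]: "w \<in> borel_measurable borel" and r: "r > 0"
  shows "(\<integral>\<^sup>+h. w (x + r *\<^sub>R h) \<partial>unit_cube_measure) \<le> ennreal (r powr - real DIM('a)) * (\<integral>\<^sup>+y. w y \<partial>lborel)"
proof -
  have r1: "r powr - real DIM('a) * \<bar>r\<bar> ^ DIM('a) = 1"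
    using r by (simp add: powr_minus powr_realpow)
  have "(\<integral>\<^sup>+h. w (x + r *\<^sub>R h) \<partial>unit_cube_measure) \<le> (\<integral>\<^sup>+h. w (x + r *\<^sub>R h) \<partial>lborel)"
    unfolding unit_cube_measure_def
    by (subst nn_integral_density) (auto intro!: nn_integral_mono simp: indicator_def)
  also have "\<dots> = ennreal (r powr - real DIM('a)) * (ennreal (\<bar>r\<bar> ^ DIM('a)) * (\<integral>\<^sup>+h. w (x + r *\<^sub>R h) \<partial>lborel))"
    by (simp add: mult.assoc[symmetric] ennreal_mult[symmetric] r1 del: power_abs)
  also have "ennreal (\<bar>r\<bar> ^ DIM('a)) * (\<integral>\<^sup>+h. w (x + r *\<^sub>R h) \<partial>lborel) = (\<integral>\<^sup>+y. w y \<partial>lborel)"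
    using r by (subst (2) lborel_affine[of r x])
      (auto simp: nn_integral_density nn_integral_distr nn_integral_cmult)
  finally show ?thesis .
qed

text \<open>Jensen bounds the squared average by r^(-N) times the total mass of v^2; the root
  produces the exponent -N/2.\<close>

lemma cube_avg_bound:
  fixes v :: "'a::euclidean_space \<Rightarrow> real"
  assumes m[measurable]: "v \<in> borel_measurable borel" and r: "r > 0" and c: "c \<ge> 0"
    and v: "(\<integral>\<^sup>+x. ennreal ((v x)\<^sup>2) \<partial>lborel) \<le> ennreal (c\<^sup>2)"
  shows "integrable unit_cube_measure (\<lambda>h. v (x + r *\<^sub>R h))"
    and "\<bar>cube_avg r v x\<bar> \<le> c * r powr (- real DIM('a) / 2)"
proof -
  have "(\<integral>\<^sup>+h. ennreal ((v (x + r *\<^sub>R h))\<^sup>2) \<partial>unit_cube_measure) \<le>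
      ennreal (r powr - real DIM('a)) * (\<integral>\<^sup>+y. ennreal ((v y)\<^sup>2) \<partial>lborel)"
    by (rule nn_integral_unit_cube_le) (use r in auto)
  also have "\<dots> \<le> ennreal (r powr - real DIM('a)) * ennreal (c\<^sup>2)"
    using v by (rule mult_left_mono) simp
  also have "\<dots> = ennreal (r powr - real DIM('a) * c\<^sup>2)" by (simp add: ennreal_mult)
  finally have b: "(\<integral>\<^sup>+h. ennreal ((v (x + r *\<^sub>R h))\<^sup>2) \<partial>unit_cube_measure) \<le> ennreal (r powr - real DIM('a) * c\<^sup>2)" .
  then have fin: "(\<integral>\<^sup>+h. ennreal ((v (x + r *\<^sub>R h))\<^sup>2) \<partial>unit_cube_measure) < \<infinity>"
    by (simp add: le_less_trans[OF _ ennreal_less_top])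
  show "integrable unit_cube_measure (\<lambda>h. v (x + r *\<^sub>R h))"
    by (rule unit_cube_square_le(1)[OF _ fin]) simp
  have "ennreal ((cube_avg r v x)\<^sup>2) \<le> ennreal (r powr - real DIM('a) * c\<^sup>2)"
    unfolding cube_avg_def by (rule order_trans[OF unit_cube_square_le(2)[OF _ fin] b]) simp
  then have "(cube_avg r v x)\<^sup>2 \<le> r powr - real DIM('a) * c\<^sup>2" by (simp add: ennreal_le_iff)
  also have "r powr - real DIM('a) = (r powr (- real DIM('a) / 2))\<^sup>2"
    using r by (simp add: powr_power power2_eq_square powr_add[symmetric])
  finally have "\<bar>cube_avg r v x\<bar>\<^sup>2 \<le> (c * r powr (- real DIM('a) / 2))\<^sup>2" by (simp add: power_mult_distrib mult.commute)
  then show "\<bar>cube_avg r v x\<bar> \<le> c * r powr (- real DIM('a) / 2)"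
    by (rule power2_le_imp_le) (use c in simp)
qed

text \<open>Jensen in \<open>h\<close> followed by Fubini: the squared error is at most the average
  over \<open>h\<close> of the squared shift differences, each of which is at most r^2.\<close>

lemma cube_avg_approx:
  fixes U :: "'a::euclidean_space \<Rightarrow> real"
  assumes m[measurable]: "U \<in> borel_measurable borel" and r: "r > 0" and U: "(\<integral>\<^sup>+x. ennreal ((U x)\<^sup>2) \<partial>lborel) \<le> 1"
    and shift: "\<And>h. h \<in> cbox 0 One \<Longrightarrow> (\<integral>\<^sup>+x. ennreal ((U (x + r *\<^sub>R h) - U x)\<^sup>2) \<partial>lborel) \<le> ennreal (r\<^sup>2)"
  shows "(\<integral>\<^sup>+x. ennreal ((cube_avg r U x - U x)\<^sup>2) \<partial>lborel) \<le> ennreal (r\<^sup>2)"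
proof -
  let ?P = "unit_cube_measure :: 'a measure"
  interpret pair_sigma_finite ?P lborel ..
  have U1: "(\<integral>\<^sup>+x. ennreal ((U x)\<^sup>2) \<partial>lborel) \<le> ennreal (1\<^sup>2)" using U by simp
  have "ennreal ((cube_avg r U x - U x)\<^sup>2) \<le> (\<integral>\<^sup>+h. ennreal ((U (x + r *\<^sub>R h) - U x)\<^sup>2) \<partial>?P)" for x
  proof (cases "(\<integral>\<^sup>+h. ennreal ((U (x + r *\<^sub>R h) - U x)\<^sup>2) \<partial>?P) < \<infinity>")
    case True
    have "(\<integral>h. U (x + r *\<^sub>R h) - U x \<partial>?P) = cube_avg r U x - U x"
      using cube_avg_bound(1)[OF m r _ U1, of x]
      by (simp add: cube_avg_def unit_cube.integrable_const)
    then show ?thesis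
      using unit_cube_square_le(2)[OF _ True] by simp
  qed (simp add: less_top[symmetric])
  then have "(\<integral>\<^sup>+x. ennreal ((cube_avg r U x - U x)\<^sup>2) \<partial>lborel) \<le>
      (\<integral>\<^sup>+x. (\<integral>\<^sup>+h. ennreal ((U (x + r *\<^sub>R h) - U x)\<^sup>2) \<partial>?P) \<partial>lborel)"
    by (intro nn_integral_mono)
  also have "\<dots> = (\<integral>\<^sup>+h. (\<integral>\<^sup>+x. ennreal ((U (x + r *\<^sub>R h) - U x)\<^sup>2) \<partial>lborel) \<partial>?P)"
    by (rule Fubini') measurable
  also have "\<dots> \<le> (\<integral>\<^sup>+h. ennreal (r\<^sup>2) \<partial>?P)"
    by (rule nn_integral_mono_AE[OF eventually_mono[OF AE_unit_cube shift]])
  also have "\<dots> = ennreal (r\<^sup>2)" by simp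
  finally show ?thesis .
qed

lemma cube_avg_diff:
  assumes "integrable unit_cube_measure (\<lambda>h. u (x + r *\<^sub>R h))" "integrable unit_cube_measure (\<lambda>h. v (x + r *\<^sub>R h))"
  shows "cube_avg r (\<lambda>x. u x - v x) x = cube_avg r u x - cube_avg r v x"
  using assms by (simp add: cube_avg_def)

lemma cube_avg_oscillation:
  fixes v :: "'a::euclidean_space \<Rightarrow> real"
  assumes "\<And>h. h \<in> cbox 0 One \<Longrightarrow> \<bar>v (x + s *\<^sub>R h) - v x\<bar> \<le> B"
    and i: "integrable unit_cube_measure (\<lambda>h. v (x + s *\<^sub>R h))"
  shows "\<bar>cube_avg s v x - v x\<bar> \<le> B"
proof -
  let ?P = "unit_cube_measure :: 'a measure"
  have c: "integrable ?P (\<lambda>h. c)" "(\<integral>h. c \<partial>?P) = c" for c :: real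
    by (auto simp: unit_cube.integrable_const)
  have "\<bar>cube_avg s v x - v x\<bar> = norm (\<integral>h. v (x + s *\<^sub>R h) - v x \<partial>?P)"
    using i c by (simp add: cube_avg_def)
  also have "\<dots> \<le> (\<integral>h. norm (v (x + s *\<^sub>R h) - v x) \<partial>?P)"
    by (rule integral_norm_bound)
  also have "\<dots> \<le> (\<integral>h. B \<partial>?P)"
  proof (rule integral_mono_AE)
    show "integrable ?P (\<lambda>h. norm (v (x + s *\<^sub>R h) - v x))" using i c(1) by simp
    show "AE h in ?P. norm (v (x + s *\<^sub>R h) - v x) \<le> B"
      by (rule eventually_mono[OF AE_unit_cube]) (use assms(1) in simp)
  qed (use c in auto)
  finally show ?thesis using c by simp
qed

text \<open>Averaging commutes with translation, so the pointwise bound applies to the average of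
  U(x + z) - U(x), whose L^2 norm is at most \<open>s\<close>.\<close>

lemma cube_avg_translate_diff:
  fixes U :: "'a::euclidean_space \<Rightarrow> real"
  assumes m[measurable]: "U \<in> borel_measurable borel" and U: "(\<integral>\<^sup>+x. ennreal ((U x)\<^sup>2) \<partial>lborel) \<le> 1"
    and z: "(\<integral>\<^sup>+x. ennreal ((U (x + z) - U x)\<^sup>2) \<partial>lborel) \<le> ennreal (s\<^sup>2)" and s: "s \<ge> 0" and r: "r > 0"
  shows "\<bar>cube_avg r U (y + z) - cube_avg r U y\<bar> \<le> s * r powr (- real DIM('a) / 2)"
proof -
  have U1: "(\<integral>\<^sup>+x. ennreal ((U x)\<^sup>2) \<partial>lborel) \<le> ennreal (1\<^sup>2)" using U by simp
  have c: "y + z + r *\<^sub>R h = y + r *\<^sub>R h + z" for h by (simp add: algebra_simps)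
  have "cube_avg r (\<lambda>x. U (x + z) - U x) y = cube_avg r (\<lambda>x. U (x + z)) y - cube_avg r U y"
    using cube_avg_bound(1)[OF m r _ U1, of "y + z"] cube_avg_bound(1)[OF m r _ U1, of y]
    by (intro cube_avg_diff) (simp_all add: c)
  also have "cube_avg r (\<lambda>x. U (x + z)) y = cube_avg r U (y + z)" by (simp add: cube_avg_def c)
  finally show ?thesis
    using cube_avg_bound(2)[OF _ r s z, of y] by simp
qed

text \<open>Both averages are O(s)-close to U in L^2, and averaging their difference once more at
  scale s makes this pointwise. That average costs 4, and undoing the extra averaging costs 1 for
  each of the two functions, hence the 6.\<close>

lemma cube_avg_halving:
  fixes U :: "'a::euclidean_space \<Rightarrow> real"
  assumes m[measurable]: "U \<in> borel_measurable borel" and U: "(\<integral>\<^sup>+x. ennreal ((U x)\<^sup>2) \<partial>lborel) \<le> 1"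
    and shift: "\<And>r h. 0 < r \<Longrightarrow> r \<le> 1 \<Longrightarrow> h \<in> cbox 0 One \<Longrightarrow>
      (\<integral>\<^sup>+x. ennreal ((U (x + r *\<^sub>R h) - U x)\<^sup>2) \<partial>lborel) \<le> ennreal (r\<^sup>2)"
    and s: "0 < s" "2 * s \<le> 1"
  shows "\<bar>cube_avg s U x - cube_avg (2 * s) U x\<bar> \<le> 6 * s powr (1 - real DIM('a) / 2)"
proof -
  have U1: "(\<integral>\<^sup>+x. ennreal ((U x)\<^sup>2) \<partial>lborel) \<le> ennreal (1\<^sup>2)" using U by simp
  let ?E = "s powr (- real DIM('a) / 2)"
  have sE: "s powr (1 - real DIM('a) / 2) = s * ?E"
    using s powr_add[of s 1 "- real DIM('a) / 2"] by simp
  have osc: "integrable unit_cube_measure (\<lambda>h. cube_avg r U (x + s *\<^sub>R h)) \<and>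
      \<bar>cube_avg s (cube_avg r U) x - cube_avg r U x\<bar> \<le> s * ?E" if r: "s \<le> r" for r
  proof
    have r0: "r > 0" using r s by linarith
    show i: "integrable unit_cube_measure (\<lambda>h. cube_avg r U (x + s *\<^sub>R h))"
      using cube_avg_bound(2)[OF m r0 _ U1]
      by (intro unit_cube.integrable_const_bound[of _ "1 * r powr (- real DIM('a) / 2)"]) auto
    have "r powr (- real DIM('a) / 2) \<le> ?E" using r s by (intro powr_mono2') auto
    then have "s * r powr (- real DIM('a) / 2) \<le> s * ?E" using s by simp
    moreover have "\<bar>cube_avg r U (x + s *\<^sub>R h) - cube_avg r U x\<bar> \<le> s * r powr (- real DIM('a) / 2)"
      if "h \<in> cbox 0 One" for h
      using cube_avg_translate_diff[OF m U shift[OF s(1) _ that] _ r0, of x] s by simp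
    ultimately show "\<bar>cube_avg s (cube_avg r U) x - cube_avg r U x\<bar> \<le> s * ?E"
      using i by (intro cube_avg_oscillation) fastforce+
  qed
  have r: "0 < 2 * s" "2 * s \<le> 1" and s1: "s \<le> 1" using s by auto
  let ?A = "cube_avg (2 * s) U" and ?B = "cube_avg s U"
  have "(\<integral>\<^sup>+x. ennreal ((?B x - ?A x)\<^sup>2) \<partial>lborel) \<le>
      (\<integral>\<^sup>+x. ennreal 2 * ennreal ((?B x - U x)\<^sup>2) + ennreal 2 * ennreal ((?A x - U x)\<^sup>2) \<partial>lborel)"
  proof (rule nn_integral_mono)
    fix x
    have "(?B x - ?A x)\<^sup>2 \<le> 2 * (?B x - U x)\<^sup>2 + 2 * (?A x - U x)\<^sup>2"
      using zero_le_power2[of "(?B x - U x) + (?A x - U x)"] by (simp add: power2_eq_square algebra_simps)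
    then show "ennreal ((?B x - ?A x)\<^sup>2) \<le> ennreal 2 * ennreal ((?B x - U x)\<^sup>2) + ennreal 2 * ennreal ((?A x - U x)\<^sup>2)"
      by (simp add: ennreal_leI flip: ennreal_mult ennreal_plus del: ennreal_numeral)
  qed
  also have "\<dots> = ennreal 2 * (\<integral>\<^sup>+x. ennreal ((?B x - U x)\<^sup>2) \<partial>lborel) + ennreal 2 * (\<integral>\<^sup>+x. ennreal ((?A x - U x)\<^sup>2) \<partial>lborel)"
    by (simp add: nn_integral_add nn_integral_cmult)
  also have "\<dots> \<le> ennreal 2 * ennreal (s\<^sup>2) + ennreal 2 * ennreal ((2 * s)\<^sup>2)"
    using s r s1 by (intro add_mono mult_left_mono cube_avg_approx m U shift) auto
  \<comment> \<open>2 s^2 + 2 (2s)^2 = 10 s^2, rounded up to a square.\<close>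
  also have "\<dots> \<le> ennreal ((4 * s)\<^sup>2)"
    by (simp add: ennreal_leI power_mult_distrib flip: ennreal_mult ennreal_plus del: ennreal_numeral)
  finally have d: "(\<integral>\<^sup>+x. ennreal ((?B x - ?A x)\<^sup>2) \<partial>lborel) \<le> ennreal ((4 * s)\<^sup>2)" .
  have "\<bar>cube_avg s (\<lambda>x. ?B x - ?A x) x\<bar> \<le> 4 * s * ?E"
    by (rule cube_avg_bound(2)[OF _ s(1) _ d]) (use s in auto)
  moreover have "cube_avg s (\<lambda>x. ?B x - ?A x) x = cube_avg s ?B x - cube_avg s ?A x"
    by (rule cube_avg_diff) (use osc[of s] osc[of "2 * s"] s in auto)
  moreover have "\<bar>cube_avg s ?B x - ?B x\<bar> \<le> s * ?E" using osc[of s] by simp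
  moreover have "\<bar>cube_avg s ?A x - ?A x\<bar> \<le> s * ?E" using osc[of "2 * s"] s by simp
  ultimately show ?thesis unfolding sE by linarith
qed

text \<open>The increments between successive dyadic scales are summed. Replacing the exponent N/2 -
  1 by a positive \<open>\<theta>\<close> makes \<open>a > 1\<close> in all dimensions, so that the
  geometric sum is controlled by its last term.\<close>

lemma cube_avg_growth:
  fixes U :: "'a::euclidean_space \<Rightarrow> real"
  assumes m[measurable]: "U \<in> borel_measurable borel" and U: "(\<integral>\<^sup>+x. ennreal ((U x)\<^sup>2) \<partial>lborel) \<le> 1"
    and shift: "\<And>r h. 0 < r \<Longrightarrow> r \<le> 1 \<Longrightarrow> h \<in> cbox 0 One \<Longrightarrow>
      (\<integral>\<^sup>+x. ennreal ((U (x + r *\<^sub>R h) - U x)\<^sup>2) \<partial>lborel) \<le> ennreal (r\<^sup>2)"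
    and \<theta>: "\<theta> > 0" "real DIM('a) / 2 - 1 \<le> \<theta>"
  defines "a \<equiv> 2 powr \<theta>"
  shows "\<bar>cube_avg ((1/2) ^ k) U x\<bar> \<le> (1 + 6 * a / (a - 1)) * a ^ k"
proof -
  have a: "a > 1" using \<theta>(1) by (simp add: a_def)
  have U1: "(\<integral>\<^sup>+x. ennreal ((U x)\<^sup>2) \<partial>lborel) \<le> ennreal (1\<^sup>2)" using U by simp
  \<comment> \<open>The induction step requires C a^k + 6 a^(k+1) \<le> C a^(k+1), that is C (a - 1)
    \<ge> 6 a; the summand 1 covers the unit scale.\<close>
  define C where "C = 1 + 6 * a / (a - 1)"
  have "C * (a - 1) = (a - 1) + 6 * a" using a by (simp add: C_def distrib_right)
  then have C: "C \<ge> 1" "C * (a - 1) \<ge> 6 * a" using a by (auto simp: C_def)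
  have "\<bar>cube_avg ((1/2) ^ k) U x\<bar> \<le> C * a ^ k"
  proof (induction k)
    case 0
    have "\<bar>cube_avg 1 U x\<bar> \<le> 1" using cube_avg_bound(2)[OF m _ _ U1, of 1 x] by simp
    then show ?case using C(1) by simp
  next
    case (Suc k)
    let ?s = "(1/2::real) ^ Suc k"
    have s: "0 < ?s" "2 * ?s \<le> 1" by (auto simp: power_le_one)
    have "?s powr (1 - real DIM('a) / 2) = 2 powr (real (Suc k) * (real DIM('a) / 2 - 1))"
    proof -
      have "?s = 2 powr (- real (Suc k))"
        by (simp only: powr_minus powr_realpow[symmetric] power_one_over) (simp add: powr_realpow powr_minus field_simps power_one_over)
      moreover have "- real (Suc k) * (1 - real DIM('a) / 2) = real (Suc k) * (real DIM('a) / 2 - 1)"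
        by (simp only: right_diff_distrib)
      ultimately show ?thesis by (simp only: powr_powr)
    qed
    also have "\<dots> \<le> 2 powr (real (Suc k) * \<theta>)"
      using \<theta>(2) by (intro powr_mono mult_left_mono) auto
    also have "\<dots> = a ^ Suc k" by (simp add: a_def powr_realpow[symmetric] powr_powr mult.commute del: power_Suc)
    finally have "\<bar>cube_avg ?s U x - cube_avg (2 * ?s) U x\<bar> \<le> 6 * a ^ Suc k"
      using cube_avg_halving[OF m U shift s, of x] by linarith
    moreover have "2 * ?s = (1/2) ^ k" by simp
    ultimately have "\<bar>cube_avg ?s U x - cube_avg ((1/2) ^ k) U x\<bar> \<le> 6 * a ^ Suc k" by (simp only:)
    with Suc have "\<bar>cube_avg ?s U x\<bar> \<le> C * a ^ k + 6 * a ^ Suc k" by linarith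
    also have "\<dots> = (C + 6 * a) * a ^ k" by (simp add: algebra_simps)
    also have "\<dots> \<le> (C * a) * a ^ k"
      using C(2) a by (intro mult_right_mono) (auto simp: algebra_simps)
    finally show ?case by (simp add: mult_ac)
  qed
  then show ?thesis by (simp add: C_def)
qed

text \<open>Where l k < \<open>\<bar>U\<bar>\<close> \<le> l (k+1), the p-th power is paid for by
  the squared error of the k-th average, which is at least (l k / 2)^2 there. The price grows like
  b^k with b = a^(p-2), the error integral decays like 4^(-k), and \<theta>(p - 2) < 2 says b <
  4.\<close>

theorem sobolev_bound:
  fixes p \<theta> :: real
  assumes p: "p \<ge> 2" and \<theta>: "\<theta> > 0" "real DIM('a::euclidean_space) / 2 - 1 \<le> \<theta>" "\<theta> * (p - 2) < 2"
  shows "\<exists>C\<ge>0. \<forall>U :: 'a \<Rightarrow> real. U \<in> borel_measurable borel \<longrightarrow> (\<integral>\<^sup>+x. ennreal ((U x)\<^sup>2) \<partial>lborel) \<le> 1 \<longrightarrow>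
    (\<forall>r h. 0 < r \<longrightarrow> r \<le> 1 \<longrightarrow> h \<in> cbox 0 One \<longrightarrow>
      (\<integral>\<^sup>+x. ennreal ((U (x + r *\<^sub>R h) - U x)\<^sup>2) \<partial>lborel) \<le> ennreal (r\<^sup>2)) \<longrightarrow>
    (\<integral>\<^sup>+x. ennreal (\<bar>U x\<bar> powr p) \<partial>lborel) \<le> ennreal C"
proof -
  define a where "a = 2 powr \<theta>"
  define C0 where "C0 = 1 + 6 * a / (a - 1)"
  define b where "b = a powr (p - 2)"
  \<comment> \<open>The ratio of \<open>l (Suc k) powr p\<close> to \<open>(l k / 2)\<^sup>2\<close>
    after splitting off the growth factor \<open>b ^ k\<close>.\<close>
  define K where "K = 4 * (2 * C0) powr (p - 2) * a powr p"
  define l where "l = (\<lambda>k::nat. 2 * C0 * a ^ k)"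
  have a: "a > 1" using \<theta>(1) by (simp add: a_def)
  have C0: "C0 > 0" using a by (simp add: C0_def add_pos_pos)
  have K: "K \<ge> 0" and b0: "b > 0" using a by (auto simp: K_def b_def)
  have b4: "b / 4 < 1"
  proof -
    have "b = 2 powr (\<theta> * (p - 2))" by (simp add: b_def a_def powr_powr)
    also have "\<dots> < 2 powr 2" using \<theta>(3) by (intro powr_less_mono) auto
    finally show ?thesis by simp
  qed
  have l_pos: "l k > 0" for k using a C0 by (simp add: l_def)
  have lp: "l (Suc k) powr p = K * b ^ k * (l k / 2)\<^sup>2" for k
  proof -
    have ak: "a ^ k > 0" using a by simp
    have "l (Suc k) powr p = (2 * C0) powr p * a powr p * (a ^ k) powr p"
      using a C0 by (simp add: l_def powr_mult mult_ac)
    also have "(2 * C0) powr p = (2 * C0) powr (p - 2) * (2 * C0)\<^sup>2"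
      using C0 powr_add[of "2 * C0" "p - 2" 2] by simp
    also have "(a ^ k) powr p = b ^ k * (a ^ k)\<^sup>2"
    proof -
      have "(a ^ k) powr p = (a ^ k) powr (p - 2) * (a ^ k)\<^sup>2"
        using ak powr_add[of "a ^ k" "p - 2" 2] by simp
      also have "(a ^ k) powr (p - 2) = b ^ k"
        using a by (simp add: b_def powr_realpow[symmetric] powr_powr mult.commute)
      finally show ?thesis .
    qed
    finally show ?thesis by (simp add: K_def l_def power2_eq_square field_simps)
  qed
  define C where "C = l 0 powr (p - 2) + K / (1 - b / 4)"
  have "C \<ge> 0" using K b4 by (simp add: C_def)
  moreover have "(\<integral>\<^sup>+x. ennreal (\<bar>U x\<bar> powr p) \<partial>lborel) \<le> ennreal C"
    if m[measurable]: "U \<in> borel_measurable borel" and U: "(\<integral>\<^sup>+x. ennreal ((U x)\<^sup>2) \<partial>lborel) \<le> 1"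
      and shift: "\<And>r h. 0 < r \<Longrightarrow> r \<le> 1 \<Longrightarrow> h \<in> cbox 0 One \<Longrightarrow>
        (\<integral>\<^sup>+x. ennreal ((U (x + r *\<^sub>R h) - U x)\<^sup>2) \<partial>lborel) \<le> ennreal (r\<^sup>2)" for U :: "'a \<Rightarrow> real"
  proof -
    let ?d = "\<lambda>k x. (cube_avg ((1/2) ^ k) U x - U x)\<^sup>2"
    let ?c = "\<lambda>k. ennreal (K * b ^ k)"
    have pw: "ennreal (\<bar>U x\<bar> powr p) \<le> ennreal (l 0 powr (p - 2)) * ennreal ((U x)\<^sup>2) + (\<Sum>k. ?c k * ennreal (?d k x))" for x
    proof (cases "\<bar>U x\<bar> \<le> l 0")
      case True
      have "\<bar>U x\<bar> powr p \<le> l 0 powr (p - 2) * (U x)\<^sup>2"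
      proof (cases "U x = 0")
        case False
        have "\<bar>U x\<bar> powr p = \<bar>U x\<bar> powr (p - 2) * (U x)\<^sup>2"
          using False powr_add[of "\<bar>U x\<bar>" "p - 2" 2] by simp
        also have "\<dots> \<le> l 0 powr (p - 2) * (U x)\<^sup>2"
          using True p by (intro mult_right_mono powr_mono2) auto
        finally show ?thesis .
      qed simp
      then have "ennreal (\<bar>U x\<bar> powr p) \<le> ennreal (l 0 powr (p - 2)) * ennreal ((U x)\<^sup>2)"
        by (simp add: ennreal_leI flip: ennreal_mult)
      then show ?thesis by (rule order_trans) simp
    next
      case False
      obtain n where "\<bar>U x\<bar> / (2 * C0) < a ^ n" using real_arch_pow[OF a] by blast
      then have ex: "\<bar>U x\<bar> \<le> l n" using C0 by (simp add: l_def field_simps)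
      \<comment> \<open>This index is positive because \<open>\<bar>U x\<bar>\<close> exceeds
        \<open>l 0\<close>; its predecessor k satisfies \<open>l k < \<bar>U x\<bar>\<close> and
        \<open>\<bar>U x\<bar> \<le> l (Suc k)\<close>.\<close>
      define n0 where "n0 = (LEAST n. \<bar>U x\<bar> \<le> l n)"
      have n0: "\<bar>U x\<bar> \<le> l n0" unfolding n0_def by (rule LeastI[of _ n]) (rule ex)
      with False obtain k where k: "n0 = Suc k" by (cases n0) auto
      have "\<not> \<bar>U x\<bar> \<le> l k" using k not_less_Least[of k "\<lambda>n. \<bar>U x\<bar> \<le> l n"] by (simp add: n0_def)
      moreover have "\<bar>cube_avg ((1/2) ^ k) U x\<bar> \<le> l k / 2"
        using cube_avg_growth[OF m U shift \<theta>(1,2), of k x] unfolding a_def[symmetric] C0_def[symmetric]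
        by (simp add: l_def)
      ultimately have "l k / 2 \<le> \<bar>cube_avg ((1/2) ^ k) U x - U x\<bar>" by linarith
      then have "(l k / 2)\<^sup>2 \<le> ?d k x"
        using l_pos[of k] power_mono[of "l k / 2" "\<bar>cube_avg ((1/2) ^ k) U x - U x\<bar>" 2] by simp
      then have "K * b ^ k * (l k / 2)\<^sup>2 \<le> K * b ^ k * ?d k x"
        using K b0 by (intro mult_left_mono) auto
      moreover have "\<bar>U x\<bar> powr p \<le> l (Suc k) powr p"
        using n0 k p by (intro powr_mono2) auto
      ultimately have "\<bar>U x\<bar> powr p \<le> K * b ^ k * ?d k x" unfolding lp by linarith
      then have "ennreal (\<bar>U x\<bar> powr p) \<le> ?c k * ennreal (?d k x)"
        using K b0 by (simp add: ennreal_leI flip: ennreal_mult)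
      also have "\<dots> \<le> (\<Sum>k. ?c k * ennreal (?d k x))"
        using sum_le_suminf[of "\<lambda>k. ?c k * ennreal (?d k x)" "{k}"] by simp
      finally show ?thesis by (rule order_trans) simp
    qed
    have "(\<integral>\<^sup>+x. ennreal (\<bar>U x\<bar> powr p) \<partial>lborel) \<le>
        (\<integral>\<^sup>+x. ennreal (l 0 powr (p - 2)) * ennreal ((U x)\<^sup>2) + (\<Sum>k. ?c k * ennreal (?d k x)) \<partial>lborel)"
      by (intro nn_integral_mono pw)
    also have "\<dots> = ennreal (l 0 powr (p - 2)) * (\<integral>\<^sup>+x. ennreal ((U x)\<^sup>2) \<partial>lborel) +
        (\<Sum>k. ?c k * (\<integral>\<^sup>+x. ennreal (?d k x) \<partial>lborel))"
      by (simp add: nn_integral_add nn_integral_cmult nn_integral_suminf)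
    also have "\<dots> \<le> ennreal (l 0 powr (p - 2)) * 1 + (\<Sum>k. ennreal (K * (b / 4) ^ k))"
    proof (intro add_mono mult_left_mono U suminf_le)
      fix k
      have "(\<integral>\<^sup>+x. ennreal (?d k x) \<partial>lborel) \<le> ennreal (((1/2) ^ k)\<^sup>2)"
        by (intro cube_avg_approx m U shift) (auto simp: power_le_one)
      then have "?c k * (\<integral>\<^sup>+x. ennreal (?d k x) \<partial>lborel) \<le> ?c k * ennreal (((1/2) ^ k)\<^sup>2)"
        by (rule mult_left_mono) simp
      also have "\<dots> = ennreal (K * (b / 4) ^ k)"
      proof -
        have "(4::real) ^ k = (2 ^ k)\<^sup>2" by (simp add: power2_eq_square flip: power_mult_distrib)
        then show ?thesis using K b0 by (simp add: power_divide flip: ennreal_mult)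
      qed
      finally show "?c k * (\<integral>\<^sup>+x. ennreal (?d k x) \<partial>lborel) \<le> ennreal (K * (b / 4) ^ k)" .
    qed auto
    also have "(\<Sum>k. ennreal (K * (b / 4) ^ k)) = ennreal (K / (1 - b / 4))"
    proof (rule suminf_ennreal_eq)
      show "(\<lambda>k. K * (b / 4) ^ k) sums (K / (1 - b / 4))"
        using sums_mult[OF geometric_sums[of "b / 4"], of K] b0 b4 by simp
    qed (use K b0 in auto)
    also have "ennreal (l 0 powr (p - 2)) * 1 + ennreal (K / (1 - b / 4)) = ennreal C"
      using K b4 by (simp add: C_def ennreal_plus)
    finally show ?thesis .
  qed
  ultimately show ?thesis by (intro exI[of _ C]) blast
qed

section \<open>Transfer of the embedding to Sobolev functions\<close>

lemma H1_fun_measurable [measurable]: "H1_fun u \<in> borel_measurable lebesgue"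
  by (simp add: H1_fun_eq)

lemma H1_fun_add: "AE x in lebesgue. H1_fun (u + v) x = H1_fun u x + H1_fun v x"
  unfolding H1_fun_eq H1_L2_add by (rule rep_L2_add)

lemma H1_fun_scaleR: "AE x in lebesgue. H1_fun (c *\<^sub>R u) x = c * H1_fun u x"
  unfolding H1_fun_eq H1_L2_scaleR by (rule rep_L2_scaleR)

lemma H1_fun_square: "integrable lebesgue (\<lambda>x. (H1_fun u x)\<^sup>2)"
  using rep_L2_square_integrable[of "H1_L2 u"] by (simp add: H1_fun_eq square_integrable_def)

lemma nn_integral_square_L2: "(\<integral>\<^sup>+x. ennreal ((rep_L2 v x)\<^sup>2) \<partial>lebesgue) = ennreal ((norm v)\<^sup>2)"
  using rep_L2_square_integrable[of v] by (simp add: nn_integral_eq_integral square_integrable_def norm_L2_eq)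

text \<open>Vectors of the unit cube have coordinates in [0,1], so the derivative along
  \<open>h\<close> is bounded by the sum of the N partial derivatives.\<close>

lemma H1_translate_difference_le:
  fixes u :: "'n::finite H1"
  assumes r: "r \<ge> 0" and h: "h \<in> cbox 0 One"
  shows "norm (translate_L2 (r *\<^sub>R h) (H1_L2 u) - H1_L2 u) \<le> r * (real CARD('n) * norm u)"
proof -
  let ?d = "\<Sum>i\<in>UNIV. h $ i *\<^sub>R (H1_partial u $ i)"
  have hi: "\<bar>h $ i\<bar> \<le> 1" for i
  proof -
    have "axis i 1 \<in> (Basis :: (real^'n) set)" by (simp add: axis_in_Basis_iff)
    then have "0 \<le> h \<bullet> axis i 1" "h \<bullet> axis i 1 \<le> 1" using h by (auto simp: mem_box)
    then show ?thesis by (simp add: inner_axis)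
  qed
  have "norm ?d \<le> (\<Sum>i\<in>(UNIV::'n set). norm u)"
  proof (rule sum_norm_le)
    fix i
    have "norm (H1_partial u $ i) \<le> norm u"
      using Finite_Cartesian_Product.norm_nth_le[of "H1_partial u" i] norm_H1_partial_le[of u] by linarith
    then show "norm (h $ i *\<^sub>R (H1_partial u $ i)) \<le> norm u"
      using mult_mono[OF hi[of i], of "norm (H1_partial u $ i)" "norm u"] by simp
  qed
  then have d: "norm ?d \<le> real CARD('n) * norm u" by simp
  have "weak_dir h (H1_L2 u) ?d" by (rule weak_dir_gradient) (rule weak_partial_H1)
  from norm_difference_le[OF this, of r] mult_left_mono[OF d r] r show ?thesis by simp
qed

text \<open>For N \<ge> 3 the condition p < 2N/(N-2) is equivalent to (N/2 - 1)(p - 2) < 2, so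
  \<open>\<theta>\<close> can be N/2 - 1 itself. For N \<le> 2 any small positive value works; 1/p
  gives (p - 2)/p < 1.\<close>

lemma subcritical_exponent:
  assumes p: "2 \<le> p" "ereal p < crit_exp N" and N: "N \<ge> 1"
  obtains \<theta> where "\<theta> > 0" "real N / 2 - 1 \<le> \<theta>" "\<theta> * (p - 2) < 2"
proof (cases "N \<ge> 3")
  case True
  then have n: "real N > 2" by linarith
  have "p < 2 * real N / (real N - 2)" using p(2) True by (simp add: crit_exp_def)
  then have "p * (real N - 2) < 2 * real N" using n by (simp add: field_simps)
  then have "(real N / 2 - 1) * (p - 2) < 2" by (simp add: field_simps)
  then show ?thesis using that[of "real N / 2 - 1"] n by simp
next
  case False
  then have "real N / 2 - 1 \<le> 0" by linarith
  also have "0 \<le> 1 / p" using p(1) by simp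
  finally have "real N / 2 - 1 \<le> 1 / p" .
  moreover have "1 / p * (p - 2) < 2" using p(1) by (simp add: field_simps)
  ultimately show ?thesis using that[of "1 / p"] p(1) by simp
qed

theorem sobolev_H1:
  assumes p: "2 \<le> p" "ereal p < crit_exp CARD('n::finite)"
  shows "\<exists>C\<ge>0. \<forall>u :: 'n H1. integrable lebesgue (\<lambda>x. \<bar>H1_fun u x\<bar> powr p) \<and>
    (\<integral>x. \<bar>H1_fun u x\<bar> powr p \<partial>lebesgue) \<le> C * norm u powr p"
proof -
  obtain \<theta> where \<theta>: "\<theta> > 0" "real CARD('n) / 2 - 1 \<le> \<theta>" "\<theta> * (p - 2) < 2"
    using subcritical_exponent[OF p] by (auto simp: Suc_leI)
  obtain C where C: "C \<ge> 0" and *: "\<And>U :: real^'n \<Rightarrow> real. U \<in> borel_measurable borel \<Longrightarrow>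
    (\<integral>\<^sup>+x. ennreal ((U x)\<^sup>2) \<partial>lborel) \<le> 1 \<Longrightarrow>
    (\<And>r h. 0 < r \<Longrightarrow> r \<le> 1 \<Longrightarrow> h \<in> cbox 0 One \<Longrightarrow>
      (\<integral>\<^sup>+x. ennreal ((U (x + r *\<^sub>R h) - U x)\<^sup>2) \<partial>lborel) \<le> ennreal (r\<^sup>2)) \<Longrightarrow>
    (\<integral>\<^sup>+x. ennreal (\<bar>U x\<bar> powr p) \<partial>lborel) \<le> ennreal C"
    using sobolev_bound[OF p(1) \<theta>(1), where ?'a = "real^'n"] \<theta>(2,3) by auto
  \<comment> \<open>Large enough that \<open>K * norm v \<le> 1\<close> forces both the unit L^2
    bound and the shift bound with constant 1, which contains the factor N.\<close>
  define K where "K = (1 + real CARD('n))"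
  have K: "K \<ge> 1" by (simp add: K_def)
  have unit: "(\<integral>\<^sup>+x. ennreal (\<bar>H1_fun v x\<bar> powr p) \<partial>lebesgue) \<le> ennreal C" if v: "K * norm v \<le> 1" for v :: "'n H1"
  proof -
    have v1: "norm v \<le> 1" using v K mult_right_mono[OF K norm_ge_zero[of v]] by linarith
    obtain U where U[measurable]: "U \<in> borel_measurable lborel" and "AE x in lborel. H1_fun v x = U x"
      using completion_ex_borel_measurable_real[OF H1_fun_measurable] by blast
    then have eq: "AE x in lebesgue. H1_fun v x = U x" by (intro AE_completion)
    have "(\<integral>\<^sup>+x. ennreal ((U x)\<^sup>2) \<partial>lborel) = (\<integral>\<^sup>+x. ennreal ((U x)\<^sup>2) \<partial>lebesgue)"
      by (simp add: nn_integral_completion)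
    also have "\<dots> = (\<integral>\<^sup>+x. ennreal ((rep_L2 (H1_L2 v) x)\<^sup>2) \<partial>lebesgue)"
      by (rule nn_integral_cong_AE) (use eq in eventually_elim, simp add: H1_fun_eq)
    also have "\<dots> \<le> 1"
      using norm_H1_L2_le[of v] v1 by (simp add: nn_integral_square_L2 power_le_one)
    finally have U2: "(\<integral>\<^sup>+x. ennreal ((U x)\<^sup>2) \<partial>lborel) \<le> 1" .
    have shift: "(\<integral>\<^sup>+x. ennreal ((U (x + r *\<^sub>R h) - U x)\<^sup>2) \<partial>lborel) \<le> ennreal (r\<^sup>2)"
      if r: "0 < r" "r \<le> 1" and h: "h \<in> cbox 0 One" for r h
    proof -
      let ?w = "translate_L2 (r *\<^sub>R h) (H1_L2 v) - H1_L2 v"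
      have "(\<integral>\<^sup>+x. ennreal ((U (x + r *\<^sub>R h) - U x)\<^sup>2) \<partial>lborel) = (\<integral>\<^sup>+x. ennreal ((U (x + r *\<^sub>R h) - U x)\<^sup>2) \<partial>lebesgue)"
        by (simp add: nn_integral_completion)
      also have "\<dots> = (\<integral>\<^sup>+x. ennreal ((rep_L2 ?w x)\<^sup>2) \<partial>lebesgue)"
        by (rule nn_integral_cong_AE)
          (use eq AE_lebesgue_translate[OF eq, of "r *\<^sub>R h"] rep_L2_diff[of "translate_L2 (r *\<^sub>R h) (H1_L2 v)" "H1_L2 v"]
            rep_translate_L2[of "r *\<^sub>R h" "H1_L2 v"] in eventually_elim, simp add: H1_fun_eq)
      also have "\<dots> = ennreal ((norm ?w)\<^sup>2)" by (rule nn_integral_square_L2)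
      also have "\<dots> \<le> ennreal (r\<^sup>2)"
      proof (intro ennreal_leI power_mono norm_ge_zero)
        have "real CARD('n) * norm v \<le> 1"
          using v mult_right_mono[of "real CARD('n)" K "norm v"] by (simp add: K_def)
        then have "r * (real CARD('n) * norm v) \<le> r * 1" using r by (intro mult_left_mono) auto
        with H1_translate_difference_le[OF less_imp_le[OF r(1)] h, of v] show "norm ?w \<le> r" by linarith
      qed
      finally show ?thesis .
    qed
    have "(\<integral>\<^sup>+x. ennreal (\<bar>H1_fun v x\<bar> powr p) \<partial>lebesgue) = (\<integral>\<^sup>+x. ennreal (\<bar>U x\<bar> powr p) \<partial>lebesgue)"
      by (rule nn_integral_cong_AE) (use eq in eventually_elim, simp)
    also have "\<dots> = (\<integral>\<^sup>+x. ennreal (\<bar>U x\<bar> powr p) \<partial>lborel)" by (simp add: nn_integral_completion)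
    also have "\<dots> \<le> ennreal C" using *[OF _ U2 shift] U by simp
    finally show ?thesis .
  qed
  have "integrable lebesgue (\<lambda>x. \<bar>H1_fun u x\<bar> powr p) \<and>
    (\<integral>x. \<bar>H1_fun u x\<bar> powr p \<partial>lebesgue) \<le> (K powr p * C) * norm u powr p" for u :: "'n H1"
  proof (cases "u = 0")
    case True
    have "AE x in lebesgue. H1_fun u x = 0"
      unfolding True H1_fun_eq H1_L2_zero by (rule rep_L2_0)
    then have ae: "AE x in lebesgue. \<bar>H1_fun u x\<bar> powr p = 0" by eventually_elim simp
    have "integrable lebesgue (\<lambda>x. \<bar>H1_fun u x\<bar> powr p) = integrable lebesgue (\<lambda>x::real^'n. 0::real)"
      by (rule integrable_cong_AE) (use ae in auto)
    moreover have "(\<integral>x. \<bar>H1_fun u x\<bar> powr p \<partial>lebesgue) = integral\<^sup>L lebesgue (\<lambda>x::real^'n. 0::real)"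
      by (rule integral_cong_AE) (use ae in auto)
    ultimately show ?thesis using True by simp
  next
    case False
    define c where "c = K * norm u"
    have c: "c > 0" using False K by (simp add: c_def)
    let ?v = "(1 / c) *\<^sub>R u"
    have "K * norm ?v \<le> 1" using c K False by (simp add: c_def)
    note un = unit[OF this]
    have "(\<integral>\<^sup>+x. ennreal (\<bar>H1_fun u x\<bar> powr p) \<partial>lebesgue) = (\<integral>\<^sup>+x. ennreal (c powr p) * ennreal (\<bar>H1_fun ?v x\<bar> powr p) \<partial>lebesgue)"
    proof (rule nn_integral_cong_AE)
      show "AE x in lebesgue. ennreal (\<bar>H1_fun u x\<bar> powr p) = ennreal (c powr p) * ennreal (\<bar>H1_fun ?v x\<bar> powr p)"
        using H1_fun_scaleR[of "1 / c" u]
      proof eventually_elim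
        case (elim x)
        have "\<bar>H1_fun u x\<bar> = c * \<bar>H1_fun ?v x\<bar>" using c by (simp add: elim abs_mult)
        then show ?case using c by (simp add: powr_mult ennreal_mult)
      qed
    qed
    also have "\<dots> = ennreal (c powr p) * (\<integral>\<^sup>+x. ennreal (\<bar>H1_fun ?v x\<bar> powr p) \<partial>lebesgue)"
      by (rule nn_integral_cmult) measurable
    also have "\<dots> \<le> ennreal (c powr p) * ennreal C" by (rule mult_left_mono[OF un]) simp
    also have "\<dots> = ennreal ((K powr p * C) * norm u powr p)"
      using K C by (simp add: c_def powr_mult ennreal_mult mult_ac)
    finally have b: "(\<integral>\<^sup>+x. ennreal (\<bar>H1_fun u x\<bar> powr p) \<partial>lebesgue) \<le> ennreal ((K powr p * C) * norm u powr p)" .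
    have i: "integrable lebesgue (\<lambda>x. \<bar>H1_fun u x\<bar> powr p)"
      by (rule integrableI_bounded) (use le_less_trans[OF b ennreal_less_top] in auto)
    with b show ?thesis using C by (simp add: nn_integral_eq_integral)
  qed
  then show ?thesis using C by (intro exI[of _ "K powr p * C"]) auto
qed

section \<open>Differentiability of superposition functionals\<close>

text \<open>One of the two terms already dominates, depending on whether b \<le> \<epsilon> a^(r-1).
  The free \<open>\<epsilon>\<close> later replaces Hoelder's inequality.\<close>

lemma Young_powr:
  fixes a b \<epsilon> r :: real
  assumes "r > 1" "\<epsilon> > 0" "a \<ge> 0" "b \<ge> 0"
  shows "a * b \<le> \<epsilon> * a powr r + \<epsilon> powr (- 1 / (r - 1)) * b powr (r / (r - 1))"
proof (cases "a = 0 \<or> b = 0")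
  case True
  then show ?thesis using assms by auto
next
  case False
  then have ab: "a > 0" "b > 0" using assms by auto
  show ?thesis
  proof (cases "b \<le> \<epsilon> * a powr (r - 1)")
    case True
    have "a * b \<le> a * (\<epsilon> * a powr (r - 1))" using True ab by simp
    also have "\<dots> = \<epsilon> * a powr r" using ab powr_add[of a 1 "r - 1"] by simp
    also have "\<dots> \<le> \<epsilon> * a powr r + \<epsilon> powr (- 1 / (r - 1)) * b powr (r / (r - 1))" by simp
    finally show ?thesis .
  next
    case False
    then have "a powr (r - 1) \<le> b / \<epsilon>" using assms by (simp add: field_simps)
    then have "(a powr (r - 1)) powr (1 / (r - 1)) \<le> (b / \<epsilon>) powr (1 / (r - 1))"
      using assms by (intro powr_mono2) auto
    then have "a \<le> (b / \<epsilon>) powr (1 / (r - 1))" using assms ab by (simp add: powr_powr)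
    then have "a * b \<le> (b / \<epsilon>) powr (1 / (r - 1)) * b" using ab by simp
    also have "\<dots> = \<epsilon> powr (- 1 / (r - 1)) * (b powr (1 / (r - 1)) * b powr 1)"
      using assms ab by (simp add: powr_divide powr_minus_divide)
    also have "b powr (1 / (r - 1)) * b powr 1 = b powr (r / (r - 1))"
    proof -
      have "1 / (r - 1) + 1 = r / (r - 1)" using assms by (simp add: field_simps)
      then show ?thesis by (simp only: powr_add[symmetric])
    qed
    also have "\<epsilon> powr (- 1 / (r - 1)) * b powr (r / (r - 1)) \<le> \<epsilon> * a powr r + \<epsilon> powr (- 1 / (r - 1)) * b powr (r / (r - 1))"
      using assms by simp
    finally show ?thesis .
  qed
qed

lemma powr_sum_le:
  fixes a b s :: real
  assumes "a \<ge> 0" "b \<ge> 0" "s \<ge> 0"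
  shows "(a + b) powr s \<le> 2 powr s * (a powr s + b powr s)"
proof -
  have "(a + b) powr s \<le> (2 * max a b) powr s" using assms by (intro powr_mono2) auto
  also have "\<dots> = 2 powr s * (max a b) powr s" using assms by (simp add: powr_mult)
  also have "(max a b) powr s \<le> a powr s + b powr s" by (simp add: max_def)
  finally show ?thesis by simp
qed

text \<open>In the application \<open>\<rho> n\<close> is the remainder of a difference quotient and
  \<open>k n\<close> an increment divided by its norm. With s = r/(r-1) the integrals of
  \<open>\<rho> n x powr s\<close> tend to 0, and Young's inequality with small
  \<open>\<epsilon>\<close> pairs this with the bounded integrals of \<open>k n\<close>.\<close>

lemma superposition_remainder_tendsto:
  fixes w :: "'a \<Rightarrow> real"
  assumes r: "r > 1" and c: "c \<ge> 0"
    and [measurable]: "w \<in> borel_measurable M" "\<And>n. \<rho> n \<in> borel_measurable M" "\<And>n. h n \<in> borel_measurable M"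
      "\<And>n. k n \<in> borel_measurable M"
    and w: "integrable M (\<lambda>x. \<bar>w x\<bar> powr r)"
    and h: "\<And>n. integrable M (\<lambda>x. \<bar>h n x\<bar> powr r)" "(\<lambda>n. \<integral>x. \<bar>h n x\<bar> powr r \<partial>M) \<longlonglongrightarrow> 0"
    and k: "\<And>n. integrable M (\<lambda>x. \<bar>k n x\<bar> powr r)" "\<And>n. (\<integral>x. \<bar>k n x\<bar> powr r \<partial>M) \<le> B"
    and \<rho>: "\<And>n. AE x in M. 0 \<le> \<rho> n x" "\<And>n. AE x in M. \<rho> n x \<le> c * (\<bar>w x\<bar> powr (r - 1) + \<bar>h n x\<bar> powr (r - 1))"
      "AE x in M. (\<lambda>n. \<rho> n x) \<longlonglongrightarrow> 0"
  shows "\<And>n. integrable M (\<lambda>x. \<rho> n x * \<bar>k n x\<bar>)" "(\<lambda>n. \<integral>x. \<rho> n x * \<bar>k n x\<bar> \<partial>M) \<longlonglongrightarrow> 0"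
proof -
  define s where "s = r / (r - 1)"
  have s: "s > 0" using r by (simp add: s_def)
  have pp: "(\<bar>t\<bar> powr (r - 1)) powr s = \<bar>t\<bar> powr r" for t
    using r by (simp add: powr_powr s_def)
  define d where "d = c powr s * 2 powr s"
  have d: "d \<ge> 0" by (simp add: d_def)
  have bd: "AE x in M. 0 \<le> \<rho> n x powr s \<and> \<rho> n x powr s \<le> d * (\<bar>w x\<bar> powr r + \<bar>h n x\<bar> powr r)" for n
    using \<rho>(1,2)[of n]
  proof eventually_elim
    case (elim x)
    have "\<rho> n x powr s \<le> (c * (\<bar>w x\<bar> powr (r - 1) + \<bar>h n x\<bar> powr (r - 1))) powr s"
      using elim s by (intro powr_mono2) auto
    also have "\<dots> = c powr s * (\<bar>w x\<bar> powr (r - 1) + \<bar>h n x\<bar> powr (r - 1)) powr s"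
      using c by (simp add: powr_mult)
    also have "\<dots> \<le> c powr s * (2 powr s * ((\<bar>w x\<bar> powr (r - 1)) powr s + (\<bar>h n x\<bar> powr (r - 1)) powr s))"
      using s by (intro mult_left_mono powr_sum_le) auto
    finally show ?case by (simp add: pp d_def)
  qed
  have i\<rho>: "integrable M (\<lambda>x. \<rho> n x powr s)" for n
  proof (rule Bochner_Integration.integrable_bound)
    show "integrable M (\<lambda>x. d * (\<bar>w x\<bar> powr r + \<bar>h n x\<bar> powr r))" using w h(1)[of n] by simp
    show "AE x in M. norm (\<rho> n x powr s) \<le> norm (d * (\<bar>w x\<bar> powr r + \<bar>h n x\<bar> powr r))"
      using bd[of n] by eventually_elim simp
  qed measurable
  \<comment> \<open>No fixed function dominates all \<open>\<bar>h n x\<bar> powr r\<close>,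
    although their integrals tend to 0. Once this part is subtracted, the rest lies below
    \<open>d * \<bar>w x\<bar> powr r\<close> and dominated convergence applies.\<close>
  let ?\<phi> = "\<lambda>n x. max 0 (\<rho> n x powr s - d * \<bar>h n x\<bar> powr r)"
  have \<phi>b: "AE x in M. norm (?\<phi> n x) \<le> d * \<bar>w x\<bar> powr r" for n
    using bd[of n] by eventually_elim (use d in \<open>simp add: algebra_simps\<close>)
  have id: "integrable M (\<lambda>x. d * \<bar>w x\<bar> powr r)" using w by simp
  have i\<phi>: "integrable M (?\<phi> n)" for n
  proof (rule Bochner_Integration.integrable_bound[OF id])
    show "AE x in M. norm (?\<phi> n x) \<le> norm (d * \<bar>w x\<bar> powr r)"
      using \<phi>b[of n] by eventually_elim (rule order_trans, assumption, simp)
  qed measurable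
  have "(\<lambda>n. \<integral>x. ?\<phi> n x \<partial>M) \<longlonglongrightarrow> integral\<^sup>L M (\<lambda>x. 0::real)"
  proof (rule integral_dominated_convergence[OF _ _ id])
    have all: "AE x in M. \<forall>n. 0 \<le> \<rho> n x" using \<rho>(1) by (simp add: AE_all_countable)
    show "AE x in M. (\<lambda>n. ?\<phi> n x) \<longlonglongrightarrow> 0"
      using \<rho>(3) all
    proof eventually_elim
      case (elim x)
      have lim: "(\<lambda>n. \<rho> n x powr s) \<longlonglongrightarrow> 0 powr s"
        by (rule tendsto_powr'[OF elim(1) tendsto_const]) (use elim(2) s in auto)
      show ?case
      proof (rule tendsto_sandwich[OF _ _ tendsto_const lim[simplified]])
        show "\<forall>\<^sub>F n in sequentially. ?\<phi> n x \<le> \<rho> n x powr s" using d by (intro always_eventually) auto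
      qed auto
    qed
  qed (use \<phi>b in measurable)
  then have \<phi>0: "(\<lambda>n. \<integral>x. ?\<phi> n x \<partial>M) \<longlonglongrightarrow> 0" by simp
  have le: "(\<integral>x. \<rho> n x powr s \<partial>M) \<le> (\<integral>x. ?\<phi> n x \<partial>M) + d * (\<integral>x. \<bar>h n x\<bar> powr r \<partial>M)" for n
  proof -
    have "(\<integral>x. \<rho> n x powr s \<partial>M) \<le> (\<integral>x. ?\<phi> n x + d * \<bar>h n x\<bar> powr r \<partial>M)"
      using i\<rho>[of n] i\<phi>[of n] h(1)[of n] by (intro integral_mono) auto
    then show ?thesis using i\<phi>[of n] h(1)[of n] by simp
  qed
  have \<rho>0: "(\<lambda>n. \<integral>x. \<rho> n x powr s \<partial>M) \<longlonglongrightarrow> 0"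
  proof (rule tendsto_sandwich[OF _ _ tendsto_const])
    show "(\<lambda>n. (\<integral>x. ?\<phi> n x \<partial>M) + d * (\<integral>x. \<bar>h n x\<bar> powr r \<partial>M)) \<longlonglongrightarrow> 0"
      using tendsto_add[OF \<phi>0 tendsto_mult_left[OF h(2), of d]] by simp
  qed (use le in auto)
  have young: "AE x in M. 0 \<le> \<rho> n x * \<bar>k n x\<bar> \<and>
      \<rho> n x * \<bar>k n x\<bar> \<le> \<epsilon> * \<bar>k n x\<bar> powr r + \<epsilon> powr (- 1 / (r - 1)) * \<rho> n x powr s" if "\<epsilon> > 0" for n \<epsilon>
    using \<rho>(1)[of n]
  proof eventually_elim
    case (elim x)
    then show ?case using Young_powr[OF r that, of "\<bar>k n x\<bar>" "\<rho> n x"] by (simp add: s_def mult.commute)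
  qed
  show int: "integrable M (\<lambda>x. \<rho> n x * \<bar>k n x\<bar>)" for n
  proof (rule Bochner_Integration.integrable_bound)
    show "integrable M (\<lambda>x. 1 * \<bar>k n x\<bar> powr r + 1 powr (- 1 / (r - 1)) * \<rho> n x powr s)"
      using k(1)[of n] i\<rho>[of n] by simp
    show "AE x in M. norm (\<rho> n x * \<bar>k n x\<bar>) \<le> norm (1 * \<bar>k n x\<bar> powr r + 1 powr (- 1 / (r - 1)) * \<rho> n x powr s)"
      using young[OF zero_less_one, of n] by (rule eventually_mono) auto
  qed measurable
  show "(\<lambda>n. \<integral>x. \<rho> n x * \<bar>k n x\<bar> \<partial>M) \<longlonglongrightarrow> 0"
  proof (rule LIMSEQ_I)
    fix e :: real assume e: "e > 0"
    \<comment> \<open>The first Young term then integrates to at most e/2, uniformly in n.\<close>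
    define \<epsilon> where "\<epsilon> = e / (2 * (\<bar>B\<bar> + 1))"
    have \<epsilon>: "\<epsilon> > 0" "\<epsilon> * B < e"
    proof -
      show "\<epsilon> > 0" using e by (simp add: \<epsilon>_def add_nonneg_pos)
      then have "\<epsilon> * B \<le> \<epsilon> * (\<bar>B\<bar> + 1)" by (intro mult_left_mono) auto
      also have "\<dots> = e / 2"
      proof -
        have "e / (2 * X) * X = e / 2" if "X > 0" for X using that by simp
        from this[of "\<bar>B\<bar> + 1"] show ?thesis unfolding \<epsilon>_def by (simp only: add_nonneg_pos abs_ge_zero zero_less_one simp_thms)
      qed
      finally show "\<epsilon> * B < e" using e by linarith
    qed
    let ?D = "\<epsilon> powr (- 1 / (r - 1))"
    have "(\<lambda>n. \<epsilon> * B + ?D * (\<integral>x. \<rho> n x powr s \<partial>M)) \<longlonglongrightarrow> \<epsilon> * B + ?D * 0"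
      by (intro tendsto_intros \<rho>0)
    then have "\<forall>\<^sub>F n in sequentially. \<epsilon> * B + ?D * (\<integral>x. \<rho> n x powr s \<partial>M) < e"
      using \<epsilon>(2) by (intro order_tendstoD) auto
    then obtain n0 where n0: "\<And>n. n \<ge> n0 \<Longrightarrow> \<epsilon> * B + ?D * (\<integral>x. \<rho> n x powr s \<partial>M) < e"
      by (auto simp: eventually_sequentially)
    show "\<exists>n0. \<forall>n\<ge>n0. norm ((\<integral>x. \<rho> n x * \<bar>k n x\<bar> \<partial>M) - 0) < e"
    proof (intro exI allI impI)
      fix n assume n: "n \<ge> n0"
      have "0 \<le> (\<integral>x. \<rho> n x * \<bar>k n x\<bar> \<partial>M)"
        by (rule integral_nonneg_AE, rule eventually_mono[OF young[OF \<epsilon>(1), of n]]) auto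
      moreover have "(\<integral>x. \<rho> n x * \<bar>k n x\<bar> \<partial>M) \<le> (\<integral>x. \<epsilon> * \<bar>k n x\<bar> powr r + ?D * \<rho> n x powr s \<partial>M)"
        by (rule integral_mono_AE[OF int])
           (use k(1)[of n] i\<rho>[of n] in \<open>auto intro!: eventually_mono[OF young[OF \<epsilon>(1), of n]]\<close>)
      moreover have "(\<integral>x. \<epsilon> * \<bar>k n x\<bar> powr r + ?D * \<rho> n x powr s \<partial>M) =
          \<epsilon> * (\<integral>x. \<bar>k n x\<bar> powr r \<partial>M) + ?D * (\<integral>x. \<rho> n x powr s \<partial>M)"
        using k(1)[of n] i\<rho>[of n] by simp
      moreover have "\<epsilon> * (\<integral>x. \<bar>k n x\<bar> powr r \<partial>M) \<le> \<epsilon> * B" using \<epsilon>(1) k(2)[of n] by simp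
      ultimately show "norm ((\<integral>x. \<rho> n x * \<bar>k n x\<bar> \<partial>M) - 0) < e" using n0[OF n] by simp
    qed
  qed
qed

text \<open>Convergence of integrals yields pointwise convergence only along a subsequence. If the
  quotient did not tend to 0, it would stay above some e > 0 along a sequence of increments, and so
  would every reselection from that sequence.\<close>

lemma has_derivative_subsequencesI:
  fixes F :: "'a::real_normed_vector \<Rightarrow> real"
  assumes D: "bounded_linear D"
    and sub: "\<And>X. (\<And>n::nat. X n \<noteq> 0) \<Longrightarrow> X \<longlonglongrightarrow> 0 \<Longrightarrow>
      \<exists>r::nat\<Rightarrow>nat. (\<lambda>n. \<bar>F (x + X (r n)) - F x - D (X (r n))\<bar> / norm (X (r n))) \<longlonglongrightarrow> 0"
  shows "(F has_derivative D) (at x)"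
  unfolding has_derivative_at
proof (intro conjI D)
  let ?\<phi> = "\<lambda>h. norm (F (x + h) - F x - D h) / norm h"
  show "(?\<phi> \<longlongrightarrow> 0) (at 0)"
    unfolding tendsto_at_iff_sequentially
  proof (intro allI impI)
    fix X :: "nat \<Rightarrow> 'a"
    assume X0: "\<forall>i. X i \<in> UNIV - {0}" and X: "X \<longlonglongrightarrow> 0"
    show "(?\<phi> \<circ> X) \<longlonglongrightarrow> 0"
    proof (rule ccontr)
      assume "\<not> ?thesis"
      then obtain e where e: "e > 0" "\<And>N. \<exists>n\<ge>N. e \<le> ?\<phi> (X n)"
        by (auto simp: LIMSEQ_def dist_real_def not_less)
      then obtain s where s: "\<And>N. s N \<ge> N" "\<And>N. e \<le> ?\<phi> (X (s N))" by metis
      have "filterlim s at_top sequentially"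
        by (rule filterlim_at_top_mono[OF filterlim_ident]) (use s in auto)
      then have "(\<lambda>n. X (s n)) \<longlonglongrightarrow> 0" using X by (rule filterlim_compose[rotated])
      then obtain r where "(\<lambda>n. ?\<phi> (X (s (r n)))) \<longlonglongrightarrow> 0"
        using sub[of "\<lambda>n. X (s n)"] X0 by auto
      then have "e \<le> 0" by (rule LIMSEQ_le_const) (use s in auto)
      with e show False by simp
    qed
  qed
qed

lemma primitive_increment_bound:
  fixes G g :: "real \<Rightarrow> real"
  assumes D: "\<And>u. (G has_real_derivative g u) (at u)"
    and gr: "\<And>u. \<bar>g u\<bar> \<le> c * (\<bar>u\<bar> + \<bar>u\<bar> powr (p - 1))" and c: "c \<ge> 0" and p: "p \<ge> 2"
    and a: "\<bar>a\<bar> \<le> M" and b: "\<bar>b\<bar> \<le> M"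
  shows "\<bar>G a - G b\<bar> \<le> c * (M + M powr (p - 1)) * \<bar>a - b\<bar>"
proof -
  have "norm (G a - G b) \<le> c * (M + M powr (p - 1)) * norm (a - b)"
  proof (rule field_differentiable_bound[of "{-M..M}" _ g])
    fix s assume "s \<in> {-M..M}"
    then have s: "\<bar>s\<bar> \<le> M" by auto
    show "(G has_field_derivative g s) (at s within {-M..M})"
      using D by (rule has_field_derivative_at_within)
    have "\<bar>s\<bar> + \<bar>s\<bar> powr (p - 1) \<le> M + M powr (p - 1)"
      using s p by (intro add_mono powr_mono2) auto
    then show "norm (g s) \<le> c * (M + M powr (p - 1))"
      using gr[of s] mult_left_mono[OF _ c] by (smt (verit) real_norm_def)
  qed (use a b in auto)
  then show ?thesis by simp
qed

text \<open>The linear and the power part of the growth match the embeddings into L^2 and L^p. Along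
  a subsequence the increments, hence the remainder quotients, tend to 0 almost everywhere, and
  \<open>superposition_remainder_tendsto\<close> is applied once with r = 2 and once with r =
  p.\<close>

theorem superposition_has_derivative:
  fixes g G :: "real^'n::finite \<Rightarrow> real \<Rightarrow> real"
  assumes p: "2 \<le> p" "ereal p < crit_exp CARD('n)"
    and mg: "\<And>w. w \<in> borel_measurable lebesgue \<Longrightarrow> (\<lambda>x. g x (w x)) \<in> borel_measurable lebesgue"
    and mG: "\<And>w. w \<in> borel_measurable lebesgue \<Longrightarrow> (\<lambda>x. G x (w x)) \<in> borel_measurable lebesgue"
    and D: "AE x in lebesgue. \<forall>u. (G x has_real_derivative g x u) (at u)"
    and G0: "AE x in lebesgue. G x 0 = 0"
    and gr: "AE x in lebesgue. \<forall>u. \<bar>g x u\<bar> \<le> c * (\<bar>u\<bar> + \<bar>u\<bar> powr (p - 1))" and c: "c \<ge> 0"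
  shows "\<And>u. integrable lebesgue (\<lambda>x. G x (H1_fun u x))"
    and "\<And>u v. integrable lebesgue (\<lambda>x. g x (H1_fun u x) * H1_fun v x)"
    and "((\<lambda>u. \<integral>x. G x (H1_fun u x) \<partial>lebesgue) has_derivative
      (\<lambda>v. \<integral>x. g x (H1_fun u x) * H1_fun v x \<partial>lebesgue)) (at u)"
proof -
  have p1: "p > 1" using p by simp
  have "ereal 2 \<le> ereal p" using p(1) by simp
  then have two: "ereal 2 < crit_exp CARD('n)" using p(2) by (rule le_less_trans)
  obtain Cp where Cp: "Cp \<ge> 0" "\<And>u :: 'n H1. integrable lebesgue (\<lambda>x. \<bar>H1_fun u x\<bar> powr p)"
      "\<And>u :: 'n H1. (\<integral>x. \<bar>H1_fun u x\<bar> powr p \<partial>lebesgue) \<le> Cp * norm u powr p"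
    using sobolev_H1[OF p] by blast
  obtain C2 where C2: "C2 \<ge> 0" "\<And>u :: 'n H1. integrable lebesgue (\<lambda>x. \<bar>H1_fun u x\<bar> powr 2)"
      "\<And>u :: 'n H1. (\<integral>x. \<bar>H1_fun u x\<bar> powr 2 \<partial>lebesgue) \<le> C2 * norm u powr 2"
    using sobolev_H1[OF order_refl two] by blast
  note mgH[measurable] = mg[OF H1_fun_measurable] and mGH[measurable] = mG[OF H1_fun_measurable]
  show iG: "integrable lebesgue (\<lambda>x. G x (H1_fun u x))" for u
  proof (rule Bochner_Integration.integrable_bound)
    show "integrable lebesgue (\<lambda>x. c * (\<bar>H1_fun u x\<bar> powr 2 + \<bar>H1_fun u x\<bar> powr p))"
      using Cp(2)[of u] C2(2)[of u] by simp
    show "AE x in lebesgue. norm (G x (H1_fun u x)) \<le> norm (c * (\<bar>H1_fun u x\<bar> powr 2 + \<bar>H1_fun u x\<bar> powr p))"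
      using D G0 gr
    proof eventually_elim
      case (elim x)
      let ?t = "H1_fun u x"
      have "\<bar>G x ?t - G x 0\<bar> \<le> c * (\<bar>?t\<bar> + \<bar>?t\<bar> powr (p - 1)) * \<bar>?t - 0\<bar>"
        by (rule primitive_increment_bound[of "G x" "g x"]) (use elim c p in auto)
      also have "\<dots> = c * (\<bar>?t\<bar> powr 1 * \<bar>?t\<bar> powr 1 + \<bar>?t\<bar> powr (p - 1) * \<bar>?t\<bar> powr 1)"
        by (simp add: algebra_simps)
      also have "\<dots> = c * (\<bar>?t\<bar> powr 2 + \<bar>?t\<bar> powr p)"
        by (simp only: powr_add[symmetric]) simp
      finally show ?case using elim c by simp
    qed
  qed measurable
  have pw: "AE x in lebesgue. norm (g x (H1_fun u x) * H1_fun v x) \<le>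
      c * (\<bar>H1_fun v x\<bar> powr 2 + \<bar>H1_fun u x\<bar> powr 2 + \<bar>H1_fun v x\<bar> powr p + \<bar>H1_fun u x\<bar> powr p)" for u v
    using gr
  proof eventually_elim
    case (elim x)
    let ?a = "\<bar>H1_fun u x\<bar>" and ?b = "\<bar>H1_fun v x\<bar>"
    have "\<bar>g x (H1_fun u x) * H1_fun v x\<bar> \<le> c * (?a + ?a powr (p - 1)) * ?b"
      using elim by (auto simp: abs_mult intro!: mult_right_mono)
    also have "\<dots> = c * (?b * ?a + ?b * ?a powr (p - 1))" by (simp add: algebra_simps)
    also have "\<dots> \<le> c * (?b powr 2 + ?a powr 2 + (?b powr p + ?a powr p))"
    proof (intro mult_left_mono add_mono c)
      show "?b * ?a \<le> ?b powr 2 + ?a powr 2"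
        using Young_powr[of 2 1 ?b ?a] by simp
      show "?b * ?a powr (p - 1) \<le> ?b powr p + ?a powr p"
        using Young_powr[OF p1, of 1 ?b "?a powr (p - 1)"] p1 by (simp add: powr_powr)
    qed
    finally show ?case by (simp add: add.assoc)
  qed
  let ?E = "\<lambda>u v x. c * (\<bar>H1_fun v x\<bar> powr 2 + \<bar>H1_fun u x\<bar> powr 2 + \<bar>H1_fun v x\<bar> powr p + \<bar>H1_fun u x\<bar> powr p)"
  have iE: "integrable lebesgue (?E u v)" for u v :: "'n H1"
    using Cp(2)[of u] C2(2)[of u] Cp(2)[of v] C2(2)[of v] by simp
  show ig: "integrable lebesgue (\<lambda>x. g x (H1_fun u x) * H1_fun v x)" for u v
    by (rule Bochner_Integration.integrable_bound[OF iE[of v u]])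
       (measurable, rule eventually_mono[OF pw[of u v]], simp)
  let ?F = "\<lambda>u. \<integral>x. G x (H1_fun u x) \<partial>lebesgue" and ?D = "\<lambda>v. \<integral>x. g x (H1_fun u x) * H1_fun v x \<partial>lebesgue"
  have Dadd: "?D (v + w) = ?D v + ?D w" for v w
  proof -
    have "?D (v + w) = (\<integral>x. g x (H1_fun u x) * H1_fun v x + g x (H1_fun u x) * H1_fun w x \<partial>lebesgue)"
    proof (rule integral_cong_AE)
      show "AE x in lebesgue. g x (H1_fun u x) * H1_fun (v + w) x = g x (H1_fun u x) * H1_fun v x + g x (H1_fun u x) * H1_fun w x"
        using H1_fun_add[of v w] by eventually_elim (simp add: distrib_left)
    qed measurable
    then show ?thesis using ig[of u v] ig[of u w] by simp
  qed
  have Dscale: "?D (a *\<^sub>R v) = a * ?D v" for a v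
  proof -
    have "?D (a *\<^sub>R v) = (\<integral>x. a * (g x (H1_fun u x) * H1_fun v x) \<partial>lebesgue)"
    proof (rule integral_cong_AE)
      show "AE x in lebesgue. g x (H1_fun u x) * H1_fun (a *\<^sub>R v) x = a * (g x (H1_fun u x) * H1_fun v x)"
        using H1_fun_scaleR[of a v] by eventually_elim simp
    qed measurable
    then show ?thesis by simp
  qed
  \<comment> \<open>The estimate from Young's inequality is not homogeneous in \<open>v\<close>. It
    is evaluated on the unit sphere, where \<open>C2\<close> and \<open>Cp\<close> bound the powers
    of \<open>v\<close>, and extended by scaling.\<close>
  define K where "K = c * (C2 + (\<integral>x. \<bar>H1_fun u x\<bar> powr 2 \<partial>lebesgue) + Cp + (\<integral>x. \<bar>H1_fun u x\<bar> powr p \<partial>lebesgue))"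
  have unit: "\<bar>?D v\<bar> \<le> K" if v: "norm v = 1" for v
  proof -
    have "\<bar>?D v\<bar> \<le> (\<integral>x. ?E u v x \<partial>lebesgue)"
      using order_trans[OF integral_norm_bound[of lebesgue "\<lambda>x. g x (H1_fun u x) * H1_fun v x"]
        integral_mono_AE[OF integrable_norm[OF ig[of u v]] iE[of v u] pw[of u v]]] by (simp only: real_norm_def)
    also have "\<dots> = c * ((\<integral>x. \<bar>H1_fun v x\<bar> powr 2 \<partial>lebesgue) + (\<integral>x. \<bar>H1_fun u x\<bar> powr 2 \<partial>lebesgue) +
        (\<integral>x. \<bar>H1_fun v x\<bar> powr p \<partial>lebesgue) + (\<integral>x. \<bar>H1_fun u x\<bar> powr p \<partial>lebesgue))"
      using Cp(2)[of u] C2(2)[of u] Cp(2)[of v] C2(2)[of v] by simp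
    also have "\<dots> \<le> K"
      unfolding K_def using Cp(3)[of v] C2(3)[of v] v c by (intro mult_left_mono add_mono) auto
    finally show ?thesis .
  qed
  have bl: "bounded_linear ?D"
  proof (rule bounded_linear_intro[of _ K])
    fix v :: "'n H1"
    show "norm (?D v) \<le> norm v * K"
    proof (cases "v = 0")
      case True
      then show ?thesis using Dscale[of 0 v] by simp
    next
      case False
      have "?D v = norm v * ?D ((1 / norm v) *\<^sub>R v)" using False unfolding Dscale by simp
      then show ?thesis using unit[of "(1 / norm v) *\<^sub>R v"] False by (simp add: abs_mult mult_left_mono)
    qed
  qed (use Dadd Dscale in auto)
  let ?w = "H1_fun u"
  show "(?F has_derivative ?D) (at u)"
  proof (rule has_derivative_subsequencesI[OF bl])
    fix X :: "nat \<Rightarrow> 'n H1"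
    assume X0: "\<And>n. X n \<noteq> 0" and X: "X \<longlonglongrightarrow> 0"
    have nX: "(\<lambda>n. norm (X n)) \<longlonglongrightarrow> 0" using X by (rule tendsto_norm_zero)
    have small: "(\<lambda>n. \<integral>x. \<bar>H1_fun (Y n) x\<bar> powr r \<partial>lebesgue) \<longlonglongrightarrow> 0"
      if Y: "(\<lambda>n. norm (Y n)) \<longlonglongrightarrow> 0" and r: "r > 0"
        and C: "\<And>u :: 'n H1. (\<integral>x. \<bar>H1_fun u x\<bar> powr r \<partial>lebesgue) \<le> C * norm u powr r" for Y :: "nat \<Rightarrow> 'n H1" and r C
    proof (rule tendsto_sandwich[OF _ _ tendsto_const])
      have "(\<lambda>n. norm (Y n) powr r) \<longlonglongrightarrow> 0 powr r"
        by (rule tendsto_powr'[OF Y tendsto_const]) (use r in auto)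
      from tendsto_mult_left[OF this, of C] r
      show "(\<lambda>n. C * norm (Y n) powr r) \<longlonglongrightarrow> 0" by simp
    qed (use C in auto)
    have "\<exists>r::nat\<Rightarrow>nat. strict_mono r \<and> (AE x in lebesgue. (\<lambda>n. \<bar>H1_fun (X (r n)) x\<bar> powr 2) \<longlonglongrightarrow> 0)"
      by (rule tendsto_L1_AE_subseq) (use C2(2) small[OF nX _ C2(3)] in auto)
    then obtain r where r: "strict_mono r" and ae2: "AE x in lebesgue. (\<lambda>n. \<bar>H1_fun (X (r n)) x\<bar> powr 2) \<longlonglongrightarrow> 0" by blast
    define Y where "Y = (\<lambda>n. X (r n))"
    have Y0: "Y n \<noteq> 0" for n using X0 by (simp add: Y_def)
    have nY: "(\<lambda>n. norm (Y n)) \<longlonglongrightarrow> 0"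
      using LIMSEQ_subseq_LIMSEQ[OF nX r] by (simp add: Y_def comp_def)
    let ?h = "\<lambda>n. H1_fun (Y n)"
    have h0: "AE x in lebesgue. (\<lambda>n. ?h n x) \<longlonglongrightarrow> 0"
      using ae2
    proof eventually_elim
      case (elim x)
      from tendsto_real_sqrt[OF elim] have "(\<lambda>n. \<bar>?h n x\<bar>) \<longlonglongrightarrow> 0" by (simp add: Y_def)
      then show ?case by (simp add: tendsto_rabs_zero_iff)
    qed
    define k where "k = (\<lambda>n x. ?h n x / norm (Y n))"
    have km[measurable]: "k n \<in> borel_measurable lebesgue" for n unfolding k_def by measurable
    have kr: "integrable lebesgue (\<lambda>x. \<bar>k n x\<bar> powr s)" "(\<integral>x. \<bar>k n x\<bar> powr s \<partial>lebesgue) \<le> C"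
      if "integrable lebesgue (\<lambda>x. \<bar>?h n x\<bar> powr s)" "(\<integral>x. \<bar>?h n x\<bar> powr s \<partial>lebesgue) \<le> C * norm (Y n) powr s" for n s C
    proof -
      have eq: "\<bar>k n x\<bar> powr s = \<bar>?h n x\<bar> powr s / norm (Y n) powr s" for x
        by (simp add: k_def powr_divide)
      show "integrable lebesgue (\<lambda>x. \<bar>k n x\<bar> powr s)" unfolding eq using that(1) by simp
      show "(\<integral>x. \<bar>k n x\<bar> powr s \<partial>lebesgue) \<le> C"
        unfolding eq using that(2) Y0[of n] by (simp add: field_simps)
    qed
    \<comment> \<open>The value 0 where the increment vanishes keeps the increment formula with
      factor \<open>\<rho> n x\<close> true there, and makes the gap, as a function of the
      increment, continuous at 0.\<close>
    define \<rho> where "\<rho> = (\<lambda>n x. if ?h n x = 0 then 0 else \<bar>(G x (?w x + ?h n x) - G x (?w x)) / ?h n x - g x (?w x)\<bar>)"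
    have mGh[measurable]: "(\<lambda>x. G x (?w x + ?h n x)) \<in> borel_measurable lebesgue" for n
      by (rule mG) measurable
    have \<rho>m[measurable]: "\<rho> n \<in> borel_measurable lebesgue" for n unfolding \<rho>_def by measurable
    \<comment> \<open>The 2 counts the difference quotient and the derivative;
      \<open>2 powr (p - 1)\<close> comes from splitting the power of a sum.\<close>
    define d where "d = 2 * c * 2 powr (p - 1)"
    have d: "d \<ge> 0" using c by (simp add: d_def)
    let ?a = "\<lambda>n x. d * (\<bar>?w x\<bar> powr (2 - 1) + \<bar>?h n x\<bar> powr (2 - 1))"
    let ?b = "\<lambda>n x. d * (\<bar>?w x\<bar> powr (p - 1) + \<bar>?h n x\<bar> powr (p - 1))"
    have \<rho>b: "AE x in lebesgue. \<rho> n x \<le> ?a n x + ?b n x" for n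
      using D gr
    proof eventually_elim
      case (elim x)
      show ?case
      proof (cases "?h n x = 0")
        case True
        then show ?thesis using d by (simp add: \<rho>_def)
      next
        case False
        let ?M = "\<bar>?w x\<bar> + \<bar>?h n x\<bar>"
        have 2: "(2::real) powr (p - 1) \<ge> 1" using p by (intro ge_one_powr_ge_zero) auto
        have "\<bar>G x (?w x + ?h n x) - G x (?w x)\<bar> \<le> c * (?M + ?M powr (p - 1)) * \<bar>?w x + ?h n x - ?w x\<bar>"
          by (rule primitive_increment_bound[of "G x" "g x"]) (use elim c p in auto)
        then have 1: "\<bar>(G x (?w x + ?h n x) - G x (?w x)) / ?h n x\<bar> \<le> c * (?M + ?M powr (p - 1))"
          using False by (simp add: abs_divide divide_le_eq)
        have "\<bar>g x (?w x)\<bar> \<le> c * (\<bar>?w x\<bar> + \<bar>?w x\<bar> powr (p - 1))" using elim by blast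
        also have "\<dots> \<le> c * (?M + ?M powr (p - 1))"
          using p by (intro mult_left_mono add_mono powr_mono2 c) auto
        finally have 3: "\<bar>g x (?w x)\<bar> \<le> c * (?M + ?M powr (p - 1))" .
        have "\<rho> n x = \<bar>(G x (?w x + ?h n x) - G x (?w x)) / ?h n x - g x (?w x)\<bar>"
          using False by (simp add: \<rho>_def)
        also have "\<dots> \<le> c * (?M + ?M powr (p - 1)) + c * (?M + ?M powr (p - 1))"
          by (rule order_trans[OF abs_triangle_ineq4 add_mono[OF 1 3]])
        finally have "\<rho> n x \<le> 2 * c * (?M + ?M powr (p - 1))" by (simp only: mult_2 distrib_right)
        also have "\<dots> \<le> 2 * c * (2 powr (p - 1) * ?M + 2 powr (p - 1) * (\<bar>?w x\<bar> powr (p - 1) + \<bar>?h n x\<bar> powr (p - 1)))"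
        proof (intro mult_left_mono add_mono)
          show "?M \<le> 2 powr (p - 1) * ?M" using mult_right_mono[OF 2, of ?M] by simp
          show "?M powr (p - 1) \<le> 2 powr (p - 1) * (\<bar>?w x\<bar> powr (p - 1) + \<bar>?h n x\<bar> powr (p - 1))"
            using p by (intro powr_sum_le) auto
        qed (use c in auto)
        finally show ?thesis by (simp add: d_def algebra_simps)
      qed
    qed
    have \<rho>n: "\<rho> n x \<ge> 0" for n x by (simp add: \<rho>_def)
    have \<rho>0: "AE x in lebesgue. (\<lambda>n. \<rho> n x) \<longlonglongrightarrow> 0"
      using h0 D
    proof eventually_elim
      case (elim x)
      let ?\<phi> = "\<lambda>t. if t = 0 then 0 else \<bar>(G x (?w x + t) - G x (?w x)) / t - g x (?w x)\<bar>"
      have "((\<lambda>t. (G x (?w x + t) - G x (?w x)) / t) \<longlongrightarrow> g x (?w x)) (at 0)"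
        using elim(2) by (simp add: DERIV_def)
      then have "((\<lambda>t. \<bar>(G x (?w x + t) - G x (?w x)) / t - g x (?w x)\<bar>) \<longlongrightarrow> 0) (at 0)"
        by (simp add: LIM_zero tendsto_rabs_zero)
      then have "(?\<phi> \<longlongrightarrow> 0) (at 0)"
        by (rule Lim_transform_eventually) (auto simp: eventually_at_filter)
      then have "isCont ?\<phi> 0" by (simp add: isCont_def)
      from isCont_tendsto_compose[OF this elim(1)] show ?case by (simp add: \<rho>_def)
    qed
    txt \<open>\<open>\<rho>1\<close> is dominated in \<open>L\<^sup>2\<close> and \<open>\<rho>2\<close> in the dual space of \<open>L\<^sup>p\<close>.\<close>
    define \<rho>1 where "\<rho>1 = (\<lambda>n x. min (\<rho> n x) (?a n x))"
    define \<rho>2 where "\<rho>2 = (\<lambda>n x. \<rho> n x - \<rho>1 n x)"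
    have m1[measurable]: "\<rho>1 n \<in> borel_measurable lebesgue" for n unfolding \<rho>1_def by measurable
    have m2[measurable]: "\<rho>2 n \<in> borel_measurable lebesgue" for n unfolding \<rho>2_def by measurable
    have n1: "0 \<le> \<rho>1 n x" "\<rho>1 n x \<le> \<rho> n x" for n x using \<rho>n[of n x] d by (auto simp: \<rho>1_def)
    have l1: "AE x in lebesgue. (\<lambda>n. \<rho>1 n x) \<longlonglongrightarrow> 0"
      using \<rho>0
    proof eventually_elim
      case (elim x)
      show ?case by (rule tendsto_sandwich[OF _ _ tendsto_const elim]) (use n1 in auto)
    qed
    have l2: "AE x in lebesgue. (\<lambda>n. \<rho>2 n x) \<longlonglongrightarrow> 0"
      using \<rho>0 l1 unfolding \<rho>2_def by eventually_elim (use tendsto_diff in fastforce)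
    have R1: "\<And>n. integrable lebesgue (\<lambda>x. \<rho>1 n x * \<bar>k n x\<bar>)" "(\<lambda>n. \<integral>x. \<rho>1 n x * \<bar>k n x\<bar> \<partial>lebesgue) \<longlonglongrightarrow> 0"
    proof -
      have hyp: "AE x in lebesgue. 0 \<le> \<rho>1 n x" "AE x in lebesgue. \<rho>1 n x \<le> ?a n x" for n
        using n1 by (auto simp: \<rho>1_def)
      note * = superposition_remainder_tendsto[of 2 d ?w lebesgue \<rho>1 ?h k C2, OF _ d _ _ _ _ C2(2) C2(2)
          small[OF nY _ C2(3)] kr(1)[OF C2(2,3)] kr(2)[OF C2(2,3)] hyp l1]
      show "\<And>n. integrable lebesgue (\<lambda>x. \<rho>1 n x * \<bar>k n x\<bar>)" by (rule *(1)) auto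
      show "(\<lambda>n. \<integral>x. \<rho>1 n x * \<bar>k n x\<bar> \<partial>lebesgue) \<longlonglongrightarrow> 0" by (rule *(2)) auto
    qed
    have R2: "\<And>n. integrable lebesgue (\<lambda>x. \<rho>2 n x * \<bar>k n x\<bar>)" "(\<lambda>n. \<integral>x. \<rho>2 n x * \<bar>k n x\<bar> \<partial>lebesgue) \<longlonglongrightarrow> 0"
    proof -
      have hyp: "AE x in lebesgue. 0 \<le> \<rho>2 n x" "AE x in lebesgue. \<rho>2 n x \<le> ?b n x" for n
      proof -
        show "AE x in lebesgue. 0 \<le> \<rho>2 n x" using n1 by (simp add: \<rho>2_def)
        have b0: "0 \<le> ?b n x" for x using d by simp
        show "AE x in lebesgue. \<rho>2 n x \<le> ?b n x"
          using \<rho>b[of n]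
        proof eventually_elim
          case (elim x)
          then show ?case using b0[of x] unfolding \<rho>2_def \<rho>1_def by (simp only: min_def split: if_split) linarith
        qed
      qed
      note * = superposition_remainder_tendsto[of p d ?w lebesgue \<rho>2 ?h k Cp, OF p1 d _ _ _ _ Cp(2) Cp(2)
          small[OF nY _ Cp(3)] kr(1)[OF Cp(2,3)] kr(2)[OF Cp(2,3)] hyp l2]
      show "\<And>n. integrable lebesgue (\<lambda>x. \<rho>2 n x * \<bar>k n x\<bar>)" by (rule *(1)) (use p1 in auto)
      show "(\<lambda>n. \<integral>x. \<rho>2 n x * \<bar>k n x\<bar> \<partial>lebesgue) \<longlonglongrightarrow> 0" by (rule *(2)) (use p1 in auto)
    qed
    have sum: "\<rho> n x * \<bar>k n x\<bar> = \<rho>1 n x * \<bar>k n x\<bar> + \<rho>2 n x * \<bar>k n x\<bar>" for n x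
      by (simp add: \<rho>2_def algebra_simps)
    have iR: "integrable lebesgue (\<lambda>x. \<rho> n x * \<bar>k n x\<bar>)" for n
      unfolding sum using R1(1) R2(1) by (rule Bochner_Integration.integrable_add)
    have R: "(\<lambda>n. \<integral>x. \<rho> n x * \<bar>k n x\<bar> \<partial>lebesgue) \<longlonglongrightarrow> 0"
      unfolding sum using tendsto_add[OF R1(2) R2(2)] R1(1) R2(1) by simp
    have est: "\<bar>?F (u + Y n) - ?F u - ?D (Y n)\<bar> / norm (Y n) \<le> (\<integral>x. \<rho> n x * \<bar>k n x\<bar> \<partial>lebesgue)" for n
    proof -
      have "?F (u + Y n) - ?F u - ?D (Y n) =
          (\<integral>x. G x (H1_fun (u + Y n) x) - G x (?w x) - g x (?w x) * ?h n x \<partial>lebesgue)"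
        using iG[of "u + Y n"] iG[of u] ig[of u "Y n"] by simp
      then have "\<bar>?F (u + Y n) - ?F u - ?D (Y n)\<bar> \<le>
          (\<integral>x. \<bar>G x (H1_fun (u + Y n) x) - G x (?w x) - g x (?w x) * ?h n x\<bar> \<partial>lebesgue)"
        using integral_norm_bound[of lebesgue "\<lambda>x. G x (H1_fun (u + Y n) x) - G x (?w x) - g x (?w x) * ?h n x"] by simp
      also have "\<dots> = (\<integral>x. norm (Y n) * (\<rho> n x * \<bar>k n x\<bar>) \<partial>lebesgue)"
      proof (rule integral_cong_AE)
        show "AE x in lebesgue. \<bar>G x (H1_fun (u + Y n) x) - G x (?w x) - g x (?w x) * ?h n x\<bar> = norm (Y n) * (\<rho> n x * \<bar>k n x\<bar>)"
          using H1_fun_add[of u "Y n"]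
        proof eventually_elim
          case (elim x)
          show ?case
          proof (cases "?h n x = 0")
            case True
            then show ?thesis by (simp add: elim \<rho>_def)
          next
            case False
            have "norm (Y n) * (\<rho> n x * \<bar>k n x\<bar>) = \<bar>?h n x\<bar> * \<rho> n x"
              using Y0[of n] by (simp add: k_def abs_divide)
            also have "\<dots> = \<bar>?h n x * ((G x (?w x + ?h n x) - G x (?w x)) / ?h n x - g x (?w x))\<bar>"
              using False by (simp add: \<rho>_def abs_mult)
            also have "?h n x * ((G x (?w x + ?h n x) - G x (?w x)) / ?h n x - g x (?w x)) =
                G x (?w x + ?h n x) - G x (?w x) - g x (?w x) * ?h n x"
              using False by (simp add: field_simps)
            finally show ?thesis by (simp add: elim)
          qed
        qed
      qed measurable
      also have "\<dots> = norm (Y n) * (\<integral>x. \<rho> n x * \<bar>k n x\<bar> \<partial>lebesgue)" by simp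
      finally show ?thesis using Y0[of n] by (simp add: divide_le_eq mult.commute)
    qed
    have "(\<lambda>n. \<bar>?F (u + Y n) - ?F u - ?D (Y n)\<bar> / norm (Y n)) \<longlonglongrightarrow> 0"
      by (rule tendsto_sandwich[OF _ _ tendsto_const R]) (use est in auto)
    then show "\<exists>r. (\<lambda>n. \<bar>?F (u + X (r n)) - ?F u - ?D (X (r n))\<bar> / norm (X (r n))) \<longlonglongrightarrow> 0"
      unfolding Y_def by blast
  qed
qed

section \<open>Measurability of superpositions and of the primitive\<close>

lemma borel_measurable_lebesgue_cong_AE:
  fixes f g :: "'a::euclidean_space \<Rightarrow> 'b::topological_space"
  assumes f: "f \<in> borel_measurable lebesgue" and eq: "AE x in lebesgue. f x = g x"
  shows "g \<in> borel_measurable lebesgue"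
proof (rule measurableI)
  fix A :: "'b set" assume "A \<in> sets borel"
  then have A: "f -` A \<in> sets lebesgue" using measurable_sets[OF f] by simp
  have "AE x in lebesgue. x \<in> f -` A \<longleftrightarrow> x \<in> g -` A" using eq by eventually_elim simp
  from completion.in_sets_AE[OF this A] show "g -` A \<inter> space lebesgue \<in> sets lebesgue" by simp
qed simp

text \<open>Measurability for the completed product measure controls the sections at almost every
  \<open>u\<close> only. Such \<open>u\<close> are dense, and continuity in \<open>u\<close> passes
  to the remaining ones by limits.\<close>

lemma caratheodory_section_measurable:
  fixes f :: "'a::euclidean_space \<Rightarrow> real \<Rightarrow> real"
  assumes f: "(\<lambda>(x, u). f x u) \<in> borel_measurable lebesgue"
    and cont: "AE x in lebesgue. continuous_on UNIV (f x)"
  shows "(\<lambda>x. f x u) \<in> borel_measurable lebesgue"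
proof -
  obtain f' where f': "f' \<in> borel_measurable lborel" and "AE z in lborel. (\<lambda>(x, u). f x u) z = f' z"
    using completion_ex_borel_measurable_real[OF f] by blast
  then obtain N where N: "{z. (\<lambda>(x, u). f x u) z \<noteq> f' z} \<subseteq> N" "N \<in> null_sets lborel"
    by (auto elim!: AE_E simp: null_sets_def)
  have f'm: "f' \<in> borel_measurable (borel \<Otimes>\<^sub>M borel)" using f' by (simp add: borel_prod)
  have Nm: "N \<in> sets (lborel \<Otimes>\<^sub>M lborel)" using N(2) unfolding lborel_prod by auto
  have "AE z in (lborel \<Otimes>\<^sub>M lborel). z \<notin> N"
    using N(2) unfolding lborel_prod by (rule AE_not_in)
  from lborel_pair.AE_pair[OF this] have "AE x in lborel. AE u in lborel. (x, u) \<notin> N" .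
  moreover have "{z \<in> space (lborel \<Otimes>\<^sub>M lborel). (fst z, snd z) \<notin> N} \<in> sets (lborel \<Otimes>\<^sub>M lborel)"
    using sets.compl_sets[OF Nm] by (simp add: set_diff_eq)
  ultimately have "AE u in lborel. AE x in lborel. (x, u) \<notin> N"
    by (simp only: lborel_pair.AE_commute)
  then have dense: "AE u in lborel. (\<lambda>x. f x u) \<in> borel_measurable lebesgue"
  proof eventually_elim
    case (elim u)
    show ?case
    proof (rule borel_measurable_lebesgue_cong_AE)
      show "(\<lambda>x. f' (x, u)) \<in> borel_measurable lebesgue"
        by (rule measurable_completion) (use f'm in measurable)
      have "AE x in lebesgue. (x, u) \<notin> N" using elim by (rule AE_completion)
      then show "AE x in lebesgue. f' (x, u) = f x u" by eventually_elim (use N(1) in force)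
    qed
  qed
  \<comment> \<open>An interval around \<open>u\<close> has positive measure, hence is not contained
    in the null set of bad parameters.\<close>
  have "\<exists>v. \<bar>v - u\<bar> < 1 / real (Suc n) \<and> (\<lambda>x. f x v) \<in> borel_measurable lebesgue" for n
  proof (rule ccontr)
    let ?I = "{u - 1 / real (Suc n)<..<u + 1 / real (Suc n)}"
    assume "\<not> ?thesis"
    then have no: "v \<in> ?I \<Longrightarrow> (\<lambda>x. f x v) \<notin> borel_measurable lebesgue" for v
      by (auto simp: abs_less_iff algebra_simps)
    have "AE v in lborel. v \<notin> ?I" using dense by eventually_elim (use no in blast)
    then have "emeasure lborel ?I = 0" by (subst (asm) AE_iff_measurable[of ?I]) auto
    then show False by simp
  qed
  then obtain v where v: "\<And>n. \<bar>v n - u\<bar> < 1 / real (Suc n)" "\<And>n. (\<lambda>x. f x (v n)) \<in> borel_measurable lebesgue"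
    by metis
  have "v \<longlonglongrightarrow> u"
  proof (rule LIM_zero_cancel, rule Lim_null_comparison)
    show "\<forall>\<^sub>F n in sequentially. norm (v n - u) \<le> 1 / real (Suc n)"
      using less_imp_le[OF v(1)] by (intro always_eventually allI) (simp only: real_norm_def)
    show "(\<lambda>n. 1 / real (Suc n)) \<longlonglongrightarrow> 0" by (rule LIMSEQ_Suc[OF lim_1_over_n])
  qed
  define L where "L = (\<lambda>x. lim (\<lambda>n. f x (v n)))"
  have "L \<in> borel_measurable lebesgue" unfolding L_def by (rule borel_measurable_lim_metric) (rule v(2))
  moreover have "AE x in lebesgue. L x = f x u"
    using cont
  proof eventually_elim
    case (elim x)
    then have "isCont (f x) u" by (simp add: continuous_on_eq_continuous_at)
    from isCont_tendsto_compose[OF this \<open>v \<longlonglongrightarrow> u\<close>] show ?case unfolding L_def by (rule limI)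
  qed
  ultimately show ?thesis by (rule borel_measurable_lebesgue_cong_AE)
qed

text \<open>Rounding \<open>u\<close> down to the grid of mesh 1/(n+1) leaves countably many
  sections; continuity in \<open>u\<close> recovers \<open>f\<close> as the mesh tends to 0.\<close>

lemma caratheodory_joint_measurable:
  fixes f :: "'a \<Rightarrow> real \<Rightarrow> real"
  assumes m: "\<And>u. (\<lambda>x. f x u) \<in> borel_measurable M" and cont: "\<And>x. continuous_on UNIV (f x)"
  shows "(\<lambda>(x, u). f x u) \<in> borel_measurable (M \<Otimes>\<^sub>M borel)"
proof (rule borel_measurable_LIMSEQ_real)
  let ?s = "\<lambda>n z. f (fst z) (real_of_int \<lfloor>real (Suc n) * snd z\<rfloor> / real (Suc n))"
  show "?s n \<in> borel_measurable (M \<Otimes>\<^sub>M borel)" for n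
  proof (rule measurable_compose_countable[of "\<lambda>i z. f (fst z) (real_of_int i / real (Suc n))" _ _ "\<lambda>z. \<lfloor>real (Suc n) * snd z\<rfloor>"])
    show "(\<lambda>z. f (fst z) (real_of_int i / real (Suc n))) \<in> borel_measurable (M \<Otimes>\<^sub>M borel)" for i
      by (rule measurable_compose[OF measurable_fst m])
    show "(\<lambda>z. \<lfloor>real (Suc n) * snd z\<rfloor>) \<in> measurable (M \<Otimes>\<^sub>M borel) (count_space UNIV)"
      by measurable
  qed
  fix z :: "'a \<times> real"
  have "(\<lambda>n. real_of_int \<lfloor>real (Suc n) * snd z\<rfloor> / real (Suc n)) \<longlonglongrightarrow> snd z"
  proof (rule LIM_zero_cancel, rule Lim_null_comparison)
    show "\<forall>\<^sub>F n in sequentially. norm (real_of_int \<lfloor>real (Suc n) * snd z\<rfloor> / real (Suc n) - snd z) \<le> 1 / real (Suc n)"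
    proof (intro always_eventually allI)
      fix n
      let ?y = "real (Suc n) * snd z"
      have "real_of_int \<lfloor>?y\<rfloor> / real (Suc n) - snd z = (real_of_int \<lfloor>?y\<rfloor> - ?y) / real (Suc n)"
        by (simp add: diff_divide_distrib)
      moreover have "\<bar>real_of_int \<lfloor>?y\<rfloor> - ?y\<bar> \<le> 1" by linarith
      ultimately show "norm (real_of_int \<lfloor>?y\<rfloor> / real (Suc n) - snd z) \<le> 1 / real (Suc n)"
        by (simp only: real_norm_def abs_divide) (simp add: divide_right_mono)
    qed
    show "(\<lambda>n. 1 / real (Suc n)) \<longlonglongrightarrow> 0" by (rule LIMSEQ_Suc[OF lim_1_over_n])
  qed
  then show "(\<lambda>n. ?s n z) \<longlonglongrightarrow> (\<lambda>(x, u). f x u) z"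
    using cont[of "fst z"] isCont_tendsto_compose[of "snd z" "f (fst z)"]
    by (simp add: continuous_on_eq_continuous_at case_prod_beta)
qed

lemma caratheodory_superposition_measurable:
  fixes f :: "real^'n::finite \<Rightarrow> real \<Rightarrow> real"
  assumes f: "(\<lambda>(x, u). f x u) \<in> borel_measurable lebesgue"
    and cont: "AE x in lebesgue. continuous_on UNIV (f x)"
    and w: "w \<in> borel_measurable lebesgue"
  shows "(\<lambda>x. f x (w x)) \<in> borel_measurable lebesgue"
    and "(\<lambda>x. primitive f x (w x)) \<in> borel_measurable lebesgue"
proof -
  obtain N where N: "{x \<in> space lebesgue. \<not> continuous_on UNIV (f x)} \<subseteq> N" "N \<in> null_sets lebesgue"
    using cont by (auto elim!: AE_E simp: null_sets_def)
  have Nm[measurable]: "N \<in> sets lebesgue" using N(2) by auto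
  have ae: "AE x in lebesgue. x \<notin> N" using N(2) by (rule AE_not_in)
  \<comment> \<open>Zero on the exceptional null set, so that continuity in \<open>u\<close> holds
    at every \<open>x\<close> as the joint measurability lemma demands.\<close>
  define g where "g = (\<lambda>x u. indicator (- N) x * f x u)"
  have gx: "g x = f x" if "x \<notin> N" for x using that by (simp add: g_def)
  have [measurable]: "(\<lambda>(x, u). g x u) \<in> borel_measurable (lebesgue \<Otimes>\<^sub>M borel)"
  proof (rule caratheodory_joint_measurable)
    fix u
    have [measurable]: "(\<lambda>x. f x u) \<in> borel_measurable lebesgue" by (rule caratheodory_section_measurable[OF f cont])
    show "(\<lambda>x. g x u) \<in> borel_measurable lebesgue" unfolding g_def by measurable
  next
    fix x
    show "continuous_on UNIV (g x)"
      using N(1) by (cases "x \<in> N") (auto simp: g_def)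
  qed
  note w[measurable]
  show "(\<lambda>x. f x (w x)) \<in> borel_measurable lebesgue"
  proof (rule borel_measurable_lebesgue_cong_AE)
    show "(\<lambda>x. g x (w x)) \<in> borel_measurable lebesgue" by measurable
    show "AE x in lebesgue. g x (w x) = f x (w x)" using ae by eventually_elim (simp add: gx)
  qed
  show "(\<lambda>x. primitive f x (w x)) \<in> borel_measurable lebesgue"
  proof (rule borel_measurable_lebesgue_cong_AE)
    \<comment> \<open>The signed indicator of the oriented interval from 0 to u. It turns the
      variable endpoint into part of the integrand, so measurability of parameter integrals
      applies.\<close>
    let ?c = "\<lambda>u s::real. (if 0 < s \<and> s < u then 1 else 0) - (if u < s \<and> s < 0 then 1 else 0) :: real"
    show "(\<lambda>x. \<integral>s. ?c (w x) s * g x s \<partial>lborel) \<in> borel_measurable lebesgue"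
      by measurable
    show "AE x in lebesgue. (\<integral>s. ?c (w x) s * g x s \<partial>lborel) = primitive f x (w x)"
      using ae
    proof eventually_elim
      case (elim x)
      show ?case
      proof (cases "0 \<le> w x")
        case True
        have "?c (w x) s * g x s = indicator {0<..<w x} s *\<^sub>R f x s" for s
          using True by (auto simp: gx[OF elim])
        then show ?thesis
          using True by (simp add: primitive_def interval_lebesgue_integral_def set_lebesgue_integral_def)
      next
        case False
        have "?c (w x) s * g x s = - (indicator {w x<..<0} s *\<^sub>R f x s)" for s
          using False by (auto simp: gx[OF elim])
        then show ?thesis
          using False by (simp add: primitive_def interval_lebesgue_integral_def set_lebesgue_integral_def)
      qed
    qed
  qed
qed

lemma primitive_has_derivative:
  assumes "continuous_on UNIV (f x)"
  shows "(primitive f x has_real_derivative f x u) (at u)"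
proof -
  let ?a = "- \<bar>u\<bar> - 1" and ?b = "\<bar>u\<bar> + 1"
  have "((\<lambda>u. LBINT s=ereal 0..ereal u. f x s) has_vector_derivative f x u) (at u within {?a..?b})"
    by (rule interval_integral_FTC2) (use assms in \<open>auto intro: continuous_on_subset\<close>)
  moreover have "at u within {?a..?b} = at u"
    by (rule at_within_interior) auto
  ultimately show ?thesis
    by (simp add: primitive_def[abs_def] has_real_derivative_iff_has_vector_derivative)
qed

lemma primitive_0: "primitive f x 0 = 0"
  by (simp add: primitive_def)

section \<open>Nonexistence of ground states\<close>

lemma abs_powr_has_derivative:
  fixes q u :: real
  assumes q: "q > 1"
  shows "((\<lambda>u. \<bar>u\<bar> powr q) has_real_derivative q * (\<bar>u\<bar> powr (q - 1) * sgn u)) (at u)"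
proof -
  consider "u > 0" | "u < 0" | "u = 0" by linarith
  then show ?thesis
  proof cases
    case 1
    have "((\<lambda>u. u powr q) has_real_derivative q * u powr (q - 1)) (at u)"
      using 1 by (auto intro!: derivative_eq_intros)
    then have "((\<lambda>u. \<bar>u\<bar> powr q) has_real_derivative q * u powr (q - 1)) (at u)"
      by (rule has_field_derivative_transform_within_open[of _ _ _ "{0<..}"]) (use 1 in auto)
    then show ?thesis using 1 by simp
  next
    case 2
    have "((\<lambda>u. (- u) powr q) has_real_derivative - (q * (- u) powr (q - 1))) (at u)"
      using 2 by (auto intro!: derivative_eq_intros)
    then have "((\<lambda>u. \<bar>u\<bar> powr q) has_real_derivative - (q * (- u) powr (q - 1))) (at u)"
      by (rule has_field_derivative_transform_within_open[of _ _ _ "{..<0}"]) (use 2 in auto)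
    then show ?thesis using 2 by simp
  next
    case 3
    have "((\<lambda>h::real. \<bar>h\<bar> powr q / h) \<longlongrightarrow> 0) (at 0)"
    proof (rule Lim_null_comparison)
      have "((\<lambda>h::real. \<bar>h\<bar> powr (q - 1)) \<longlongrightarrow> \<bar>0\<bar> powr (q - 1)) (at 0)"
        by (rule tendsto_powr'[OF tendsto_rabs[OF tendsto_ident_at] tendsto_const]) (use q in auto)
      then show "((\<lambda>h::real. \<bar>h\<bar> powr (q - 1)) \<longlongrightarrow> 0) (at 0)" by simp
      show "\<forall>\<^sub>F h in at 0. norm (\<bar>h\<bar> powr q / h) \<le> \<bar>h\<bar> powr (q - 1)"
        by (auto simp: eventually_at_filter powr_diff abs_divide)
    qed
    then show ?thesis using 3 by (simp add: DERIV_def)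
  qed
qed

text \<open>The weighted inequality of arithmetic and geometric mean for t^q and 1 with weights 2/q
  and 1 - 2/q. It compares the quadratic part of the energy on a ray with the factor (t^q - 1)/q
  attached to the nonlinear part.\<close>

lemma powr_square_le:
  fixes t q :: real
  assumes t: "t > 0" and q: "q \<ge> 2"
  shows "(t\<^sup>2 - 1) / 2 \<le> (t powr q - 1) / q"
proof -
  have "(t powr q) powr (2 / q) * 1 powr (1 - 2 / q) \<le> 2 / q * t powr q + (1 - 2 / q) * 1"
    by (rule Youngs_inequality_0) (use t q in \<open>auto simp: field_simps\<close>)
  then have "t\<^sup>2 \<le> 2 / q * t powr q + (1 - 2 / q)" using t q by (simp add: powr_powr)
  then have "q * t\<^sup>2 \<le> q * (2 / q * t powr q + (1 - 2 / q))" using q by (intro mult_left_mono) auto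
  also have "\<dots> = 2 * t powr q + q - 2" using q by (simp add: distrib_left right_diff_distrib)
  finally show ?thesis using q by (simp add: field_simps)
qed

lemma bounded_bilinear_schrodinger_form:
  assumes V: "L_infty V"
  shows "bounded_bilinear (schrodinger_form V)"
proof -
  obtain K where "\<And>u v. \<bar>schrodinger_form V u v\<bar> \<le> K * (norm u * norm v)"
    using schrodinger_form_bounded[OF V] by blast
  then show ?thesis
    by unfold_locales
      (auto simp: schrodinger_form_add_left[OF V] schrodinger_form_add_right[OF V]
        schrodinger_form_scaleR_left[OF V] schrodinger_form_scaleR_right mult_ac intro!: exI[of _ K])
qed

lemma schrodinger_form_potential_add:
  assumes "L_infty V" "L_infty W"
  shows "schrodinger_form (\<lambda>x. V x + W x) u v = schrodinger_form V u v + inner (mult_L2 W (H1_L2 u)) (H1_L2 v)"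
proof -
  have "mult_L2 (\<lambda>x. V x + W x) (H1_L2 u) = mult_L2 V (H1_L2 u) + mult_L2 W (H1_L2 u)"
    using abs_L2_add[OF square_integrable_mult_L_infty[OF assms(1)] square_integrable_mult_L_infty[OF assms(2)]]
    by (simp add: mult_L2_def rep_L2_square_integrable distrib_right)
  then show ?thesis by (simp add: schrodinger_form_def inner_add_left)
qed

lemma translate_H1_scaleR: "translate_H1 z (c *\<^sub>R u) = c *\<^sub>R translate_H1 z u"
  by (rule H1_eqI) (simp_all add: vec_eq_iff H1_L2_translate H1_partial_translate H1_L2_scaleR H1_partial_scaleR translate_L2_scaleR)

lemma H1_fun_translate: "AE x in lebesgue. H1_fun (translate_H1 z u) x = H1_fun u (x + z)"
  unfolding H1_fun_eq H1_L2_translate by (rule rep_translate_L2)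

lemma translate_H1_eq_0_iff: "translate_H1 z u = 0 \<longleftrightarrow> u = 0"
  by (metis H1_L2_eq_0_iff H1_L2_translate norm_eq_zero norm_translate_L2)

section \<open>Growth of the nonlinearity and differentiability of the energy\<close>

locale nls_problem =
  fixes V Vper Vloc \<Gamma> :: "real^'n::finite \<Rightarrow> real"
    and f :: "real^'n \<Rightarrow> real \<Rightarrow> real"
    and p q :: real
  assumes q: "2 \<le> q" and qp: "q < p" and p: "ereal p < crit_exp CARD('n)"
    and V: "cond_V V Vper Vloc"
    and \<Gamma>: "cond_Gamma \<Gamma>"
    and F1: "cond_F1 f p" and F2: "cond_F2 f" and F3: "cond_F3 f q" and F4: "cond_F4 f q"
    and spectrum_pos: "(INF \<mu>\<in>spectrum (schrodinger Vper). ereal \<mu>) > 0"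
    and Vloc_pos: "AE x in lebesgue. Vloc x > 0"
begin

definition G :: "real^'n \<Rightarrow> real \<Rightarrow> real" where
  "G x u = primitive f x u - 1 / q * \<Gamma> x * \<bar>u\<bar> powr q"

text \<open>The right-hand side of the equation; |u|^(q-2) u is written with \<open>sgn\<close>,
  which gives the value 0 at u = 0 for every q including 2.\<close>

definition g :: "real^'n \<Rightarrow> real \<Rightarrow> real" where
  "g x u = f x u - \<Gamma> x * (\<bar>u\<bar> powr (q - 1) * sgn u)"

definition J :: "'n H1 \<Rightarrow> real" where
  "J = energy V \<Gamma> f q"

lemma Vper: "L_infty Vper" "periodic_AE Vper"
  and Vloc: "L_infty Vloc" "vanishes_at_infinity Vloc"
  and V_eq: "V = (\<lambda>x. Vper x + Vloc x)"
  using V by (auto simp: cond_V_def)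

lemma V_L_infty: "L_infty V"
proof -
  obtain C D where "AE x in lebesgue. \<bar>Vper x\<bar> \<le> C" "AE x in lebesgue. \<bar>Vloc x\<bar> \<le> D"
    using Vper Vloc by (auto simp: L_infty_def)
  then have "AE x in lebesgue. \<bar>Vper x + Vloc x\<bar> \<le> C + D" by eventually_elim linarith
  then show ?thesis using Vper Vloc by (auto simp: V_eq L_infty_def)
qed

lemma p2: "p > 2" "2 \<le> p" "1 < p"
  using q qp by auto

text \<open>Below the radius \<open>d\<close> supplied by (F2) the linear term suffices. Beyond it
  the constant 1 in (F1) is at most (|u|/d)^(p-1), which explains \<open>C\<close>.\<close>

lemma f_growth:
  assumes "\<epsilon> > 0"
  obtains C where "C \<ge> 0" "\<And>x u. \<bar>f x u\<bar> \<le> \<epsilon> * \<bar>u\<bar> + C * \<bar>u\<bar> powr (p - 1)"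
proof -
  obtain c where c: "c > 0" "\<And>x u. \<bar>f x u\<bar> \<le> c * (1 + \<bar>u\<bar> powr (p - 1))"
    using F1 by (auto simp: cond_F1_def)
  have "\<forall>\<^sub>F u in nhds 0. \<forall>x. \<bar>f x u\<bar> \<le> \<epsilon> * \<bar>u\<bar>" using F2 assms by (simp add: cond_F2_def)
  then obtain d where d: "d > 0" "\<And>u x. \<bar>u\<bar> < d \<Longrightarrow> \<bar>f x u\<bar> \<le> \<epsilon> * \<bar>u\<bar>"
    by (auto simp: eventually_nhds_metric dist_real_def)
  define C where "C = c * (1 / d powr (p - 1) + 1)"
  have C: "C \<ge> 0" using c(1) by (simp add: C_def)
  have "\<bar>f x u\<bar> \<le> \<epsilon> * \<bar>u\<bar> + C * \<bar>u\<bar> powr (p - 1)" for x u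
  proof (cases "\<bar>u\<bar> < d")
    case True
    then have "\<bar>f x u\<bar> \<le> \<epsilon> * \<bar>u\<bar>" by (rule d(2))
    also have "\<dots> \<le> \<epsilon> * \<bar>u\<bar> + C * \<bar>u\<bar> powr (p - 1)" using C by simp
    finally show ?thesis .
  next
    case False
    then have "d powr (p - 1) \<le> \<bar>u\<bar> powr (p - 1)" using d(1) p2 by (intro powr_mono2) auto
    then have "1 \<le> 1 / d powr (p - 1) * \<bar>u\<bar> powr (p - 1)" using d(1) by (simp add: field_simps)
    then have "1 + \<bar>u\<bar> powr (p - 1) \<le> (1 / d powr (p - 1) + 1) * \<bar>u\<bar> powr (p - 1)"
      by (simp add: distrib_right)
    then have "c * (1 + \<bar>u\<bar> powr (p - 1)) \<le> C * \<bar>u\<bar> powr (p - 1)"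
      using c(1) by (simp add: C_def mult.assoc)
    moreover have "0 \<le> \<epsilon> * \<bar>u\<bar>" using assms by simp
    ultimately show ?thesis using c(2)[of x u] by linarith
  qed
  with C show ?thesis by (rule that)
qed

lemma f_continuous: "AE x in lebesgue. continuous_on UNIV (f x)"
  using F1 by (simp add: cond_F1_def)

lemma f_measurable: "(\<lambda>(x, u). f x u) \<in> borel_measurable lebesgue"
  using F1 by (simp add: cond_F1_def)

lemma \<Gamma>_measurable [measurable]: "\<Gamma> \<in> borel_measurable lebesgue"
  using \<Gamma> by (simp add: cond_Gamma_def L_infty_def)

lemma \<Gamma>_bound: obtains D where "D \<ge> 0" "AE x in lebesgue. 0 \<le> \<Gamma> x \<and> \<Gamma> x \<le> D"
proof -
  obtain D where "AE x in lebesgue. \<bar>\<Gamma> x\<bar> \<le> D" "AE x in lebesgue. 0 \<le> \<Gamma> x"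
    using \<Gamma> by (auto simp: cond_Gamma_def L_infty_def)
  then have "AE x in lebesgue. 0 \<le> \<Gamma> x \<and> \<Gamma> x \<le> \<bar>D\<bar>" by eventually_elim auto
  then show ?thesis using that[of "\<bar>D\<bar>"] by simp
qed

lemma g_measurable: "w \<in> borel_measurable lebesgue \<Longrightarrow> (\<lambda>x. g x (w x)) \<in> borel_measurable lebesgue"
proof -
  assume w[measurable]: "w \<in> borel_measurable lebesgue"
  note [measurable] = caratheodory_superposition_measurable(1)[OF f_measurable f_continuous w]
  show ?thesis unfolding g_def by measurable
qed

lemma G_measurable: "w \<in> borel_measurable lebesgue \<Longrightarrow> (\<lambda>x. G x (w x)) \<in> borel_measurable lebesgue"
proof -
  assume w[measurable]: "w \<in> borel_measurable lebesgue"
  note [measurable] = caratheodory_superposition_measurable(2)[OF f_measurable f_continuous w]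
  show ?thesis unfolding G_def by measurable
qed

lemma G_has_derivative:
  assumes "continuous_on UNIV (f x)"
  shows "(G x has_real_derivative g x u) (at u)"
proof -
  have "((\<lambda>u. primitive f x u - 1 / q * \<Gamma> x * \<bar>u\<bar> powr q) has_real_derivative
      f x u - 1 / q * \<Gamma> x * (q * (\<bar>u\<bar> powr (q - 1) * sgn u))) (at u)"
    using q by (intro DERIV_diff primitive_has_derivative[of f x, OF assms] DERIV_cmult abs_powr_has_derivative) simp
  then show ?thesis using q by (simp add: G_def[abs_def] g_def)
qed

lemma g_growth:
  obtains c where "c \<ge> 0" "AE x in lebesgue. \<forall>u. \<bar>g x u\<bar> \<le> c * (\<bar>u\<bar> + \<bar>u\<bar> powr (p - 1))"
proof -
  obtain C where C: "C \<ge> 0" "\<And>x u. \<bar>f x u\<bar> \<le> 1 * \<bar>u\<bar> + C * \<bar>u\<bar> powr (p - 1)"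
    using f_growth[of 1] by auto
  obtain D where D: "D \<ge> 0" "AE x in lebesgue. 0 \<le> \<Gamma> x \<and> \<Gamma> x \<le> D" by (rule \<Gamma>_bound)
  have "AE x in lebesgue. \<forall>u. \<bar>g x u\<bar> \<le> (1 + C + D) * (\<bar>u\<bar> + \<bar>u\<bar> powr (p - 1))"
    using D(2)
  proof eventually_elim
    case (elim x)
    show ?case
    proof
      fix u
      \<comment> \<open>q - 1 lies between 1 and p - 1, so the first summand dominates for
        \<open>\<bar>u\<bar> \<le> 1\<close> and the second beyond.\<close>
      have m: "\<bar>u\<bar> powr (q - 1) \<le> \<bar>u\<bar> + \<bar>u\<bar> powr (p - 1)"
      proof (cases "\<bar>u\<bar> \<le> 1")
        case True
        then have "\<bar>u\<bar> powr (q - 1) \<le> \<bar>u\<bar> powr 1" using q by (intro powr_mono') auto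
        then show ?thesis by (simp add: add_increasing2)
      next
        case False
        then have "\<bar>u\<bar> powr (q - 1) \<le> \<bar>u\<bar> powr (p - 1)" using qp by (intro powr_mono) auto
        then show ?thesis by simp
      qed
      have "\<bar>\<Gamma> x * (\<bar>u\<bar> powr (q - 1) * sgn u)\<bar> \<le> D * (\<bar>u\<bar> + \<bar>u\<bar> powr (p - 1))"
      proof -
        have "\<bar>\<Gamma> x * (\<bar>u\<bar> powr (q - 1) * sgn u)\<bar> \<le> \<Gamma> x * \<bar>u\<bar> powr (q - 1)"
          using elim by (cases "u = 0") (auto simp: abs_mult)
        also have "\<dots> \<le> D * (\<bar>u\<bar> + \<bar>u\<bar> powr (p - 1))"
          using elim m D(1) by (intro mult_mono) auto
        finally show ?thesis .
      qed
      moreover have "\<bar>f x u\<bar> \<le> (1 + C) * (\<bar>u\<bar> + \<bar>u\<bar> powr (p - 1))"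
      proof -
        have "0 \<le> C * \<bar>u\<bar>" using C(1) by simp
        moreover have "0 \<le> \<bar>u\<bar> powr (p - 1)" by simp
        ultimately show ?thesis using C(2)[of x u] unfolding distrib_left distrib_right by linarith
      qed
      ultimately show "\<bar>g x u\<bar> \<le> (1 + C + D) * (\<bar>u\<bar> + \<bar>u\<bar> powr (p - 1))"
        unfolding g_def distrib_right[of "1 + C" D] by linarith
    qed
  qed
  then show ?thesis using that[of "1 + C + D"] C D by simp
qed

lemma G_integrable: "integrable lebesgue (\<lambda>x. G x (H1_fun u x))"
  and g_integrable: "integrable lebesgue (\<lambda>x. g x (H1_fun u x) * H1_fun v x)"
  and G_functional_has_derivative:
    "((\<lambda>u. \<integral>x. G x (H1_fun u x) \<partial>lebesgue) has_derivative (\<lambda>v. \<integral>x. g x (H1_fun u x) * H1_fun v x \<partial>lebesgue)) (at u)"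
proof -
  obtain c where c: "c \<ge> 0" "AE x in lebesgue. \<forall>u. \<bar>g x u\<bar> \<le> c * (\<bar>u\<bar> + \<bar>u\<bar> powr (p - 1))"
    by (rule g_growth)
  have D: "AE x in lebesgue. \<forall>u. (G x has_real_derivative g x u) (at u)"
    using f_continuous by eventually_elim (blast intro: G_has_derivative)
  have G0: "AE x in lebesgue. G x 0 = 0"
    using q by (simp add: G_def primitive_0)
  note * = superposition_has_derivative[where g = g and G = G, OF p2(2) p g_measurable G_measurable D G0 c(2,1)]
  show "integrable lebesgue (\<lambda>x. G x (H1_fun u x))" by (rule *(1))
  show "integrable lebesgue (\<lambda>x. g x (H1_fun u x) * H1_fun v x)" by (rule *(2))
  show "((\<lambda>u. \<integral>x. G x (H1_fun u x) \<partial>lebesgue) has_derivative (\<lambda>v. \<integral>x. g x (H1_fun u x) * H1_fun v x \<partial>lebesgue)) (at u)"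
    by (rule *(3))
qed

lemma powr_integrable:
  assumes "2 \<le> s" "s \<le> p"
  shows "integrable lebesgue (\<lambda>x. \<bar>H1_fun (u :: 'n H1) x\<bar> powr s)"
proof -
  have "ereal s \<le> ereal p" using assms(2) by simp
  then have "ereal s < crit_exp CARD('n)" using p by (rule le_less_trans)
  from sobolev_H1[OF assms(1) this] show ?thesis by blast
qed

section \<open>The Nehari manifold and the energy along rays\<close>

lemma J_eq: "J u = schrodinger_form V u u / 2 - (\<integral>x. G x (H1_fun u x) \<partial>lebesgue)"
  unfolding J_def energy_def schrodinger_form_quadratic[OF V_L_infty] G_def by simp

lemma J_has_derivative:
  "(J has_derivative (\<lambda>v. schrodinger_form V u v - (\<integral>x. g x (H1_fun u x) * H1_fun v x \<partial>lebesgue))) (at u)"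
proof -
  interpret bounded_bilinear "schrodinger_form V" by (rule bounded_bilinear_schrodinger_form[OF V_L_infty])
  have "((\<lambda>u. 1 / 2 * schrodinger_form V u u) has_derivative
      (\<lambda>v. 1 / 2 * (schrodinger_form V u v + schrodinger_form V v u))) (at u)"
    by (rule has_derivative_mult_right[OF FDERIV[OF has_derivative_ident has_derivative_ident]])
  moreover have "(\<lambda>v. 1 / 2 * (schrodinger_form V u v + schrodinger_form V v u)) = schrodinger_form V u"
    using schrodinger_form_commute[OF V_L_infty, of _ u] by (simp add: fun_eq_iff)
  ultimately have "((\<lambda>u. schrodinger_form V u u / 2) has_derivative schrodinger_form V u) (at u)"
    by simp
  from has_derivative_diff[OF this G_functional_has_derivative[of u]]
  show ?thesis by (simp add: J_eq[abs_def])
qed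

lemma nehari_iff:
  "u \<in> nehari V \<Gamma> f q \<longleftrightarrow> u \<noteq> 0 \<and> schrodinger_form V u u = (\<integral>x. g x (H1_fun u x) * H1_fun u x \<partial>lebesgue)"
proof -
  have "frechet_derivative (energy V \<Gamma> f q) (at u) =
      (\<lambda>v. schrodinger_form V u v - (\<integral>x. g x (H1_fun u x) * H1_fun v x \<partial>lebesgue))"
    using frechet_derivative_at[OF J_has_derivative[of u]] by (simp add: J_def)
  then show ?thesis by (simp add: nehari_def)
qed

lemma J_scaleR: "J (t *\<^sub>R u) = t\<^sup>2 * schrodinger_form V u u / 2 - (\<integral>x. G x (t * H1_fun u x) \<partial>lebesgue)"
  and G_scaleR_integrable: "integrable lebesgue (\<lambda>x. G x (t * H1_fun u x))"
proof -
  have ae: "AE x in lebesgue. G x (H1_fun (t *\<^sub>R u) x) = G x (t * H1_fun u x)"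
    using H1_fun_scaleR[of t u] by eventually_elim simp
  have m: "(\<lambda>x. G x (H1_fun (t *\<^sub>R u) x)) \<in> borel_measurable lebesgue" "(\<lambda>x. G x (t * H1_fun u x)) \<in> borel_measurable lebesgue"
    by (rule G_measurable, measurable)+
  have "(\<integral>x. G x (H1_fun (t *\<^sub>R u) x) \<partial>lebesgue) = (\<integral>x. G x (t * H1_fun u x) \<partial>lebesgue)"
    by (rule integral_cong_AE[OF m ae])
  then show "J (t *\<^sub>R u) = t\<^sup>2 * schrodinger_form V u u / 2 - (\<integral>x. G x (t * H1_fun u x) \<partial>lebesgue)"
    by (simp add: J_eq schrodinger_form_scaleR_left[OF V_L_infty] schrodinger_form_scaleR_right power2_eq_square)
  show "integrable lebesgue (\<lambda>x. G x (t * H1_fun u x))"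
    using G_integrable[of "t *\<^sub>R u"] integrable_cong_AE[OF m ae] by simp
qed

text \<open>The factor \<open>(t\<^sup>q - 1)/q\<close> is the one for which the \<open>\<Gamma>\<close>-terms on both sides agree.\<close>

lemma G_ray_increment:
  assumes x: "continuous_on UNIV (f x)" and t: "t > 0"
  shows "(t powr q - 1) / q * (g x w * w) \<le> G x (t * w) - G x w"
proof (cases "w = 0")
  case True
  then show ?thesis by simp
next
  case False
  \<comment> \<open>This function is smallest at t = 1: in \<open>fac\<close> its derivative is a
    nonnegative factor times w times the difference of \<open>?k\<close> at \<open>t * w\<close> and
    at \<open>w\<close>, and (F4) makes the sign that of t - 1. For w < 0 both the order of the
    arguments and the factor w are reversed.\<close>
  let ?\<psi> = "\<lambda>t. primitive f x (t * w) - t powr q / q * (f x w * w)"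
  let ?\<psi>' = "\<lambda>t. f x (t * w) * w - t powr (q - 1) * (f x w * w)"
  have d: "(?\<psi> has_real_derivative ?\<psi>' t) (at t)" if "t > 0" for t
  proof -
    have "((\<lambda>t. primitive f x (t * w)) has_real_derivative f x (t * w) * w) (at t)"
      by (rule DERIV_chain2[OF primitive_has_derivative[of f x, OF x]]) (auto intro!: derivative_eq_intros)
    moreover have "((\<lambda>t. t powr q / q * (f x w * w)) has_real_derivative t powr (q - 1) * (f x w * w)) (at t)"
      using that q by (auto intro!: derivative_eq_intros)
    ultimately show ?thesis by (rule DERIV_diff)
  qed
  let ?k = "\<lambda>u. f x u / \<bar>u\<bar> powr (q - 1)"
  have fac: "?\<psi>' t = t powr (q - 1) * \<bar>w\<bar> powr (q - 1) * (w * (?k (t * w) - ?k w))" if "t > 0" for t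
    using False that by (simp add: abs_mult powr_mult field_simps)
  have mono: "strict_mono_on {..<0} ?k" "strict_mono_on {0<..} ?k"
    using F4 by (auto simp: cond_F4_def)
  have mon: "?k a \<le> ?k b" if "a \<le> b" "0 < a \<or> b < 0" for a b
    using that mono strict_mono_onD[OF mono(1), of a b] strict_mono_onD[OF mono(2), of a b]
    by (cases "a = b") auto
  have s1: "?\<psi>' t \<le> 0" if "0 < t" "t \<le> 1" for t
  proof -
    have "w * (?k (t * w) - ?k w) \<le> 0"
    proof (cases "w > 0")
      case True
      then have "?k (t * w) \<le> ?k w" using that by (intro mon) auto
      then show ?thesis using True by (intro mult_nonneg_nonpos) auto
    next
      case f: False
      with False have w: "w < 0" by simp
      have "w \<le> t * w" using mult_right_mono_neg[of t 1 w] that w by simp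
      then have "?k w \<le> ?k (t * w)" using that w by (intro mon) (auto simp: mult_pos_neg)
      then show ?thesis using w by (intro mult_nonpos_nonneg) auto
    qed
    then show ?thesis unfolding fac[OF that(1)] by (rule mult_nonneg_nonpos[rotated]) simp
  qed
  have s2: "0 \<le> ?\<psi>' t" if "1 \<le> t" for t
  proof -
    have t0: "t > 0" using that by simp
    have "0 \<le> w * (?k (t * w) - ?k w)"
    proof (cases "w > 0")
      case True
      then have "w \<le> t * w" using mult_right_mono[OF that, of w] by simp
      then have "?k w \<le> ?k (t * w)" using True by (intro mon) auto
      then show ?thesis using True by simp
    next
      case f: False
      with False have w: "w < 0" by simp
      have "t * w \<le> w" using mult_right_mono_neg[OF that, of w] w by simp
      then have "?k (t * w) \<le> ?k w" using w by (intro mon) auto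
      then show ?thesis using w by (intro mult_nonpos_nonpos) auto
    qed
    then show ?thesis unfolding fac[OF t0] by simp
  qed
  have "?\<psi> 1 \<le> ?\<psi> t"
  proof (cases "t \<le> 1")
    case True
    show ?thesis
    proof (rule DERIV_nonpos_imp_nonincreasing[OF True], intro exI conjI)
      fix s assume "t \<le> s" "s \<le> 1"
      then show "(?\<psi> has_real_derivative ?\<psi>' s) (at s)" "?\<psi>' s \<le> 0" using d[of s] s1[of s] t by simp_all
    qed
  next
    case False
    then have le: "1 \<le> t" by simp
    show ?thesis
    proof (rule DERIV_nonneg_imp_nondecreasing[OF le], intro exI conjI)
      fix s assume "1 \<le> s" "s \<le> t"
      then show "(?\<psi> has_real_derivative ?\<psi>' s) (at s)" "0 \<le> ?\<psi>' s" using d[of s] s2[of s] by simp_all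
    qed
  qed
  then have 1: "(t powr q - 1) / q * (f x w * w) \<le> primitive f x (t * w) - primitive f x w"
    by (simp add: diff_divide_distrib left_diff_distrib)
  have "\<bar>w\<bar> powr (q - 1) * sgn w * w = \<bar>w\<bar> powr q"
  proof -
    have "sgn w * w = \<bar>w\<bar>" by (simp add: sgn_if)
    then show ?thesis using False powr_add[of "\<bar>w\<bar>" "q - 1" 1] by (simp only: mult.assoc) simp
  qed
  then have "(t powr q - 1) / q * (g x w * w) = (t powr q - 1) / q * (f x w * w) - (t powr q - 1) / q * (\<Gamma> x * \<bar>w\<bar> powr q)"
    by (simp add: g_def left_diff_distrib right_diff_distrib mult.assoc)
  moreover have "G x (t * w) - G x w = primitive f x (t * w) - primitive f x w - (t powr q - 1) / q * (\<Gamma> x * \<bar>w\<bar> powr q)"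
    using t by (simp add: G_def abs_mult powr_mult algebra_simps diff_divide_distrib)
  ultimately show ?thesis using 1 by linarith
qed

text \<open>On the Nehari manifold the integral of \<open>g\<close> against \<open>u\<close> equals
  the form, so the nonlinear part grows by at least (t^q - 1)/q times the form. The quadratic part
  grows by (t^2 - 1)/2 times the form, which is no more when the form is nonnegative.\<close>

lemma J_ray_le:
  assumes u: "u \<in> nehari V \<Gamma> f q" and B: "0 \<le> schrodinger_form V u u" and t: "t > 0"
  shows "J (t *\<^sub>R u) \<le> J u"
proof -
  let ?w = "H1_fun u" and ?B = "schrodinger_form V u u"
  have eq: "?B = (\<integral>x. g x (?w x) * ?w x \<partial>lebesgue)" using u by (simp add: nehari_iff)
  have "(t powr q - 1) / q * ?B = (\<integral>x. (t powr q - 1) / q * (g x (?w x) * ?w x) \<partial>lebesgue)"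
    by (simp add: eq)
  also have "\<dots> \<le> (\<integral>x. G x (t * ?w x) - G x (?w x) \<partial>lebesgue)"
  proof (rule integral_mono_AE)
    show "integrable lebesgue (\<lambda>x. (t powr q - 1) / q * (g x (?w x) * ?w x))" using g_integrable[of u u] by simp
    show "integrable lebesgue (\<lambda>x. G x (t * ?w x) - G x (?w x))" using G_integrable[of u] G_scaleR_integrable[of t u] by simp
    show "AE x in lebesgue. (t powr q - 1) / q * (g x (?w x) * ?w x) \<le> G x (t * ?w x) - G x (?w x)"
      using f_continuous by eventually_elim (rule G_ray_increment[OF _ t])
  qed
  also have "\<dots> = (\<integral>x. G x (t * ?w x) \<partial>lebesgue) - (\<integral>x. G x (?w x) \<partial>lebesgue)"
    using G_integrable[of u] G_scaleR_integrable[of t u] by simp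
  finally have "J (t *\<^sub>R u) - J u \<le> (t\<^sup>2 - 1) / 2 * ?B - (t powr q - 1) / q * ?B"
    by (simp add: J_scaleR J_eq[of u] left_diff_distrib diff_divide_distrib)
  also have "\<dots> \<le> 0"
    using mult_right_mono[OF powr_square_le[OF t q] B] by simp
  finally show ?thesis by simp
qed

section \<open>Mountain pass geometry on rays\<close>

lemma primitive_growth:
  assumes "\<epsilon> > 0"
  obtains C where "C \<ge> 0"
    "\<And>x u. continuous_on UNIV (f x) \<Longrightarrow> \<bar>primitive f x u\<bar> \<le> \<epsilon> * u\<^sup>2 + C * \<bar>u\<bar> powr p"
proof -
  obtain C where C: "C \<ge> 0" "\<And>x u. \<bar>f x u\<bar> \<le> \<epsilon> * \<bar>u\<bar> + C * \<bar>u\<bar> powr (p - 1)"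
    using f_growth[OF assms] by blast
  have "\<bar>primitive f x u\<bar> \<le> \<epsilon> * u\<^sup>2 + C * \<bar>u\<bar> powr p" if x: "continuous_on UNIV (f x)" for x u
  proof -
    have "norm (primitive f x u - primitive f x 0) \<le> (\<epsilon> * \<bar>u\<bar> + C * \<bar>u\<bar> powr (p - 1)) * norm (u - 0)"
    proof (rule field_differentiable_bound[of "{- \<bar>u\<bar>..\<bar>u\<bar>}" _ "f x"])
      fix s assume "s \<in> {- \<bar>u\<bar>..\<bar>u\<bar>}"
      then have s: "\<bar>s\<bar> \<le> \<bar>u\<bar>" by auto
      show "(primitive f x has_field_derivative f x s) (at s within {- \<bar>u\<bar>..\<bar>u\<bar>})"
        by (rule has_field_derivative_at_within) (rule primitive_has_derivative[of f x, OF x])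
      have "\<epsilon> * \<bar>s\<bar> + C * \<bar>s\<bar> powr (p - 1) \<le> \<epsilon> * \<bar>u\<bar> + C * \<bar>u\<bar> powr (p - 1)"
        using s p2 assms C(1) by (intro add_mono mult_left_mono powr_mono2) auto
      then show "norm (f x s) \<le> \<epsilon> * \<bar>u\<bar> + C * \<bar>u\<bar> powr (p - 1)"
        using C(2)[of x s] by simp
    qed auto
    also have "(\<epsilon> * \<bar>u\<bar> + C * \<bar>u\<bar> powr (p - 1)) * norm (u - 0) = \<epsilon> * u\<^sup>2 + C * (\<bar>u\<bar> powr (p - 1) * \<bar>u\<bar> powr 1)"
      by (simp add: algebra_simps power2_eq_square)
    also have "\<bar>u\<bar> powr (p - 1) * \<bar>u\<bar> powr 1 = \<bar>u\<bar> powr p" by (simp only: powr_add[symmetric]) simp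
    finally show ?thesis by (simp add: primitive_0)
  qed
  with C(1) show ?thesis by (rule that)
qed

lemma primitive_superlinear:
  obtains R where "R > 0" "\<And>x u. \<bar>u\<bar> \<ge> R \<Longrightarrow> M * \<bar>u\<bar> powr q \<le> primitive f x u"
proof -
  have "\<forall>\<^sub>F u in at_infinity. \<forall>x. M \<le> primitive f x u / \<bar>u\<bar> powr q" using F3 by (simp add: cond_F3_def)
  then obtain R where R: "\<And>u x. R \<le> \<bar>u\<bar> \<Longrightarrow> M \<le> primitive f x u / \<bar>u\<bar> powr q"
    by (auto simp: eventually_at_infinity)
  have "M * \<bar>u\<bar> powr q \<le> primitive f x u" if "\<bar>u\<bar> \<ge> \<bar>R\<bar> + 1" for x u
  proof -
    have "u \<noteq> 0" "R \<le> \<bar>u\<bar>" using that by auto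
    then show ?thesis using R[of u x] by (simp add: field_simps)
  qed
  then show ?thesis using that[of "\<bar>R\<bar> + 1"] by simp
qed

text \<open>For large \<open>\<bar>u\<bar>\<close> the primitive is nonnegative, which is (F3) with
  M = 0; for \<open>\<bar>u\<bar> < R\<close> its p-th power bound is absorbed into u^2. The
  estimate controls the points where a scaled function is still small.\<close>

lemma primitive_lower:
  obtains C where "C \<ge> 0" "\<And>x u. continuous_on UNIV (f x) \<Longrightarrow> - C * u\<^sup>2 \<le> primitive f x u"
proof -
  obtain R where R: "R > 0" "\<And>x u. \<bar>u\<bar> \<ge> R \<Longrightarrow> 0 * \<bar>u\<bar> powr q \<le> primitive f x u"
    by (rule primitive_superlinear[of 0]) blast
  obtain C where C: "C \<ge> 0"
    "\<And>x u. continuous_on UNIV (f x) \<Longrightarrow> \<bar>primitive f x u\<bar> \<le> 1 * u\<^sup>2 + C * \<bar>u\<bar> powr p"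
    using primitive_growth[of 1] by auto
  let ?C = "1 + C * R powr (p - 2)"
  have "- ?C * u\<^sup>2 \<le> primitive f x u" if x: "continuous_on UNIV (f x)" for x u
  proof (cases "\<bar>u\<bar> \<ge> R")
    case True
    have "0 \<le> ?C * u\<^sup>2" using C(1) by simp
    then show ?thesis using R(2)[OF True, of x] by linarith
  next
    case False
    have "\<bar>u\<bar> powr p \<le> R powr (p - 2) * u\<^sup>2"
    proof (cases "u = 0")
      case f: False
      have "\<bar>u\<bar> powr p = \<bar>u\<bar> powr (p - 2) * u\<^sup>2"
        using f powr_add[of "\<bar>u\<bar>" "p - 2" 2] by simp
      also have "\<dots> \<le> R powr (p - 2) * u\<^sup>2"
        using False p2 by (intro mult_right_mono powr_mono2) auto
      finally show ?thesis .
    qed simp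
    then have "C * \<bar>u\<bar> powr p \<le> C * (R powr (p - 2) * u\<^sup>2)" using C(1) by (rule mult_left_mono)
    then have "\<bar>primitive f x u\<bar> \<le> ?C * u\<^sup>2"
      using C(2)[OF x, of u] by (simp only: distrib_right mult.assoc mult_1_left)
    then show ?thesis by linarith
  qed
  then show ?thesis using that[of ?C] C(1) by simp
qed

lemma J_positive_near_0:
  assumes B: "schrodinger_form V v v > 0"
  obtains t where "t > 0" "J (t *\<^sub>R v) > 0"
proof -
  let ?w = "H1_fun v" and ?B = "schrodinger_form V v v"
  let ?A = "\<integral>x. (?w x)\<^sup>2 \<partial>lebesgue" and ?P = "\<integral>x. \<bar>?w x\<bar> powr p \<partial>lebesgue"
  have A0: "?A \<ge> 0" "?P \<ge> 0" by simp_all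
  \<comment> \<open>Makes the quadratic error at most a quarter of the form.\<close>
  define \<epsilon> where "\<epsilon> = ?B / (4 * (?A + 1))"
  have \<epsilon>: "\<epsilon> > 0" using B A0 by (simp add: \<epsilon>_def add_nonneg_pos)
  have \<epsilon>A: "\<epsilon> * ?A \<le> ?B / 4"
  proof -
    have "\<epsilon> * ?A \<le> \<epsilon> * (?A + 1)" using \<epsilon> by simp
    also have "\<dots> = ?B / 4"
    proof -
      have "b / (4 * X) * X = b / 4" if "X > 0" for b X :: real using that by simp
      from this[of "?A + 1" ?B] show ?thesis unfolding \<epsilon>_def using A0 by (simp only: add_nonneg_pos zero_less_one)
    qed
    finally show ?thesis .
  qed
  obtain C where C: "C \<ge> 0" "\<And>x u. continuous_on UNIV (f x) \<Longrightarrow> \<bar>primitive f x u\<bar> \<le> \<epsilon> * u\<^sup>2 + C * \<bar>u\<bar> powr p"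
    using primitive_growth[OF \<epsilon>] by blast
  let ?K = "C * ?P"
  have K: "?K \<ge> 0" using C(1) A0 by simp
  \<comment> \<open>Solves \<open>t powr (p - 2) = ?B / (8 * (?K + 1))\<close>, which keeps the p-th
    power error below another quarter; the \<open>\<Gamma>\<close> term has the favourable
    sign.\<close>
  define t where "t = (?B / (8 * (?K + 1))) powr (1 / (p - 2))"
  have bp: "?B / (8 * (?K + 1)) > 0" using B K by (simp add: add_nonneg_pos)
  have t: "t > 0" unfolding t_def powr_gt_zero using bp by (rule less_imp_neq[symmetric])
  have tp: "?K * t powr (p - 2) < ?B / 4"
  proof -
    have "1 / (p - 2) * (p - 2) = 1" using p2 by simp
    then have tt: "t powr (p - 2) = ?B / (8 * (?K + 1))"
      by (simp only: t_def powr_powr powr_one[OF less_imp_le[OF bp]])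
    have "?K * t powr (p - 2) \<le> (?K + 1) * t powr (p - 2)" by (intro mult_right_mono) auto
    also have "\<dots> = ?B / 8"
    proof -
      have "X * (b / (8 * X)) = b / 8" if "X > 0" for b X :: real using that by simp
      from this[of "?K + 1" ?B] show ?thesis unfolding tt using K by (simp only: add_nonneg_pos zero_less_one)
    qed
    finally show ?thesis using B by linarith
  qed
  have "(\<integral>x. G x (t * ?w x) \<partial>lebesgue) \<le> (\<integral>x. \<epsilon> * t\<^sup>2 * (?w x)\<^sup>2 + C * t powr p * \<bar>?w x\<bar> powr p \<partial>lebesgue)"
  proof (rule integral_mono_AE[OF G_scaleR_integrable])
    show "integrable lebesgue (\<lambda>x. \<epsilon> * t\<^sup>2 * (?w x)\<^sup>2 + C * t powr p * \<bar>?w x\<bar> powr p)"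
      using H1_fun_square[of v] powr_integrable[of p v] p2 by simp
    obtain D where "AE x in lebesgue. 0 \<le> \<Gamma> x \<and> \<Gamma> x \<le> D" using \<Gamma>_bound by blast
    then show "AE x in lebesgue. G x (t * ?w x) \<le> \<epsilon> * t\<^sup>2 * (?w x)\<^sup>2 + C * t powr p * \<bar>?w x\<bar> powr p"
      using f_continuous
    proof eventually_elim
      case (elim x)
      have "0 \<le> 1 / q * \<Gamma> x * \<bar>t * ?w x\<bar> powr q" using elim q by simp
      then have "G x (t * ?w x) \<le> \<epsilon> * (t * ?w x)\<^sup>2 + C * \<bar>t * ?w x\<bar> powr p"
        using C(2)[OF elim(2), of "t * ?w x"] unfolding G_def by linarith
      then show ?case using t by (simp add: power_mult_distrib abs_mult powr_mult mult.assoc)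
    qed
  qed
  also have "\<dots> = t\<^sup>2 * (\<epsilon> * ?A) + t powr p * ?K"
    using H1_fun_square[of v] powr_integrable[of p v] p2 by simp
  also have "t powr p = t\<^sup>2 * t powr (p - 2)"
    using t powr_add[of t 2 "p - 2"] by simp
  also have "t\<^sup>2 * (\<epsilon> * ?A) + t\<^sup>2 * t powr (p - 2) * ?K = t\<^sup>2 * (\<epsilon> * ?A + ?K * t powr (p - 2))"
    by (simp add: algebra_simps)
  also have "\<dots> < t\<^sup>2 * (?B / 2)"
    using t \<epsilon>A tp by (intro mult_strict_left_mono) auto
  finally have "J (t *\<^sub>R v) > 0" by (simp add: J_scaleR)
  with t show ?thesis by (rule that)
qed

text \<open>(F3) is effective only where the scaled function exceeds a fixed radius, so a set on
  which \<open>v\<close> stays away from 0 is needed. The sets with thresholds 1/(n+1) exhaust the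
  points where \<open>v\<close> is nonzero, and the full integral is positive.\<close>

lemma H1_fun_nontrivial:
  assumes "v \<noteq> 0"
  obtains \<delta> where "\<delta> > 0" "(\<integral>x. indicator {x. \<delta> \<le> \<bar>H1_fun (v :: 'n H1) x\<bar>} x * \<bar>H1_fun v x\<bar> powr q \<partial>lebesgue) > 0"
proof -
  let ?w = "H1_fun v"
  let ?s = "\<lambda>n x. indicator {x. 1 / real (Suc n) \<le> \<bar>?w x\<bar>} x * \<bar>?w x\<bar> powr q"
  have iq: "integrable lebesgue (\<lambda>x. \<bar>?w x\<bar> powr q)" using powr_integrable[of q v] q qp by simp
  have "(\<lambda>n. \<integral>x. ?s n x \<partial>lebesgue) \<longlonglongrightarrow> (\<integral>x. \<bar>?w x\<bar> powr q \<partial>lebesgue)"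
  proof (rule integral_dominated_convergence[OF _ _ iq])
    show "AE x in lebesgue. (\<lambda>n. ?s n x) \<longlonglongrightarrow> \<bar>?w x\<bar> powr q"
    proof (intro always_eventually allI)
      fix x
      show "(\<lambda>n. ?s n x) \<longlonglongrightarrow> \<bar>?w x\<bar> powr q"
      proof (cases "?w x = 0")
        case True
        then show ?thesis by simp
      next
        case False
        have "\<forall>\<^sub>F n in sequentially. 1 / real (Suc n) < \<bar>?w x\<bar>"
          using order_tendstoD(2)[OF LIMSEQ_Suc[OF lim_1_over_n], of "\<bar>?w x\<bar>"] False by simp
        then have "\<forall>\<^sub>F n in sequentially. ?s n x = \<bar>?w x\<bar> powr q"
          by eventually_elim (simp add: indicator_def)
        then show ?thesis by (rule tendsto_eventually)
      qed
    qed
    show "AE x in lebesgue. norm (?s n x) \<le> \<bar>?w x\<bar> powr q" for n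
      by (intro always_eventually) (simp add: indicator_def)
  qed measurable
  moreover have "(\<integral>x. \<bar>?w x\<bar> powr q \<partial>lebesgue) > 0"
  proof -
    have "(\<integral>x. \<bar>?w x\<bar> powr q \<partial>lebesgue) \<noteq> 0"
    proof
      assume "(\<integral>x. \<bar>?w x\<bar> powr q \<partial>lebesgue) = 0"
      then have "AE x in lebesgue. \<bar>?w x\<bar> powr q = 0"
        by (subst (asm) integral_nonneg_eq_0_iff_AE[OF iq]) auto
      then have "AE x in lebesgue. rep_L2 (H1_L2 v) x = rep_L2 0 x"
        using rep_L2_0 by eventually_elim (simp add: H1_fun_eq)
      then have "H1_L2 v = 0" by (rule L2_eqI)
      with assms show False by (simp add: H1_L2_eq_0_iff)
    qed
    moreover have "(\<integral>x. \<bar>?w x\<bar> powr q \<partial>lebesgue) \<ge> 0" by simp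
    ultimately show ?thesis by linarith
  qed
  ultimately have "\<forall>\<^sub>F n in sequentially. (\<integral>x. ?s n x \<partial>lebesgue) > 0" by (rule order_tendstoD(1))
  then obtain n where "(\<integral>x. ?s n x \<partial>lebesgue) > 0" by (auto simp: eventually_sequentially)
  then show ?thesis using that[of "1 / real (Suc n)"] by simp
qed

text \<open>The \<open>\<Gamma>\<close> term also grows like t^q, so a superlinear gain of the same
  order must beat it by its constant; (F3) provides every constant \<open>M\<close>.\<close>

lemma J_negative_far:
  assumes v: "v \<noteq> 0"
  obtains t where "t > T" "J (t *\<^sub>R v) < 0"
proof -
  let ?w = "H1_fun v" and ?B = "schrodinger_form V v v"
  let ?A = "\<integral>x. (?w x)\<^sup>2 \<partial>lebesgue" and ?Q = "\<integral>x. \<bar>?w x\<bar> powr q \<partial>lebesgue"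
  obtain \<delta> where \<delta>: "\<delta> > 0" "(\<integral>x. indicator {x. \<delta> \<le> \<bar>?w x\<bar>} x * \<bar>?w x\<bar> powr q \<partial>lebesgue) > 0"
    using H1_fun_nontrivial[OF v] by blast
  let ?i = "\<lambda>x. indicator {x. \<delta> \<le> \<bar>?w x\<bar>} x * \<bar>?w x\<bar> powr q"
  let ?m = "\<integral>x. ?i x \<partial>lebesgue"
  have iq: "integrable lebesgue (\<lambda>x. \<bar>?w x\<bar> powr q)" using powr_integrable[of q v] q qp by simp
  have ii: "integrable lebesgue ?i"
    by (rule Bochner_Integration.integrable_bound[OF iq]) (measurable, simp add: indicator_def)
  obtain C where C: "C \<ge> 0" "\<And>x u. continuous_on UNIV (f x) \<Longrightarrow> - C * u\<^sup>2 \<le> primitive f x u"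
    using primitive_lower by blast
  obtain D where D: "D \<ge> 0" "AE x in lebesgue. 0 \<le> \<Gamma> x \<and> \<Gamma> x \<le> D" by (rule \<Gamma>_bound)
  \<comment> \<open>Since \<open>t\<^sup>2 \<le> t powr q\<close>, all terms except the gain add up
    to at most \<open>S * t powr q\<close>. With \<open>M * ?m = S + 1\<close> the energy is at most
    \<open>- (t powr q)\<close>.\<close>
  define S where "S = \<bar>?B\<bar> / 2 + C * ?A + D / q * ?Q"
  have S: "S \<ge> 0" using C(1) D(1) q by (simp add: S_def)
  define M where "M = (S + 1) / ?m"
  have M0: "M \<ge> 0" using S \<delta>(2) by (simp add: M_def)
  obtain R where R: "R > 0" "\<And>x u. \<bar>u\<bar> \<ge> R \<Longrightarrow> M * \<bar>u\<bar> powr q \<le> primitive f x u"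
    by (rule primitive_superlinear[of M]) blast
  define t where "t = max (\<bar>T\<bar> + 1) (R / \<delta>)"
  have t: "t \<ge> 1" "t > T" "t * \<delta> \<ge> R"
  proof -
    show "t \<ge> 1" "t > T" by (auto simp: t_def)
    have "R / \<delta> \<le> t" by (simp add: t_def)
    then show "t * \<delta> \<ge> R" using \<delta>(1) by (simp add: field_simps)
  qed
  have t2: "t\<^sup>2 \<le> t powr q" using powr_mono[of 2 q t] q t(1) by simp
  let ?low = "\<lambda>x. M * t powr q * ?i x - C * t\<^sup>2 * (?w x)\<^sup>2 - D / q * t powr q * \<bar>?w x\<bar> powr q"
  have "(\<integral>x. ?low x \<partial>lebesgue) \<le> (\<integral>x. G x (t * ?w x) \<partial>lebesgue)"
  proof (rule integral_mono_AE[OF _ G_scaleR_integrable])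
    show "integrable lebesgue ?low" using ii iq H1_fun_square[of v] by simp
    show "AE x in lebesgue. ?low x \<le> G x (t * ?w x)"
      using D(2) f_continuous
    proof eventually_elim
      case (elim x)
      have tw: "\<bar>t * ?w x\<bar> powr q = t powr q * \<bar>?w x\<bar> powr q" using t by (simp add: abs_mult powr_mult)
      have "M * t powr q * ?i x - C * t\<^sup>2 * (?w x)\<^sup>2 \<le> primitive f x (t * ?w x)"
      proof (cases "\<delta> \<le> \<bar>?w x\<bar>")
        case True
        have "t * \<delta> \<le> t * \<bar>?w x\<bar>" using True t by (intro mult_left_mono) auto
        with t(3) have "R \<le> t * \<bar>?w x\<bar>" by linarith
        then have "R \<le> \<bar>t * ?w x\<bar>" using t by (simp add: abs_mult)
        from R(2)[OF this, of x] have "M * t powr q * ?i x \<le> primitive f x (t * ?w x)"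
          using True by (simp add: tw mult.assoc)
        moreover have "0 \<le> C * t\<^sup>2 * (?w x)\<^sup>2" using C(1) by simp
        ultimately show ?thesis by linarith
      next
        case False
        then show ?thesis using C(2)[OF elim(2), of "t * ?w x"] by (simp add: power_mult_distrib mult.assoc)
      qed
      moreover have "1 / q * \<Gamma> x * \<bar>t * ?w x\<bar> powr q \<le> D / q * t powr q * \<bar>?w x\<bar> powr q"
        using elim q unfolding tw by (simp add: field_simps mult_right_mono)
      ultimately show ?case unfolding G_def by linarith
    qed
  qed
  also have "(\<integral>x. ?low x \<partial>lebesgue) = M * t powr q * ?m - C * t\<^sup>2 * ?A - D / q * t powr q * ?Q"
    using ii iq H1_fun_square[of v] by simp
  finally have G: "M * t powr q * ?m - C * t\<^sup>2 * ?A - D / q * t powr q * ?Q \<le> (\<integral>x. G x (t * ?w x) \<partial>lebesgue)" .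
  have Mm: "M * t powr q * ?m = t powr q * (S + 1)" using \<delta>(2) by (simp add: M_def)
  have "t\<^sup>2 * (\<bar>?B\<bar> / 2 + C * ?A) \<le> t powr q * (\<bar>?B\<bar> / 2 + C * ?A)"
    using t2 C(1) by (intro mult_right_mono) auto
  moreover have "t\<^sup>2 * ?B \<le> t\<^sup>2 * \<bar>?B\<bar>" by (intro mult_left_mono) auto
  moreover have "t powr q * (S + 1) = t powr q * (\<bar>?B\<bar> / 2 + C * ?A) + D / q * t powr q * ?Q + t powr q"
    by (simp add: S_def algebra_simps)
  moreover have "t\<^sup>2 * (\<bar>?B\<bar> / 2 + C * ?A) = t\<^sup>2 * \<bar>?B\<bar> / 2 + C * t\<^sup>2 * ?A" by (simp add: algebra_simps)
  moreover have "t powr q > 0" using t by simp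
  ultimately have "J (t *\<^sub>R v) < 0" unfolding J_scaleR using G Mm by linarith
  with t(2) show ?thesis by (rule that)
qed

text \<open>The energy is 0 at the origin of the ray, positive somewhere and negative further out,
  so its maximum over \<open>{0..t1}\<close> is interior. The derivative along \<open>v\<close>
  vanishes there, and by linearity so does the one along \<open>t *\<^sub>R v\<close>.\<close>

lemma nehari_ray:
  assumes v: "v \<noteq> 0" and B: "schrodinger_form V v v > 0"
  obtains t where "t > 0" "t *\<^sub>R v \<in> nehari V \<Gamma> f q"
proof -
  let ?D = "\<lambda>u v. schrodinger_form V u v - (\<integral>x. g x (H1_fun u x) * H1_fun v x \<partial>lebesgue)"
  obtain t0 where t0: "t0 > 0" "J (t0 *\<^sub>R v) > 0" using J_positive_near_0[OF B] by blast
  obtain t1 where t1: "t1 > t0" "J (t1 *\<^sub>R v) < 0" using J_negative_far[OF v] by blast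
  let ?\<phi> = "\<lambda>t. J (t *\<^sub>R v)"
  have d: "(?\<phi> has_real_derivative ?D (t *\<^sub>R v) v) (at t)" for t
  proof -
    have "((\<lambda>t. t *\<^sub>R v) has_derivative (\<lambda>h. h *\<^sub>R v)) (at t)" by (auto intro!: derivative_eq_intros)
    from has_derivative_compose[OF this J_has_derivative]
    have "(?\<phi> has_derivative (\<lambda>h. ?D (t *\<^sub>R v) (h *\<^sub>R v))) (at t)" .
    moreover have "?D (t *\<^sub>R v) (h *\<^sub>R v) = ?D (t *\<^sub>R v) v * h" for h
      using linear_scale[OF has_derivative_linear[OF J_has_derivative[of "t *\<^sub>R v"]], of h v] by simp
    ultimately show ?thesis by (simp add: has_field_derivative_def)
  qed
  have "continuous_on {0..t1} ?\<phi>"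
    using d by (intro continuous_at_imp_continuous_on) (auto intro: DERIV_isCont)
  then obtain t where t: "t \<in> {0..t1}" and max: "\<And>s. s \<in> {0..t1} \<Longrightarrow> ?\<phi> s \<le> ?\<phi> t"
    using continuous_attains_sup[of "{0..t1}" ?\<phi>] t0 t1 by auto
  have pos: "?\<phi> t > 0" using max[of t0] t0 t1 by auto
  have "(\<integral>x. G x 0 \<partial>lebesgue) = 0" using q by (simp add: G_def primitive_0)
  then have "?\<phi> 0 = 0" using J_scaleR[of 0 v] by simp
  then have tt: "0 < t" "t < t1" using t pos t1 by (auto simp: less_le)
  have "?D (t *\<^sub>R v) v = 0"
  proof (rule DERIV_local_max[OF d])
    show "0 < min t (t1 - t)" using tt by simp
    show "\<forall>y. \<bar>t - y\<bar> < min t (t1 - t) \<longrightarrow> ?\<phi> y \<le> ?\<phi> t"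
      by (intro allI impI max) auto
  qed
  then have "?D (t *\<^sub>R v) (t *\<^sub>R v) = 0"
    using linear_scale[OF has_derivative_linear[OF J_has_derivative[of "t *\<^sub>R v"]], of t v] by simp
  then have "t *\<^sub>R v \<in> nehari V \<Gamma> f q" using v tt by (simp add: nehari_iff)
  with tt(1) show ?thesis by (rule that)
qed

section \<open>Lattice translations and the localised potential\<close>

definition pot :: "'n H1 \<Rightarrow> real" where
  "pot u = (\<integral>x. Vloc x * (H1_fun u x)\<^sup>2 \<partial>lebesgue)"

lemma form_split: "schrodinger_form V u u = schrodinger_form Vper u u + pot u"
  unfolding V_eq schrodinger_form_potential_add[OF Vper(1) Vloc(1)] inner_mult_L2[OF Vloc(1)] pot_def
  by (simp add: H1_fun_eq power2_eq_square mult.assoc)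

lemma pot_scaleR: "pot (t *\<^sub>R u) = t\<^sup>2 * pot u"
proof -
  have "schrodinger_form Vper (t *\<^sub>R u) (t *\<^sub>R u) = t\<^sup>2 * schrodinger_form Vper u u"
    "schrodinger_form V (t *\<^sub>R u) (t *\<^sub>R u) = t\<^sup>2 * schrodinger_form V u u"
    using Vper(1) V_L_infty
    by (simp_all add: schrodinger_form_scaleR_left schrodinger_form_scaleR_right power2_eq_square)
  then show ?thesis using form_split[of u] form_split[of "t *\<^sub>R u"] by (simp add: distrib_left)
qed

lemma pot_integrable: "integrable lebesgue (\<lambda>x. Vloc x * (H1_fun u x)\<^sup>2)"
  using square_integrable_mult[OF square_integrable_mult_L_infty[OF Vloc(1) rep_L2_square_integrable[of "H1_L2 u"]]
      rep_L2_square_integrable[of "H1_L2 u"]]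
  by (simp add: H1_fun_eq power2_eq_square mult.assoc)

lemma pot_pos:
  assumes "u \<noteq> 0"
  shows "pot u > 0"
proof -
  have nn: "AE x in lebesgue. 0 \<le> Vloc x * (H1_fun u x)\<^sup>2"
    using Vloc_pos by eventually_elim simp
  then have "pot u \<ge> 0" unfolding pot_def by (rule integral_nonneg_AE)
  moreover have "pot u \<noteq> 0"
  proof
    assume "pot u = 0"
    then have "AE x in lebesgue. Vloc x * (H1_fun u x)\<^sup>2 = 0"
      unfolding pot_def by (subst (asm) integral_nonneg_eq_0_iff_AE[OF pot_integrable nn]) auto
    then have "AE x in lebesgue. rep_L2 (H1_L2 u) x = rep_L2 0 x"
      using Vloc_pos rep_L2_0 by eventually_elim (simp add: H1_fun_eq)
    then have "H1_L2 u = 0" by (rule L2_eqI)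
    with assms show False by (simp add: H1_L2_eq_0_iff)
  qed
  ultimately show ?thesis by linarith
qed

text \<open>The periodic form is nonnegative by the spectral assumption, and the localised potential
  contributes strict positivity.\<close>

lemma form_pos:
  assumes "u \<noteq> 0"
  shows "schrodinger_form V u u > 0"
proof -
  obtain m where m: "m > 0" "\<And>u. m * (norm (H1_L2 u))\<^sup>2 \<le> schrodinger_form Vper u u"
    using schrodinger_form_coercive[OF Vper(1) spectrum_pos] by blast
  have "0 \<le> m * (norm (H1_L2 u))\<^sup>2" using m(1) by simp
  then show ?thesis using m(2)[of u] pot_pos[OF assms] form_split[of u] by linarith
qed

lemma Vper_form_translate:
  assumes z: "z \<in> int_lattice"
  shows "schrodinger_form Vper (translate_H1 z u) (translate_H1 z u) = schrodinger_form Vper u u"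
proof -
  have [measurable]: "Vper \<in> borel_measurable lebesgue" using Vper by (simp add: L_infty_def)
  let ?w = "rep_L2 (H1_L2 u)"
  have "inner (mult_L2 Vper (translate_L2 z (H1_L2 u))) (translate_L2 z (H1_L2 u)) =
      (\<integral>x. Vper (x + z) * ?w (x + z) * ?w (x + z) \<partial>lebesgue)"
    unfolding inner_mult_L2[OF Vper(1)]
  proof (rule integral_cong_AE)
    have "AE x in lebesgue. Vper (x + z) = Vper x" using Vper(2) z by (simp add: periodic_AE_def)
    then show "AE x in lebesgue. Vper x * rep_L2 (translate_L2 z (H1_L2 u)) x * rep_L2 (translate_L2 z (H1_L2 u)) x =
        Vper (x + z) * ?w (x + z) * ?w (x + z)"
      using rep_translate_L2[of z "H1_L2 u"] by eventually_elim simp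
  qed (auto intro!: borel_measurable_times measurable_lebesgue_translate)
  also have "\<dots> = inner (mult_L2 Vper (H1_L2 u)) (H1_L2 u)"
    unfolding inner_mult_L2[OF Vper(1)]
    using integral_lebesgue_translate[of "\<lambda>x. Vper x * ?w x * ?w x" z] by simp
  finally show ?thesis
    by (simp add: schrodinger_form_def H1_L2_translate inner_vec_def H1_partial_translate inner_translate_L2)
qed

lemma G_integral_translate:
  assumes z: "z \<in> int_lattice"
  shows "(\<integral>x. G x (H1_fun (translate_H1 z u) x) \<partial>lebesgue) = (\<integral>x. G x (H1_fun u x) \<partial>lebesgue)"
proof -
  \<comment> \<open>One null set has to serve all s, since the value u(x + z), which depends on x,
    is substituted for s.\<close>
  have per: "AE x in lebesgue. \<forall>s. G (x + z) s = G x s"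
  proof -
    have "f (x + z) = f x" for x using F1 z by (auto simp: cond_F1_def)
    moreover have "AE x in lebesgue. \<Gamma> (x + z) = \<Gamma> x" using \<Gamma> z by (simp add: cond_Gamma_def periodic_AE_def)
    ultimately show ?thesis unfolding G_def primitive_def by (auto elim!: eventually_mono)
  qed
  have m: "(\<lambda>x. G x (H1_fun v x)) \<in> borel_measurable lebesgue" for v
    by (rule G_measurable) measurable
  have "(\<integral>x. G x (H1_fun (translate_H1 z u) x) \<partial>lebesgue) = (\<integral>x. G (x + z) (H1_fun u (x + z)) \<partial>lebesgue)"
  proof (rule integral_cong_AE[OF m measurable_lebesgue_translate[OF m]])
    show "AE x in lebesgue. G x (H1_fun (translate_H1 z u) x) = G (x + z) (H1_fun u (x + z))"
      using per H1_fun_translate[of z u] by eventually_elim simp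
  qed
  also have "\<dots> = (\<integral>x. G x (H1_fun u x) \<partial>lebesgue)" by (rule integral_lebesgue_translate[OF m])
  finally show ?thesis .
qed

lemma J_translate:
  assumes "z \<in> int_lattice"
  shows "J (translate_H1 z u) = J u + (pot (translate_H1 z u) - pot u) / 2"
  using form_split[of u] form_split[of "translate_H1 z u"] Vper_form_translate[OF assms, of u]
    G_integral_translate[OF assms, of u] by (simp add: J_eq field_simps)

text \<open>A change of variables moves the shift from \<open>u\<close> to \<open>Vloc\<close>. The
  integrand is then dominated by a multiple of u^2, while at almost every x the shifted argument
  leaves every ball.\<close>

lemma pot_translate_tendsto_0:
  fixes i :: 'n
  shows "(\<lambda>n. pot (translate_H1 (real n *\<^sub>R axis i 1) u)) \<longlonglongrightarrow> 0"
proof -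
  have [measurable]: "Vloc \<in> borel_measurable lebesgue" using Vloc by (simp add: L_infty_def)
  let ?z = "\<lambda>n. real n *\<^sub>R axis i 1 :: real^'n"
  let ?s = "\<lambda>n x. Vloc (x + - ?z n) * (H1_fun u x)\<^sup>2"
  have mV: "(\<lambda>x. Vloc (x + - ?z n)) \<in> borel_measurable lebesgue" for n
    by (rule measurable_lebesgue_translate) measurable
  have ms: "?s n \<in> borel_measurable lebesgue" for n
    using mV[of n] by measurable
  have pot_eq: "pot (translate_H1 (?z n) u) = (\<integral>x. ?s n x \<partial>lebesgue)" for n
  proof -
    have "pot (translate_H1 (?z n) u) = (\<integral>x. ?s n (x + ?z n) \<partial>lebesgue)"
      unfolding pot_def
    proof (rule integral_cong_AE)
      show "(\<lambda>x. ?s n (x + ?z n)) \<in> borel_measurable lebesgue" by (rule measurable_lebesgue_translate[OF ms])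
      show "AE x in lebesgue. Vloc x * (H1_fun (translate_H1 (?z n) u) x)\<^sup>2 = ?s n (x + ?z n)"
        using H1_fun_translate[of "?z n" u] by eventually_elim (simp add: add.assoc)
    qed measurable
    then show ?thesis using integral_lebesgue_translate[OF ms[of n], of "?z n"] by simp
  qed
  obtain C where C: "AE x in lebesgue. \<bar>Vloc x\<bar> \<le> C" using Vloc by (auto simp: L_infty_def)
  have "\<forall>k. \<exists>R. AE x in lebesgue. norm x \<ge> R \<longrightarrow> \<bar>Vloc x\<bar> < 1 / real (Suc k)"
    using Vloc(2) by (auto simp: vanishes_at_infinity_def)
  then obtain R where R: "\<And>k. AE x in lebesgue. norm x \<ge> R k \<longrightarrow> \<bar>Vloc x\<bar> < 1 / real (Suc k)" by metis
  \<comment> \<open>Tolerances 1/(k+1) and shifts n are countably many, so a single null set covers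
    all exceptions.\<close>
  have all: "AE x in lebesgue. \<forall>n k. norm (x + - ?z n) \<ge> R k \<longrightarrow> \<bar>Vloc (x + - ?z n)\<bar> < 1 / real (Suc k)"
    unfolding AE_all_countable using AE_lebesgue_translate[OF R] by blast
  have "(\<lambda>n. \<integral>x. ?s n x \<partial>lebesgue) \<longlonglongrightarrow> integral\<^sup>L lebesgue (\<lambda>x::real^'n. 0::real)"
  proof (rule integral_dominated_convergence)
    show "integrable lebesgue (\<lambda>x. C * (H1_fun u x)\<^sup>2)" using H1_fun_square[of u] by simp
    show "AE x in lebesgue. norm (?s n x) \<le> C * (H1_fun u x)\<^sup>2" for n
      using AE_lebesgue_translate[OF C, of "- ?z n"] by eventually_elim (simp add: abs_mult mult_right_mono)
    show "AE x in lebesgue. (\<lambda>n. ?s n x) \<longlonglongrightarrow> 0"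
      using all
    proof eventually_elim
      case (elim x)
      have "(\<lambda>n. Vloc (x + - ?z n)) \<longlonglongrightarrow> 0"
      proof (rule LIMSEQ_I)
        fix e :: real assume "e > 0"
        then obtain k where k: "1 / real (Suc k) < e" by (rule nat_approx_posE)
        obtain n0 :: nat where n0: "norm x + R k < real n0" using reals_Archimedean2 by blast
        show "\<exists>n0. \<forall>n\<ge>n0. norm (Vloc (x + - ?z n) - 0) < e"
        proof (intro exI allI impI)
          fix n assume "n \<ge> n0"
          then have "norm x + R k < real n" using n0 by linarith
          moreover have "norm (?z n) = real n" by simp
          moreover have "norm (?z n) \<le> norm x + norm (x + - ?z n)"
            using norm_triangle_ineq4[of x "x + - ?z n"] by simp
          ultimately have "norm (x + - ?z n) \<ge> R k" by linarith
          then have "\<bar>Vloc (x + - ?z n)\<bar> < 1 / real (Suc k)" using elim by blast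
          with k show "norm (Vloc (x + - ?z n) - 0) < e" by simp
        qed
      qed
      from tendsto_mult_right[OF this, of "(H1_fun u x)\<^sup>2"] show ?case by simp
    qed
  qed (use ms in auto)
  then show ?thesis by (simp add: pot_eq)
qed

theorem no_ground_state: "\<not> ground_state V \<Gamma> f q u"
proof
  assume "ground_state V \<Gamma> f q u"
  then have u: "u \<in> nehari V \<Gamma> f q" and min: "ereal (J u) = (INF v\<in>nehari V \<Gamma> f q. ereal (J v))"
    by (auto simp: ground_state_def J_def)
  have u0: "u \<noteq> 0" using u by (simp add: nehari_def)
  \<comment> \<open>Any coordinate direction will do: its integer multiples lie in the lattice and
    are unbounded.\<close>
  fix i :: 'n
  have "\<forall>\<^sub>F n in sequentially. pot (translate_H1 (real n *\<^sub>R axis i 1) u) < pot u"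
    using pot_translate_tendsto_0 pot_pos[OF u0] by (rule order_tendstoD(2))
  then obtain n where n: "pot (translate_H1 (real n *\<^sub>R axis i 1) u) < pot u"
    by (auto simp: eventually_sequentially)
  define z :: "real^'n" where "z = real n *\<^sub>R axis i 1"
  have z: "z \<in> int_lattice" by (auto simp: z_def int_lattice_def axis_def)
  let ?v = "translate_H1 z u"
  have v0: "?v \<noteq> 0" using u0 by (simp add: translate_H1_eq_0_iff)
  obtain t where t: "t > 0" "t *\<^sub>R ?v \<in> nehari V \<Gamma> f q" using nehari_ray[OF v0 form_pos[OF v0]] by blast
  have "J (t *\<^sub>R ?v) = J (t *\<^sub>R u) + t\<^sup>2 * (pot ?v - pot u) / 2"
    using J_translate[OF z, of "t *\<^sub>R u"] by (simp add: translate_H1_scaleR pot_scaleR right_diff_distrib)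
  moreover have "t\<^sup>2 * (pot ?v - pot u) < 0" using t(1) n by (intro mult_pos_neg) (auto simp: z_def)
  moreover have "J (t *\<^sub>R u) \<le> J u" using J_ray_le[OF u _ t(1)] form_pos[OF u0] by simp
  ultimately have "J (t *\<^sub>R ?v) < J u" by linarith
  moreover have "ereal (J u) \<le> ereal (J (t *\<^sub>R ?v))" unfolding min using t(2) by (rule INF_lower)
  ultimately show False by simp
qed

end

theorem theorem1p2:
  fixes V Vper Vloc \<Gamma> :: "real^'n::finite \<Rightarrow> real"
    and f :: "real^'n \<Rightarrow> real \<Rightarrow> real"
    and p q :: real
  assumes "2 \<le> q" and "q < p" and "ereal p < crit_exp CARD('n)"
    and "cond_V V Vper Vloc"
    and "cond_Gamma \<Gamma>"
    and "cond_F1 f p" and "cond_F2 f" and "cond_F3 f q" and "cond_F4 f q"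
    and "(INF \<mu>\<in>spectrum (schrodinger Vper). ereal \<mu>) > 0"
    and "AE x in lebesgue. Vloc x > 0"
  shows "\<not> (\<exists>u. ground_state V \<Gamma> f q u)"
proof -
  interpret nls_problem V Vper Vloc \<Gamma> f p q
    by unfold_locales (fact assms)+
  show ?thesis using no_ground_state by blast
qed

end
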